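(* Let $d,a,b,c_1,c_2$ be positive integers with $d\mid q-1$, let $\lambda_1,\lambda_2\in\kappa^\times\setminus\{1\}$, and let $S_{4,\lambda}$ be the affine surface over $\kappa$ defined by $$y^d=x_1^{\langle a\rangle}x_2^{\langle b\rangle}(1-x_1)^{\langle c_1-a\rangle}(1-x_2)^{\langle c_2-b\rangle}(1-\lambda_1x_1)^{\langle a-c_1-c_2\rangle}(1-\lambda_2x_2)^{\langle b-c_1-c_2\rangle}(1-\lambda_1x_1-\lambda_2x_2)^{\langle c_1+c_2-a-b\rangle},$$ where, for $k\in\mathbb{Z}$, $\langle k\rangle\in\{0,\dots,d-1\}$ denotes the representative of $k$ modulo $d$, with $\mu_d$ acting by $\xi\cdot(x_1,x_2,y)=(x_1,x_2,\xi y)$. Suppose that $\gcd(d,a)=\gcd(d,b)=\gcd(d,c_i-a)=\gcd(d,c_i-b)=1$ for $i=1,2$. For $m\in\mathbb{Z}/d\mathbb{Z}$ and $r\ge1$ define a function over $\kappa_r$ by $$f_r(\lambda_1,\lambda_2)=F_4\big(\varphi_{d,r}^{ma};\varphi_{d,r}^{mb};\varphi_{d,r}^{mc_1},\varphi_{d,r}^{mc_2};\lambda_1(1-\lambda_2),\lambda_2(1-\lambda_1)\big).$$ Then $$L(S_{4,\lambda},\chi^m;t)=\begin{cases}\dfrac{1}{1-q^2t}&(m=0),\\ \exp\Big(\sum_{r=1}^\infty J^r\cdot f_r(\lambda_1,\lambda_2)\dfrac{t^r}{r}\Big)\prod_{i=0}^2(1-S_it)^{-1}&(m\neq0),\end{cases}$$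 where, with $\alpha=\varphi_d^{ma}$, $\beta=\varphi_d^{mb}$, $\gamma_i=\varphi_d^{mc_i}$, $$J=j(\alpha,\overline{\alpha}\gamma_1)\,j(\beta,\overline{\beta}\gamma_2),$$ $$S_0=\alpha\beta(-1)\,j(\alpha\overline{\gamma_2},\beta\overline{\gamma_1})\,\overline{\gamma_1}(\lambda_1)\,\overline{\gamma_2}(\lambda_2),$$ $$S_1=j(\overline{\alpha\beta}\gamma_1\gamma_2,\beta)\,\overline{\gamma_1}(\lambda_1)\,\overline{\alpha}\gamma_1(\lambda_1-1)\,\overline{\beta}(\lambda_2),$$ $$S_2=j(\overline{\alpha\beta}\gamma_1\gamma_2,\alpha)\,\overline{\gamma_2}(\lambda_2)\,\overline{\beta}\gamma_2(\lambda_2-1)\,\overline{\alpha}(\lambda_1).$$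
   Context: $\kappa$ is a finite field with $q$ elements of characteristic $p$. $\widehat{\kappa^\times}=\mathrm{Hom}(\kappa^\times,\overline{\mathbb{Q}}^\times)$ is the group of multiplicative characters, $\varepsilon$ the trivial character, $\overline{\eta}=\eta^{-1}$; every $\eta\in\widehat{\kappa^\times}$ (including $\varepsilon$) is extended to $\kappa$ by $\eta(0)=0$. A product of characters followed by an argument means the product character evaluated there. $\delta(\eta)=1$ if $\eta=\varepsilon$ and $0$ otherwise. Fix a non-trivial additive character $\psi\in\mathrm{Hom}(\kappa,\overline{\mathbb{Q}}^\times)$. Put $$g(\eta)=-\sum_{x\in\kappa^\times}\psi(x)\eta(x),\quad g^\circ(\eta)=q^{\delta(\eta)}g(\eta),\quad j(\eta_1,\eta_2)=-\sum_{x_1,x_2\in\kappa^\times,\ x_1+x_2=1}\eta_1(x_1)\eta_2(x_2),$$ $$(\alpha)_\nu=\frac{g(\alpha\nu)}{g(\alpha)},\qquad(\alpha)_\nu^\circ=\frac{g^\circ(\alpha\nu)}{g^\circ(\alpha)},$$ $$F_4(\alpha;\beta;\gamma_1,\gamma_2;\lambda_1,\lambda_2)=\frac{1}{(1-q)^2}\sum_{\nu_1,\nu_2\in\widehat{\kappa^\times}}\frac{(\alpha)_{\nu_1\nu_2}(\beta)_{\nu_1\nu_2}}{(\gamma_1)^\circ_{\nu_1}(\gamma_2)^\circ_{\nu_2}(\varepsilon)^\circ_{\nu_1}(\varepsilon)^\circ_{\nu_2}}\nu_1(\lambda_1)\nu_2(\lambda_2).$$ $\overline{\kappa}$ is a fixed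 algebraic closure of $\kappa$ and $\kappa_r\subset\overline{\kappa}$ is the degree $r$ extension of $\kappa$; functions over $\kappa_r$ are defined by the same formulas with $\kappa,q$ replaced by $\kappa_r,q^r$ and with any non-trivial additive character of $\kappa_r$ (the values of $F_4$ do not depend on this choice). $\mu_d\subset\kappa^\times$ is the group of $d$th roots of unity. Fix a generator $\varphi$ of $\widehat{\kappa^\times}$ and put $\varphi_d=\varphi^{(q-1)/d}$, $\chi=\varphi|_{\mu_d}$ (so $\widehat{\mu_d}=\{\chi^m\mid m\in\mathbb{Z}/d\mathbb{Z}\}$) and $\varphi_{d,r}=\varphi_d\circ N_{\kappa_r/\kappa}\in\widehat{\kappa_r^\times}$, where $N_{\kappa_r/\kappa}$ is the norm map. For a variety $V$ over $\kappa$ with an action over $\kappa$ of a finite abelian group $G$, with $F$ the $q$-Frobenius on $V(\overline{\kappa})$, and for $\theta\in\mathrm{Hom}(G,\overline{\mathbb{Q}}^\times)$, $$N_r(V;\theta)=\frac{1}{\#G}\sum_{g\in G}\theta(g)\,\#\{x\in V(\overline{\kappa})\mid F^r(x)=g(x)\},\qquad L(V,\theta;t)=\exp\Big(\sum_{r=1}^\infty\frac{N_r(V;\theta)}{r}t^r\Big)\in\overline{\mathbb{Q}}[[t]].$$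
   Formalization: For m≠0 it is assumed that d divides none of a−c₁−c₂, b−c₁−c₂, c₁+c₂−a−b: otherwise the formula fails (e.g. q=5, d=2, a=b=1, c₁=c₂=2, m=1, λ₁=λ₂=2). For all parameters the formula is proved instead with ⟨k⟩=d when d divides k. *)

theory Defs
  imports "HOL-Algebra.Algebraic_Closure_Type" "HOL-Library.Cardinality"
begin

type_synonym Qbar = "rat alg_closure"

section \<open>The base field and its extensions\<close>

text \<open>
  The base field is a finite field type \<open>'a\<close> with \<open>q = CARD('a)\<close>, embedded by \<open>to_ac\<close> into its
  algebraic closure \<open>'a alg_closure\<close>.
\<close>

definition frob :: "'a::{field,finite} alg_closure \<Rightarrow> 'a alg_closure" where
  "frob x = x ^ CARD('a)"

definition ext_field :: "nat \<Rightarrow> 'a::{field,finite} alg_closure set" where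
  "ext_field r = {x. (frob ^^ r) x = x}"

text \<open>
  The Galois group of \<open>ext_field r\<close> over the base field is cyclic of order \<open>r\<close>, generated by
  \<open>frob\<close>, so the norm is the product of the \<open>r\<close> Frobenius conjugates; \<open>of_ac\<close> views the result
  as an element of the base field.
\<close>
definition ext_norm :: "nat \<Rightarrow> 'a::{field,finite} alg_closure \<Rightarrow> 'a" where
  "ext_norm r x = of_ac (\<Prod>i<r. (frob ^^ i) x)"

section \<open>Characters\<close>

text \<open>
  The functions below take as an argument the finite field \<open>K\<close>, given as a subset of an ambient
  field type: \<open>UNIV :: 'a set\<close> for the base field, \<open>ext_field r\<close> for its extensions.
  A multiplicative character of \<open>K\<close> is a total function that vanishes at \<open>0\<close> (also when it is
  trivial) and outside \<open>K\<close>, so distinct functions are distinct characters.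
\<close>
definition mult_chars :: "'b::field set \<Rightarrow> ('b \<Rightarrow> Qbar) set" where
  "mult_chars K = {\<eta>. (\<forall>x. \<eta> x \<noteq> 0 \<longleftrightarrow> x \<in> K - {0}) \<and>
     (\<forall>x\<in>K - {0}. \<forall>y\<in>K - {0}. \<eta> (x * y) = \<eta> x * \<eta> y)}"

definition triv_char :: "'b::field set \<Rightarrow> 'b \<Rightarrow> Qbar" where
  "triv_char K x = (if x \<in> K - {0} then 1 else 0)"

definition char_mult :: "('b \<Rightarrow> Qbar) \<Rightarrow> ('b \<Rightarrow> Qbar) \<Rightarrow> 'b \<Rightarrow> Qbar"  (infixl \<open>\<star>\<close> 70) where
  "(\<eta> \<star> \<theta>) x = \<eta> x * \<theta> x"

text \<open>Since \<open>inverse 0 = 0\<close>, the pointwise inverse again vanishes at \<open>0\<close> and outside \<open>K\<close>.\<close>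
definition char_inv :: "('b \<Rightarrow> Qbar) \<Rightarrow> 'b \<Rightarrow> Qbar" where
  "char_inv \<eta> x = inverse (\<eta> x)"

text \<open>The zeroth power has to be the trivial character, which is not the constant function 1.\<close>
definition char_pow :: "'b::field set \<Rightarrow> ('b \<Rightarrow> Qbar) \<Rightarrow> nat \<Rightarrow> 'b \<Rightarrow> Qbar" where
  "char_pow K \<eta> n = ((\<lambda>\<theta>. \<theta> \<star> \<eta>) ^^ n) (triv_char K)"

definition mult_char_generator :: "'b::field set \<Rightarrow> ('b \<Rightarrow> Qbar) \<Rightarrow> bool" where
  "mult_char_generator K \<phi> \<longleftrightarrow>
     \<phi> \<in> mult_chars K \<and> mult_chars K = range (char_pow K \<phi>)"

definition char_lift ::
    "nat \<Rightarrow> ('a::{field,finite} \<Rightarrow> Qbar) \<Rightarrow> 'a alg_closure \<Rightarrow> Qbar" where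
  "char_lift r \<eta> x = (if x \<in> ext_field r then \<eta> (ext_norm r x) else 0)"

definition nontriv_add_char :: "'b::field set \<Rightarrow> ('b \<Rightarrow> Qbar) \<Rightarrow> bool" where
  "nontriv_add_char K \<psi> \<longleftrightarrow>
     (\<forall>x\<in>K. \<psi> x \<noteq> 0) \<and> (\<forall>x\<in>K. \<forall>y\<in>K. \<psi> (x + y) = \<psi> x * \<psi> y) \<and> (\<exists>x\<in>K. \<psi> x \<noteq> 1)"

section \<open>Gauss sums, Jacobi sums and the finite Appell function\<close>

definition gauss :: "'b::field set \<Rightarrow> ('b \<Rightarrow> Qbar) \<Rightarrow> ('b \<Rightarrow> Qbar) \<Rightarrow> Qbar" where
  "gauss K \<psi> \<eta> = - (\<Sum>x\<in>K - {0}. \<psi> x * \<eta> x)"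

definition gauss0 :: "'b::field set \<Rightarrow> ('b \<Rightarrow> Qbar) \<Rightarrow> ('b \<Rightarrow> Qbar) \<Rightarrow> Qbar" where
  "gauss0 K \<psi> \<eta> = of_nat (card K) ^ (if \<eta> = triv_char K then 1 else 0) * gauss K \<psi> \<eta>"

definition jacobi :: "'b::field set \<Rightarrow> ('b \<Rightarrow> Qbar) \<Rightarrow> ('b \<Rightarrow> Qbar) \<Rightarrow> Qbar" where
  "jacobi K \<eta>1 \<eta>2 =
     - (\<Sum>(x1, x2) \<in> {(x1, x2). x1 \<in> K - {0} \<and> x2 \<in> K - {0} \<and> x1 + x2 = 1}. \<eta>1 x1 * \<eta>2 x2)"

definition poch ::
    "'b::field set \<Rightarrow> ('b \<Rightarrow> Qbar) \<Rightarrow> ('b \<Rightarrow> Qbar) \<Rightarrow> ('b \<Rightarrow> Qbar) \<Rightarrow> Qbar" where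
  "poch K \<psi> \<alpha> \<nu> = gauss K \<psi> (\<alpha> \<star> \<nu>) / gauss K \<psi> \<alpha>"

definition poch0 ::
    "'b::field set \<Rightarrow> ('b \<Rightarrow> Qbar) \<Rightarrow> ('b \<Rightarrow> Qbar) \<Rightarrow> ('b \<Rightarrow> Qbar) \<Rightarrow> Qbar" where
  "poch0 K \<psi> \<alpha> \<nu> = gauss0 K \<psi> (\<alpha> \<star> \<nu>) / gauss0 K \<psi> \<alpha>"

definition appell_F4 ::
    "'b::field set \<Rightarrow> ('b \<Rightarrow> Qbar) \<Rightarrow> ('b \<Rightarrow> Qbar) \<Rightarrow> ('b \<Rightarrow> Qbar) \<Rightarrow>
     ('b \<Rightarrow> Qbar) \<Rightarrow> ('b \<Rightarrow> Qbar) \<Rightarrow> 'b \<Rightarrow> 'b \<Rightarrow> Qbar" where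
  "appell_F4 K \<psi> \<alpha> \<beta> \<gamma>1 \<gamma>2 l1 l2 =
     1 / (1 - of_nat (card K)) ^ 2 *
     (\<Sum>\<nu>1\<in>mult_chars K. \<Sum>\<nu>2\<in>mult_chars K.
        poch K \<psi> \<alpha> (\<nu>1 \<star> \<nu>2) * poch K \<psi> \<beta> (\<nu>1 \<star> \<nu>2) /
        (poch0 K \<psi> \<gamma>1 \<nu>1 * poch0 K \<psi> \<gamma>2 \<nu>2 *
         poch0 K \<psi> (triv_char K) \<nu>1 * poch0 K \<psi> (triv_char K) \<nu>2) *
        \<nu>1 l1 * \<nu>2 l2)"

section \<open>Artin L-functions\<close>

text \<open>
  \<open>V\<close> is the set of geometric points, \<open>F\<close> the Frobenius map and \<open>act\<close> the action of the finite
  group \<open>G\<close> on it; \<open>\<theta>\<close> only matters on \<open>G\<close>.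
\<close>
definition twisted_count ::
    "'v set \<Rightarrow> ('v \<Rightarrow> 'v) \<Rightarrow> 'g set \<Rightarrow> ('g \<Rightarrow> 'v \<Rightarrow> 'v) \<Rightarrow> ('g \<Rightarrow> Qbar) \<Rightarrow> nat \<Rightarrow> Qbar" where
  "twisted_count V F G act \<theta> r =
     1 / of_nat (card G) * (\<Sum>g\<in>G. \<theta> g * of_nat (card {x \<in> V. (F ^^ r) x = act g x}))"

definition exp_series :: "(nat \<Rightarrow> Qbar) \<Rightarrow> Qbar fps" where
  "exp_series N =
     fps_compose (fps_exp 1) (Abs_fps (\<lambda>r. if r = 0 then 0 else N r / of_nat r))"

definition artin_L ::
    "'v set \<Rightarrow> ('v \<Rightarrow> 'v) \<Rightarrow> 'g set \<Rightarrow> ('g \<Rightarrow> 'v \<Rightarrow> 'v) \<Rightarrow> ('g \<Rightarrow> Qbar) \<Rightarrow> Qbar fps" where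
  "artin_L V F G act \<theta> = exp_series (twisted_count V F G act \<theta>)"

section \<open>The surface\<close>

text \<open>
  Two choices of representatives modulo \<open>d\<close>: the one in \<open>{0..d-1}\<close> and the one in \<open>{1..d}\<close>.
  They differ only on multiples of \<open>d\<close>.  With the former, a factor of the equation of the surface
  whose exponent is divisible by \<open>d\<close> is absent, also at its zeros (\<open>0 ^ 0 = 1\<close>); with the latter
  it is present with exponent \<open>d\<close>.
\<close>
definition res :: "nat \<Rightarrow> int \<Rightarrow> nat" where
  "res d k = nat (k mod int d)"

definition pos_res :: "nat \<Rightarrow> int \<Rightarrow> nat" where
  "pos_res d k = (if int d dvd k then d else res d k)"

definition S4 ::
    "(int \<Rightarrow> nat) \<Rightarrow> nat \<Rightarrow> int \<Rightarrow> int \<Rightarrow> int \<Rightarrow> int \<Rightarrow> 'a::{field,finite} \<Rightarrow> 'a \<Rightarrow>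
     ('a alg_closure \<times> 'a alg_closure \<times> 'a alg_closure) set" where
  "S4 rep d a b c1 c2 l1 l2 = {(x1, x2, y).
     y ^ d = x1 ^ rep a * x2 ^ rep b * (1 - x1) ^ rep (c1 - a) * (1 - x2) ^ rep (c2 - b) *
       (1 - to_ac l1 * x1) ^ rep (a - c1 - c2) * (1 - to_ac l2 * x2) ^ rep (b - c1 - c2) *
       (1 - to_ac l1 * x1 - to_ac l2 * x2) ^ rep (c1 + c2 - a - b)}"

definition frob3 ::
    "'a::{field,finite} alg_closure \<times> 'a alg_closure \<times> 'a alg_closure \<Rightarrow>
     'a alg_closure \<times> 'a alg_closure \<times> 'a alg_closure" where
  "frob3 = (\<lambda>(x1, x2, y). (frob x1, frob x2, frob y))"

definition mu :: "nat \<Rightarrow> 'a::field set" where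
  "mu d = {\<xi>. \<xi> ^ d = 1}"

definition mu_act ::
    "'a::{field,finite} \<Rightarrow> 'a alg_closure \<times> 'a alg_closure \<times> 'a alg_closure \<Rightarrow>
     'a alg_closure \<times> 'a alg_closure \<times> 'a alg_closure" where
  "mu_act \<xi> = (\<lambda>(x1, x2, y). (x1, x2, to_ac \<xi> * y))"

end

theory Submission
  imports Defs
begin

text \<open>
  Counting \<open>y\<close> in the fibre over \<open>(x1, x2)\<close> turns the twisted number of points over the field \<open>K\<close>
  of degree \<open>r\<close> into a sum over \<open>K \<times> K\<close> of a product of seven multiplicative characters.  The
  substitution \<open>u = x1 / (1 - l2 x2)\<close>, \<open>v = x2 / (1 - l1 x1)\<close> transforms it into the Euler sum of
  \<open>\<alpha>(u) \<beta>(v) (\<gamma>1/\<alpha>)(1 - u + l2 (1 - l1) u v) (\<gamma>2/\<beta>)(1 - v + l1 (1 - l2) u v)\<close>, except that the curves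
  \<open>l1 l2 u v = 1\<close>, \<open>l1 u = 1\<close> and \<open>l2 v = 1\<close> are missed; these contribute \<open>S0\<close>, \<open>S1\<close> and \<open>S2\<close>.
  Expanding additive characters into multiplicative ones identifies the Euler sum with
  \<open>J F4\<close>.  The dependence on \<open>r\<close> follows from the Hasse-Davenport relation for Jacobi sums, proved by
  evaluating sums over monic polynomials of \<open>\<eta>((-1)^n f(0)) \<theta>(f(1))\<close>, which vanish in degree
  at least \<open>2\<close>.
\<close>

section \<open>Characters of a finite field\<close>

text \<open>A character vanishes at 0 even if it is trivial, whereas a factor of the surface with
  exponent 0 equals 1 at its zeros. For d not dividing m the count is therefore a sum of products of
  seven characters only when every exponent is represented by a positive number.
  \<open>pos_res\<close> always achieves this; \<open>res\<close> does so exactly if d divides none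
  of the seven exponents. Coprimality takes care of four of them, and the other three are the
  condition in the conclusion. If d divides m, every pair (x1, x2) counts 1 for either choice. The
  additive characters \<open>\<psi> r\<close> over different extensions are chosen independently, so
  Gauss sums over different fields cannot be compared directly. Gauss sums are used inside one field
  only, and the passage from the extension to the base field goes through Jacobi sums, which involve
  no additive character. The coefficient for r becomes J^r F4 + S0^r + S1^r + S2^r, and the
  exponential turns the last three powers into geometric factors.\<close>

lemma power_eq_1_gcd:
  fixes x :: "'b::field"
  assumes "x ^ m = 1" "x ^ n = 1" "m > 0"
  shows "x ^ gcd m n = 1"
proof -
  obtain u v where uv: "m * u = n * v + gcd m n"
    using bezout_nat[of m n] assms(3) by auto
  have "x ^ (m * u) = x ^ (n * v) * x ^ gcd m n"
    by (simp add: uv power_add)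
  then show ?thesis
    using assms by (simp add: power_mult)
qed

lemma card_power_eq_1_le:
  assumes "n > 0"
  shows "finite {x::'b::field. x ^ n = 1}" "card {x::'b::field. x ^ n = 1} \<le> n"
proof -
  define p :: "'b poly" where "p = Polynomial.monom 1 n - 1"
  have "Polynomial.coeff p n = 1"
    using assms by (simp add: p_def)
  then have p0: "p \<noteq> 0" by auto
  have eq: "{x. x ^ n = 1} = {x. poly p x = 0}"
    by (simp add: p_def poly_monom)
  have "Polynomial.degree p \<le> n"
    unfolding p_def by (rule degree_diff_le) (auto simp: degree_monom_le)
  then show "finite {x::'b::field. x ^ n = 1}" "card {x::'b::field. x ^ n = 1} \<le> n"
    using poly_roots_finite[OF p0] card_poly_roots_bound[OF p0] unfolding eq by auto
qed

text \<open>With g = gcd(|G|, e), every element of \<open>G\<close> is a root of X^g - 1, so |G| <=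
  g and hence g = |G|. Orders in the unit group, among the roots of unity and in \<open>mu d\<close>
  are all compared in this way.\<close>

lemma card_dvd_exponent:
  fixes G :: "'b::field set"
  assumes "card G > 0" "\<And>x. x \<in> G \<Longrightarrow> x ^ card G = 1" "\<And>x. x \<in> G \<Longrightarrow> x ^ e = 1"
  shows "card G dvd e"
proof -
  let ?g = "gcd (card G) e"
  have "?g > 0" using assms(1) by auto
  have "card G \<le> card {x::'b. x ^ ?g = 1}"
    using card_power_eq_1_le(1)[OF \<open>?g > 0\<close>] assms by (intro card_mono) (auto intro: power_eq_1_gcd)
  also have "\<dots> \<le> ?g" by (rule card_power_eq_1_le(2)[OF \<open>?g > 0\<close>])
  finally have "?g = card G"
    using assms(1) gcd_le1_nat by (simp add: le_antisym)
  then show ?thesis by (metis gcd_dvd2)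
qed

section \<open>Counting roots over an algebraically closed field\<close>

lemma proots_prod_linear: "proots (\<Prod>x\<in>#A. [:-x, 1:]) = (A :: 'b::idom multiset)"
proof (induction A)
  case (add x A)
  have "(\<Prod>x\<in>#A. [:-x, 1:]) \<noteq> 0" by (auto simp: prod_mset_zero_iff)
  then show ?case using add by (simp add: proots_mult del: mult_pCons_left)
qed simp

lemma size_proots_alg_closed:
  fixes p :: "'b::alg_closed_field poly"
  assumes "p \<noteq> 0"
  shows "size (proots p) = Polynomial.degree p"
proof -
  obtain A where A: "size A = Polynomial.degree p"
      "p = Polynomial.smult (lead_coeff p) (\<Prod>x\<in>#A. [:-x, 1:])"
    using alg_closed_imp_factorization[OF assms] by blast
  have "proots p = A"
    using assms by (subst A(2)) (simp add: proots_prod_linear)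
  with A show ?thesis by simp
qed

text \<open>A root of order at least 2 is also a root of the derivative. So all roots are simple,
  and counting them with or without multiplicity gives the same number.\<close>

lemma card_roots_separable:
  fixes p :: "'b::alg_closed_field poly"
  assumes "p \<noteq> 0" and sep: "\<And>x. poly p x = 0 \<Longrightarrow> poly (pderiv p) x \<noteq> 0"
  shows "card {x. poly p x = 0} = Polynomial.degree p"
proof -
  have "Polynomial.order x p = 1" if "poly p x = 0" for x
  proof -
    have "\<not> Polynomial.order x p \<ge> 2"
    proof
      assume "Polynomial.order x p \<ge> 2"
      moreover define l where "l = [:-x, 1:]"
      ultimately have "l ^ 2 dvd p"
        by (metis order_divides)
      then obtain g where "p = l ^ 2 * g" by (elim dvdE)
      then have "p = l * (l * g)" by (simp add: power2_eq_square mult.assoc)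
      moreover have "poly l x = 0" by (simp add: l_def)
      ultimately have "poly (pderiv p) x = 0" by (simp add: pderiv_mult)
      then show False using sep[OF that] by simp
    qed
    moreover have "Polynomial.order x p > 0"
      using that assms(1) by (simp add: order_gt_0_iff)
    ultimately show ?thesis by linarith
  qed
  then have "(\<Sum>x | poly p x = 0. Polynomial.order x p) = card {x. poly p x = 0}"
    by simp
  moreover have "size (proots p) = (\<Sum>x | poly p x = 0. Polynomial.order x p)"
    using assms(1) by (simp add: size_multiset_overloaded_eq)
  ultimately show ?thesis
    using size_proots_alg_closed[OF assms(1)] by simp
qed

lemma card_roots_of_unity:
  assumes "n > 0"
  shows "card {w::'b::{alg_closed_field, field_char_0}. w ^ n = 1} = n"
proof -
  define p :: "'b poly" where "p = Polynomial.monom 1 n - 1"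
  have c: "Polynomial.coeff p n = 1"
    using assms by (simp add: p_def)
  then have p0: "p \<noteq> 0" by auto
  have "Polynomial.degree p \<le> n"
    unfolding p_def by (rule degree_diff_le) (auto simp: degree_monom_le)
  moreover have "n \<le> Polynomial.degree p" using c by (intro le_degree) simp
  ultimately have "Polynomial.degree p = n" by simp
  moreover have "card {x. poly p x = 0} = Polynomial.degree p"
    using assms p0
    by (intro card_roots_separable) (auto simp: p_def poly_monom pderiv_monom pderiv_diff power_0_left)
  ultimately show ?thesis
    by (simp add: p_def poly_monom)
qed

text \<open>The field is a set inside an ambient field because the extensions depend on the number
  r. Both \<open>UNIV\<close> and \<open>ext_field r\<close> are instances, so each fact about
  characters is proved once.\<close>

locale finite_subfield =
  fixes K :: "'b::field set"
  assumes finite_K: "finite K"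
    and zero_in [simp]: "0 \<in> K"
    and one_in [simp]: "1 \<in> K"
    and add_in [simp]: "x \<in> K \<Longrightarrow> y \<in> K \<Longrightarrow> x + y \<in> K"
    and minus_in [simp]: "x \<in> K \<Longrightarrow> - x \<in> K"
    and mult_in [simp]: "x \<in> K \<Longrightarrow> y \<in> K \<Longrightarrow> x * y \<in> K"
    and inverse_in [simp]: "x \<in> K \<Longrightarrow> inverse x \<in> K"
begin

lemma diff_in [simp]: "x \<in> K \<Longrightarrow> y \<in> K \<Longrightarrow> x - y \<in> K"
  using add_in[of x "-y"] by simp

lemma divide_in [simp]: "x \<in> K \<Longrightarrow> y \<in> K \<Longrightarrow> x / y \<in> K"
  by (simp add: field_class.field_divide_inverse)

lemma power_in [simp]: "x \<in> K \<Longrightarrow> x ^ n \<in> K"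
  by (induction n) auto

lemma card_units: "card (K - {0}) = card K - 1"
  using finite_K by (subst card_Diff_subset) auto

lemma card_gt_1: "card K > 1"
proof -
  have "card {0, 1::'b} \<le> card K" using finite_K by (intro card_mono) auto
  then show ?thesis by simp
qed

lemma bij_mult:
  assumes "c \<in> K - {0}"
  shows "bij_betw ((*) c) (K - {0}) (K - {0})"
proof (rule bij_betw_byWitness[where f' = "\<lambda>x. x / c"])
  show "(*) c ` (K - {0}) \<subseteq> K - {0}" "(\<lambda>x. x / c) ` (K - {0}) \<subseteq> K - {0}"
    using assms by auto
qed (use assms in auto)

lemma power_card_units:
  assumes "x \<in> K - {0}"
  shows "x ^ (card K - 1) = 1"
proof -
  have "(\<Prod>y\<in>K - {0}. y) = (\<Prod>y\<in>K - {0}. x * y)"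
    by (rule prod.reindex_bij_betw[OF bij_mult[OF assms], symmetric])
  also have "\<dots> = x ^ (card K - 1) * (\<Prod>y\<in>K - {0}. y)"
    by (simp add: prod.distrib card_units)
  finally have "x ^ (card K - 1) * (\<Prod>y\<in>K - {0}. y) = 1 * (\<Prod>y\<in>K - {0}. y)" by simp
  moreover have "(\<Prod>y\<in>K - {0}. y) \<noteq> 0" using finite_K by simp
  ultimately show ?thesis
    using mult_right_cancel by blast
qed

lemma power_card: "x \<in> K \<Longrightarrow> x ^ card K = x"
  using power_card_units[of x] card_gt_1
  by (cases "x = 0") (auto simp: power_eq_if[of x "card K"])

text \<open>Translation by 1 permutes \<open>K\<close>, so the sum of all elements equals itself
  plus |K|.\<close>

lemma of_nat_card_eq_0: "of_nat (card K) = (0::'b)"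
proof -
  have "bij_betw ((+) 1) K K"
    by (rule bij_betw_byWitness[where f' = "\<lambda>x. x - 1"]) auto
  then have "(\<Sum>x\<in>K. x) = (\<Sum>x\<in>K. 1 + x)"
    by (rule sum.reindex_bij_betw[symmetric])
  also have "\<dots> = of_nat (card K) + (\<Sum>x\<in>K. x)"
    by (simp add: sum.distrib)
  finally show ?thesis by simp
qed

lemma unit_generator:
  obtains g where "g \<in> K - {0}" "\<forall>x\<in>K - {0}. \<exists>i. x = g ^ i"
proof -
  \<comment> \<open>Viewing \<open>K\<close> as a ring in the sense of HOL-Algebra makes the
    cyclicity of the unit group of a finite field applicable.\<close>
  define R :: "'b ring" where "R = \<lparr>carrier = K, monoid.mult = (*), one = 1, zero = 0, add = (+)\<rparr>"
  have "\<exists>y\<in>K. x + y = 0" "\<exists>y\<in>K. y + x = 0" if "x \<in> K" for x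
    using that by (auto intro!: bexI[of _ "- x"])
  moreover have "\<exists>y\<in>K. x * y = 1" "\<exists>y\<in>K. y * x = 1" if "x \<in> K" "x \<noteq> 0" for x
    using that by (auto intro!: bexI[of _ "inverse x"])
  ultimately have R: "Ring.field R"
    unfolding R_def by unfold_locales (fastforce simp: algebra_simps Units_def)+
  then obtain g where g: "g \<in> carrier (mult_of R)"
      "carrier (mult_of R) = {g [^]\<^bsub>R\<^esub> i | i::nat. i \<in> UNIV}"
    using field.finite_field_mult_group_has_gen[OF R] finite_K
    by (auto simp: R_def)
  have "g [^]\<^bsub>R\<^esub> i = g ^ i" for i :: nat
    by (induction i) (simp_all add: R_def nat_pow_def)
  with g show thesis
    by (intro that[of g]) (auto simp: R_def)
qed

lemma generator_power_eq_1:
  assumes "\<forall>x\<in>K - {0}. \<exists>i. x = g ^ i" "g ^ n = 1"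
  shows "card K - 1 dvd n"
proof -
  have "card (K - {0}) dvd n"
  proof (rule card_dvd_exponent)
    fix x assume "x \<in> K - {0}"
    then obtain i where "x = g ^ i" using assms(1) by blast
    then show "x ^ n = 1" by (metis assms(2) power_mult mult.commute power_one)
  qed (use card_gt_1 power_card_units in \<open>auto simp: card_units\<close>)
  then show ?thesis by (simp add: card_units)
qed

section \<open>Multiplicative characters: group structure and orthogonality\<close>

abbreviation \<epsilon> :: "'b \<Rightarrow> Qbar" where "\<epsilon> \<equiv> triv_char K"

abbreviation chars :: "('b \<Rightarrow> Qbar) set" where "chars \<equiv> mult_chars K"

lemma char_0_iff: "\<eta> \<in> chars \<Longrightarrow> \<eta> x = 0 \<longleftrightarrow> x \<notin> K - {0}"
  by (auto simp: mult_chars_def)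

lemma char_zero [simp]: "\<eta> \<in> chars \<Longrightarrow> \<eta> 0 = 0"
  by (simp add: char_0_iff)

lemma char_mult: "\<eta> \<in> chars \<Longrightarrow> x \<in> K \<Longrightarrow> y \<in> K \<Longrightarrow> \<eta> (x * y) = \<eta> x * \<eta> y"
  by (cases "x = 0"; cases "y = 0") (auto simp: mult_chars_def)

lemma char_one [simp]:
  assumes "\<eta> \<in> chars"
  shows "\<eta> 1 = 1"
proof -
  have "\<eta> 1 * \<eta> 1 = \<eta> 1" using char_mult[OF assms, of 1 1] by simp
  moreover have "\<eta> 1 \<noteq> 0" using assms by (simp add: char_0_iff)
  ultimately show ?thesis by simp
qed

lemma char_power: "\<eta> \<in> chars \<Longrightarrow> x \<in> K \<Longrightarrow> \<eta> (x ^ n) = \<eta> x ^ n"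
  by (induction n) (simp_all add: char_mult)

lemma char_inverse:
  assumes "\<eta> \<in> chars" "x \<in> K"
  shows "\<eta> (inverse x) = inverse (\<eta> x)"
proof (cases "x = 0")
  case False
  then have "\<eta> (inverse x) * \<eta> x = 1"
    using char_mult[OF assms(1), of "inverse x" x] assms by simp
  then show ?thesis by (metis inverse_unique mult.commute)
qed (use assms in simp)

lemma char_divide:
  "\<eta> \<in> chars \<Longrightarrow> x \<in> K \<Longrightarrow> y \<in> K \<Longrightarrow> \<eta> (x / y) = \<eta> x / \<eta> y"
  by (simp add: field_class.field_divide_inverse char_mult char_inverse)

lemma char_minus_1_square: "\<eta> \<in> chars \<Longrightarrow> \<eta> (-1) * \<eta> (-1) = 1"
  using char_mult[of \<eta> "-1" "-1"] by simp

lemma char_uminus: "\<eta> \<in> chars \<Longrightarrow> x \<in> K \<Longrightarrow> \<eta> (- x) = \<eta> (-1) * \<eta> x"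
  using char_mult[of \<eta> "-1" x] by simp

lemma triv_char_in [simp]: "\<epsilon> \<in> chars"
  by (auto simp: mult_chars_def triv_char_def)

lemma char_mult_in [simp]: "\<eta> \<in> chars \<Longrightarrow> \<theta> \<in> chars \<Longrightarrow> \<eta> \<star> \<theta> \<in> chars"
  by (auto simp: mult_chars_def char_mult_def)

lemma char_inv_in [simp]: "\<eta> \<in> chars \<Longrightarrow> char_inv \<eta> \<in> chars"
  by (auto simp: mult_chars_def char_inv_def)

lemma char_pow_apply:
  "char_pow K \<eta> n x = (if x \<in> K - {0} then \<eta> x ^ n else 0)"
  if "\<eta> \<in> chars \<or> (\<forall>x. x \<notin> K - {0} \<longrightarrow> \<eta> x = 0)"
  using that by (induction n) (auto simp: char_pow_def triv_char_def char_mult_def char_0_iff)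

lemma char_pow_in [simp]: "\<eta> \<in> chars \<Longrightarrow> char_pow K \<eta> n \<in> chars"
  by (auto simp: mult_chars_def char_pow_apply power_mult_distrib)

lemma char_inv_inv [simp]: "char_inv (char_inv \<eta>) = (\<eta> :: 'b \<Rightarrow> Qbar)"
  by (simp add: char_inv_def fun_eq_iff)

lemma char_inv_mult: "char_inv (\<eta> \<star> \<theta>) = char_inv \<eta> \<star> (char_inv \<theta> :: 'b \<Rightarrow> Qbar)"
  by (simp add: char_inv_def char_mult_def fun_eq_iff)

lemma char_mult_triv [simp]: "\<eta> \<in> chars \<Longrightarrow> \<eta> \<star> \<epsilon> = \<eta>" "\<eta> \<in> chars \<Longrightarrow> \<epsilon> \<star> \<eta> = \<eta>"
  by (auto simp: char_mult_def triv_char_def fun_eq_iff char_0_iff)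

lemma char_mult_inv [simp]: "\<eta> \<in> chars \<Longrightarrow> \<eta> \<star> char_inv \<eta> = \<epsilon>" "\<eta> \<in> chars \<Longrightarrow> char_inv \<eta> \<star> \<eta> = \<epsilon>"
  by (auto simp: char_mult_def char_inv_def triv_char_def fun_eq_iff char_0_iff)

lemma char_mult_commute: "\<eta> \<star> \<theta> = \<theta> \<star> (\<eta> :: 'b \<Rightarrow> Qbar)"
  by (simp add: char_mult_def fun_eq_iff mult.commute)

lemma char_mult_assoc: "(\<eta> \<star> \<theta>) \<star> \<omega> = \<eta> \<star> (\<theta> \<star> (\<omega> :: 'b \<Rightarrow> Qbar))"
  by (simp add: char_mult_def fun_eq_iff mult.assoc)

lemma char_inv_triv [simp]: "char_inv \<epsilon> = \<epsilon>"
  by (auto simp: char_inv_def triv_char_def)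

lemma char_mult_eq_triv_iff:
  "\<eta> \<in> chars \<Longrightarrow> \<theta> \<in> chars \<Longrightarrow> \<eta> \<star> \<theta> = \<epsilon> \<longleftrightarrow> \<theta> = char_inv \<eta>"
  by (metis char_mult_assoc char_mult_commute char_mult_inv(1) char_mult_triv(1) char_inv_in)

lemma char_neq_triv:
  assumes "\<eta> \<in> chars" "\<eta> \<noteq> \<epsilon>"
  obtains x where "x \<in> K - {0}" "\<eta> x \<noteq> 1"
proof -
  from assms obtain x where x: "\<eta> x \<noteq> \<epsilon> x" by (auto simp: fun_eq_iff)
  then have "x \<in> K - {0}" using assms(1) by (auto simp: triv_char_def char_0_iff split: if_splits)
  with x show thesis by (intro that[of x]) (auto simp: triv_char_def)
qed

lemma sum_char:
  assumes "\<eta> \<in> chars"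
  shows "(\<Sum>x\<in>K - {0}. \<eta> x) = (if \<eta> = \<epsilon> then of_nat (card K) - 1 else 0)"
proof (cases "\<eta> = \<epsilon>")
  case True
  have "(\<Sum>x\<in>K - {0}. \<epsilon> x) = (\<Sum>x\<in>K - {0}. 1)"
    by (intro sum.cong) (auto simp: triv_char_def)
  then show ?thesis using True card_gt_1 by (simp add: card_units of_nat_diff)
next
  case False
  then obtain c where c: "c \<in> K - {0}" "\<eta> c \<noteq> 1" using char_neq_triv assms by blast
  have "(\<Sum>x\<in>K - {0}. \<eta> x) = (\<Sum>x\<in>K - {0}. \<eta> (c * x))"
    by (rule sum.reindex_bij_betw[OF bij_mult[OF c(1)], symmetric])
  also have "\<dots> = \<eta> c * (\<Sum>x\<in>K - {0}. \<eta> x)"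
    unfolding sum_distrib_left using assms c by (intro sum.cong) (auto simp: char_mult)
  finally show ?thesis using c False by simp
qed

text \<open>This yields both the number of characters and enough of them to separate points.\<close>

lemma bij_char_eval:
  assumes g: "g \<in> K - {0}" "\<forall>x\<in>K - {0}. \<exists>i. x = g ^ i"
  shows "bij_betw (\<lambda>\<nu>. \<nu> g) chars {w. w ^ (card K - 1) = 1}"
proof (rule bij_betw_imageI)
  show "inj_on (\<lambda>\<nu>. \<nu> g) chars"
  proof (rule inj_onI)
    fix \<nu> \<nu>' assume \<nu>: "\<nu> \<in> chars" "\<nu>' \<in> chars" "\<nu> g = \<nu>' g"
    show "\<nu> = \<nu>'"
    proof
      fix x
      show "\<nu> x = \<nu>' x"
      proof (cases "x \<in> K - {0}")
        case True
        then obtain i where "x = g ^ i" using g(2) by blast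
        then show ?thesis using \<nu> g(1) by (simp add: char_power)
      next
        case False
        then show ?thesis using \<nu>(1,2) char_0_iff by metis
      qed
    qed
  qed
  show "(\<lambda>\<nu>. \<nu> g) ` chars = {w. w ^ (card K - 1) = 1}" (is "?L = ?R")
  proof
    show "?L \<subseteq> ?R"
    proof clarify
      fix \<nu> assume \<nu>: "\<nu> \<in> chars"
      have "\<nu> (g ^ (card K - 1)) = \<nu> g ^ (card K - 1)"
        using \<nu> g(1) by (simp add: char_power)
      then show "\<nu> g ^ (card K - 1) = 1" using power_card_units[OF g(1)] \<nu> by simp
    qed
    show "?R \<subseteq> ?L"
    proof
      fix w :: Qbar assume "w \<in> {w. w ^ (card K - 1) = 1}"
      then have w: "w ^ (card K - 1) = 1" by simp
      have w0: "w \<noteq> 0" using w card_gt_1 by (auto simp: power_0_left)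
      have le: "w ^ i = w ^ j" if "g ^ i = g ^ j" "i \<le> j" for i j
      proof -
        have "g ^ j = g ^ i * g ^ (j - i)" using power_add[of g i "j - i"] unfolding le_add_diff_inverse[OF that(2)] .
        then have "g ^ i * g ^ (j - i) = g ^ i * 1" using that(1) by (metis mult.right_neutral)
        then have "g ^ (j - i) = 1" using g(1) by simp
        from generator_power_eq_1[OF g(2) this] have "card K - 1 dvd j - i" .
        then obtain k where k: "j - i = (card K - 1) * k" by (elim dvdE)
        have "w ^ (j - i) = 1" unfolding k power_mult w by simp
        moreover have "w ^ j = w ^ i * w ^ (j - i)" using power_add[of w i "j - i"] unfolding le_add_diff_inverse[OF that(2)] .
        ultimately show ?thesis by (metis mult.right_neutral)
      qed
      have wd: "w ^ i = w ^ j" if "g ^ i = g ^ j" for i j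
        using le[OF that] le[OF that[symmetric]] by (metis nat_le_linear)
      \<comment> \<open>A discrete logarithm to base g. The choice is immaterial, because by
        \<open>wd\<close> a power of w depends only on the corresponding power of g.\<close>
      define L where "L x = (SOME i. x = g ^ i)" for x
      have L: "x = g ^ L x" if "x \<in> K - {0}" for x
        unfolding L_def using bspec[OF g(2) that] by (rule someI_ex)
      define \<nu> where "\<nu> x = (if x \<in> K - {0} then w ^ L x else 0)" for x
      have "\<nu> \<in> chars"
        unfolding mult_chars_def
      proof (intro CollectI conjI ballI allI)
        fix x show "(\<nu> x \<noteq> 0) = (x \<in> K - {0})" using w0 by (simp add: \<nu>_def)
      next
        fix x y assume xy: "x \<in> K - {0}" "y \<in> K - {0}"
        then have xyK: "x * y \<in> K - {0}" by simp
        have "g ^ L (x * y) = g ^ (L x + L y)"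
          unfolding power_add L[OF xy(1), symmetric] L[OF xy(2), symmetric] L[OF xyK, symmetric] ..
        from wd[OF this] show "\<nu> (x * y) = \<nu> x * \<nu> y"
          using xy xyK by (simp add: \<nu>_def power_add)
      qed
      moreover have "\<nu> g = w"
        using wd[of "L g" 1, unfolded power_one_right, OF L[OF g(1), symmetric]] g(1) by (simp add: \<nu>_def)
      ultimately show "w \<in> ?L" by blast
    qed
  qed
qed

lemma card_chars: "card chars = card K - 1"
proof -
  obtain g where g: "g \<in> K - {0}" "\<forall>x\<in>K - {0}. \<exists>i. x = g ^ i"
    by (rule unit_generator) blast
  have "card {w::Qbar. w ^ (card K - 1) = 1} = card K - 1"
    using card_gt_1 by (intro card_roots_of_unity) simp
  with bij_betw_same_card[OF bij_char_eval[OF g]] show ?thesis by simp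
qed

text \<open>Write x = g^i. The values \<nu>(g) run through all |K| - 1 roots of unity of order
  dividing |K| - 1, and each satisfies \<nu>(g)^i = \<nu>(x) = 1. So |K| - 1 divides i.\<close>

lemma char_separates:
  assumes "x \<in> K" "\<And>\<nu>. \<nu> \<in> chars \<Longrightarrow> \<nu> x = 1"
  shows "x = 1"
proof -
  have x: "x \<in> K - {0}" using assms(1) assms(2)[OF triv_char_in] by (auto simp: triv_char_def)
  obtain g where g: "g \<in> K - {0}" "\<forall>x\<in>K - {0}. \<exists>i. x = g ^ i"
    by (rule unit_generator) blast
  obtain i where i: "x = g ^ i" using g x by blast
  let ?R = "{w::Qbar. w ^ (card K - 1) = 1}"
  have card: "card ?R = card K - 1"
    using card_gt_1 by (intro card_roots_of_unity) simp
  have "card ?R dvd i"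
  proof (rule card_dvd_exponent)
    show "0 < card ?R" using card card_gt_1 by simp
    fix w assume w: "w \<in> ?R"
    then show "w ^ card ?R = 1" using card by simp
    obtain \<nu> where "\<nu> \<in> chars" "w = \<nu> g"
      using bij_char_eval[OF g] w unfolding bij_betw_def by blast
    then show "w ^ i = 1" using assms(2)[of \<nu>] i g by (simp add: char_power)
  qed
  then have "card K - 1 dvd i" unfolding card .
  then obtain k where k: "i = (card K - 1) * k" by (elim dvdE)
  show ?thesis unfolding i k power_mult power_card_units[OF g(1)] by simp
qed

lemma sum_over_chars:
  assumes "x \<in> K - {0}"
  shows "(\<Sum>\<nu>\<in>chars. \<nu> x) = (if x = 1 then of_nat (card K) - 1 else 0)"
proof (cases "x = 1")
  case True
  then show ?thesis using card_gt_1 by (simp add: card_chars of_nat_diff)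
next
  case False
  then obtain \<mu> where \<mu>: "\<mu> \<in> chars" "\<mu> x \<noteq> 1" using char_separates assms by blast
  have "bij_betw (\<lambda>\<nu>. \<mu> \<star> \<nu>) chars chars"
    by (rule bij_betw_byWitness[where f' = "\<lambda>\<nu>. char_inv \<mu> \<star> \<nu>"])
      (use \<mu> in \<open>auto simp flip: char_mult_assoc\<close>)
  then have "(\<Sum>\<nu>\<in>chars. \<nu> x) = (\<Sum>\<nu>\<in>chars. (\<mu> \<star> \<nu>) x)"
    by (rule sum.reindex_bij_betw[symmetric])
  also have "\<dots> = \<mu> x * (\<Sum>\<nu>\<in>chars. \<nu> x)"
    by (simp add: char_mult_def sum_distrib_left)
  finally show ?thesis using \<mu> False by simp
qed

end

section \<open>Gauss and Jacobi sums\<close>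

context finite_subfield
begin

lemma card_neq [simp]: "(of_nat (card K) :: Qbar) \<noteq> 0" "of_nat (card K) - 1 \<noteq> (0 :: Qbar)"
  "1 - of_nat (card K) \<noteq> (0 :: Qbar)"
proof -
  show "(of_nat (card K) :: Qbar) \<noteq> 0" using card_gt_1 by auto
  have "(of_nat (card K) :: Qbar) \<noteq> of_nat 1" using card_gt_1 by (subst of_nat_eq_iff) simp
  then show "of_nat (card K) - 1 \<noteq> (0 :: Qbar)" "1 - of_nat (card K) \<noteq> (0 :: Qbar)" by auto
qed

lemma card_pos [simp]: "card K > 0" "card K \<noteq> 0" "card K \<noteq> Suc 0"
  using card_gt_1 by simp_all

lemma bij_diff_left:
  assumes "c \<in> K"
  shows "bij_betw (\<lambda>x. c - x) K K"
  by (rule bij_betw_byWitness[where f' = "\<lambda>x. c - x"]) (use assms in auto)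

text \<open>The added point x = 1 contributes 0, because \<theta>(0) = 0 even for trivial
  \<theta>.\<close>

lemma jacobi_conv:
  assumes "\<eta> \<in> chars" "\<theta> \<in> chars"
  shows "jacobi K \<eta> \<theta> = - (\<Sum>x\<in>K - {0}. \<eta> x * \<theta> (1 - x))"
proof -
  have [simp]: "1 - x1 = x2" if "x1 + x2 = 1" for x1 x2 :: 'b
    using that by (simp add: diff_eq_eq add.commute)
  have "(\<Sum>(x1, x2) \<in> {(x1, x2). x1 \<in> K - {0} \<and> x2 \<in> K - {0} \<and> x1 + x2 = 1}. \<eta> x1 * \<theta> x2)
      = (\<Sum>x\<in>K - {0, 1}. \<eta> x * \<theta> (1 - x))"
    by (rule sum.reindex_bij_witness[where i = "\<lambda>x. (x, 1 - x)" and j = fst])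
      auto
  also have "\<dots> = (\<Sum>x\<in>K - {0}. \<eta> x * \<theta> (1 - x))"
    using finite_K assms by (intro sum.mono_neutral_left) auto
  finally show ?thesis by (simp add: jacobi_def)
qed

lemma sum_K: "(\<Sum>x\<in>K. f x) = f 0 + (\<Sum>x\<in>K - {0}. f x)"
  using finite_K by (simp add: sum.remove)

lemma jacobi_conv':
  assumes "\<eta> \<in> chars" "\<theta> \<in> chars"
  shows "(\<Sum>x\<in>K. \<eta> x * \<theta> (1 - x)) = - jacobi K \<eta> \<theta>"
  using assms by (simp add: jacobi_conv sum_K)

lemma jacobi_commute:
  assumes "\<eta> \<in> chars" "\<theta> \<in> chars"
  shows "jacobi K \<eta> \<theta> = jacobi K \<theta> \<eta>"
proof -
  have "(\<Sum>x\<in>K. \<eta> x * \<theta> (1 - x)) = (\<Sum>x\<in>K. \<eta> (1 - x) * \<theta> (1 - (1 - x)))"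
    by (rule sum.reindex_bij_betw[OF bij_diff_left[OF one_in], symmetric])
  then show ?thesis
    using jacobi_conv'[OF assms] jacobi_conv'[OF assms(2,1)] by (simp add: mult.commute)
qed

text \<open>The substitution \<open>x \<mapsto> x / (x - 1)\<close>.\<close>
lemma jacobi_reflect:
  assumes "\<eta> \<in> chars" "\<theta> \<in> chars"
  shows "jacobi K \<eta> \<theta> = \<eta> (-1) * jacobi K \<eta> (char_inv (\<eta> \<star> \<theta>))"
proof -
  let ?\<omega> = "char_inv (\<eta> \<star> \<theta>)"
  have K1: "(\<Sum>x\<in>K. \<eta> x * \<zeta> (1 - x)) = (\<Sum>x\<in>K - {1}. \<eta> x * \<zeta> (1 - x))" if "\<zeta> \<in> chars" for \<zeta>
    using finite_K that by (intro sum.mono_neutral_right) auto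
  have invol: "x / (x - 1) \<noteq> 1" "x / (x - 1) / (x / (x - 1) - 1) = x" if "x \<noteq> 1" for x :: 'b
  proof -
    have "x - 1 \<noteq> 0" using that by simp
    then have "x / (x - 1) - 1 = 1 / (x - 1)" by (subst divide_diff_eq_iff) simp_all
    then show "x / (x - 1) / (x / (x - 1) - 1) = x" using that by simp
  qed (use that in \<open>simp add: divide_eq_1_iff\<close>)
  have "(\<Sum>x\<in>K - {1}. \<eta> x * \<theta> (1 - x)) = (\<Sum>x\<in>K - {1}. \<eta> (-1) * (\<eta> x * ?\<omega> (1 - x)))"
  proof (rule sum.reindex_bij_witness[where i = "\<lambda>x. x / (x - 1)" and j = "\<lambda>x. x / (x - 1)"])
    fix x assume x: "x \<in> K - {1}"
    then show "x / (x - 1) \<in> K - {1}" "x / (x - 1) \<in> K - {1}"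
      "x / (x - 1) / (x / (x - 1) - 1) = x" "x / (x - 1) / (x / (x - 1) - 1) = x"
      using invol[of x] by auto
    define w where "w = 1 - x"
    have w: "x = 1 - w" "w \<noteq> 0" using x by (auto simp: w_def)
    have "x / (x - 1) = (-1) * x * inverse (1 - x)"
      unfolding w(1) using w(2) by (simp add: field_simps)
    then have "\<eta> (x / (x - 1)) = \<eta> ((-1) * x * inverse (1 - x))" by simp
    also have "\<dots> = \<eta> (-1) * \<eta> x * inverse (\<eta> (1 - x))"
      using x assms by (simp only: char_mult minus_in mult_in inverse_in one_in diff_in char_inverse Diff_iff)
    finally have "\<eta> (x / (x - 1)) = \<dots>" .
    moreover have "1 - x / (x - 1) = inverse (1 - x)"
      unfolding w(1) using w(2) by (simp add: field_simps)
    ultimately have "\<eta> (-1) * (\<eta> (x / (x - 1)) * ?\<omega> (1 - x / (x - 1)))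
        = \<eta> (-1) * \<eta> (-1) * \<eta> x * inverse (\<eta> (1 - x)) * (\<eta> (1 - x) * \<theta> (1 - x))"
      using x assms by (simp add: char_inverse char_inv_def char_mult_def)
    also have "\<dots> = \<eta> x * \<theta> (1 - x)"
      using x assms char_minus_1_square[OF assms(1)] by (simp add: char_0_iff)
    finally show "\<eta> (-1) * (\<eta> (x / (x - 1)) * ?\<omega> (1 - x / (x - 1))) = \<eta> x * \<theta> (1 - x)" .
  qed
  then have "(\<Sum>x\<in>K. \<eta> x * \<theta> (1 - x)) = \<eta> (-1) * (\<Sum>x\<in>K. \<eta> x * ?\<omega> (1 - x))"
    using assms by (simp add: K1 sum_distrib_left)
  then show ?thesis
    using assms by (simp add: jacobi_conv')
qed

text \<open>The sum of \<eta> over \<open>K\<close> is 0, and the factor \<epsilon>(1 - x) removes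
  the point x = 1, which leaves -1.\<close>

lemma jacobi_triv:
  assumes "\<eta> \<in> chars" "\<eta> \<noteq> \<epsilon>"
  shows "jacobi K \<eta> \<epsilon> = 1"
proof -
  have "(\<Sum>x\<in>K. \<eta> x * \<epsilon> (1 - x)) = (\<Sum>x\<in>K. \<eta> x - (if x = 1 then 1 else 0))"
    using assms by (intro sum.cong) (auto simp: triv_char_def)
  also have "\<dots> = -1"
    using sum_char[OF assms(1)] assms finite_K by (simp add: sum_subtractf sum_K)
  finally show ?thesis using jacobi_conv'[OF assms(1) triv_char_in] by simp
qed

lemma jacobi_inv:
  assumes "\<eta> \<in> chars" "\<eta> \<noteq> \<epsilon>"
  shows "jacobi K \<eta> (char_inv \<eta>) = \<eta> (-1)"
  using jacobi_reflect[of \<eta> "char_inv \<eta>"] jacobi_triv assms by simp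

end

section \<open>Gauss sums for a fixed additive character\<close>

locale finite_subfield_add_char = finite_subfield +
  fixes \<psi> :: "'a \<Rightarrow> Qbar"
  assumes nontriv: "nontriv_add_char K \<psi>"
begin

abbreviation G :: "('a \<Rightarrow> Qbar) \<Rightarrow> Qbar" where "G \<equiv> gauss K \<psi>"

lemma psi_add: "x \<in> K \<Longrightarrow> y \<in> K \<Longrightarrow> \<psi> (x + y) = \<psi> x * \<psi> y"
  using nontriv by (simp add: nontriv_add_char_def)

lemma psi_0 [simp]: "\<psi> 0 = 1"
  using psi_add[of 0 0] nontriv by (simp add: nontriv_add_char_def)

lemma sum_psi: "(\<Sum>x\<in>K. \<psi> x) = 0"
proof -
  obtain c where c: "c \<in> K" "\<psi> c \<noteq> 1" using nontriv by (auto simp: nontriv_add_char_def)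
  have "bij_betw ((+) c) K K"
    by (rule bij_betw_byWitness[where f' = "\<lambda>x. x - c"]) (use c in auto)
  then have "(\<Sum>x\<in>K. \<psi> x) = (\<Sum>x\<in>K. \<psi> (c + x))"
    by (rule sum.reindex_bij_betw[symmetric])
  also have "\<dots> = \<psi> c * (\<Sum>x\<in>K. \<psi> x)"
    unfolding sum_distrib_left using c by (intro sum.cong) (auto simp: psi_add)
  finally show ?thesis using c by simp
qed

lemma gauss_triv: "G \<epsilon> = 1"
proof -
  have "(\<Sum>x\<in>K - {0}. \<psi> x * \<epsilon> x) = (\<Sum>x\<in>K - {0}. \<psi> x)"
    by (intro sum.cong) (auto simp: triv_char_def)
  then show ?thesis using sum_psi by (simp add: gauss_def sum_K add_eq_0_iff)
qed

lemma sum_psi_scale: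
  assumes "\<eta> \<in> chars" "x \<in> K - {0}"
  shows "(\<Sum>s\<in>K - {0}. \<psi> (s * x) * \<eta> s) = - char_inv \<eta> x * G \<eta>"
proof -
  have "(\<Sum>s\<in>K - {0}. \<psi> s * (\<eta> s * inverse (\<eta> x)))
      = (\<Sum>s\<in>K - {0}. \<psi> (x * s) * (\<eta> (x * s) * inverse (\<eta> x)))"
    by (rule sum.reindex_bij_betw[OF bij_mult[OF assms(2)], symmetric])
  also have "\<dots> = (\<Sum>s\<in>K - {0}. \<psi> (s * x) * \<eta> s)"
    using assms by (intro sum.cong) (auto simp: char_mult mult.commute char_0_iff)
  finally show ?thesis
    by (simp add: gauss_def char_inv_def sum_distrib_left sum_distrib_right sum_negf mult_ac)
qed

text \<open>At x = 0 the left side is a complete sum of a non-trivial character, and the right side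
  is 0 because \<open>inverse 0 = 0\<close>. For \<eta> = \<epsilon> this fails at 0, which is why
  \<alpha> \<noteq> \<gamma>1 and \<beta> \<noteq> \<gamma>2 are assumed later.\<close>

lemma sum_psi_scale_nontriv:
  assumes "\<eta> \<in> chars" "\<eta> \<noteq> \<epsilon>" "x \<in> K"
  shows "(\<Sum>s\<in>K - {0}. \<psi> (s * x) * \<eta> s) = - char_inv \<eta> x * G \<eta>"
proof (cases "x = 0")
  case True
  then show ?thesis using assms sum_char[OF assms(1)] by (simp add: char_inv_def)
next
  case False
  then show ?thesis using assms sum_psi_scale by simp
qed

text \<open>Collect the double sum by s = x + y. For s \<noteq> 0, replacing x by s x splits off the
  product character at s and leaves a Jacobi sum; s = 0 produces the correction term.\<close>

lemma gauss_mult: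
  assumes "\<alpha> \<in> chars" "\<eta> \<in> chars"
  shows "G \<alpha> * G \<eta> = jacobi K \<alpha> \<eta> * G (\<alpha> \<star> \<eta>)
    + (if \<alpha> \<star> \<eta> = \<epsilon> then \<eta> (-1) * (of_nat (card K) - 1) else 0)"
proof -
  have "G \<alpha> * G \<eta> = (\<Sum>x\<in>K - {0}. \<Sum>y\<in>K. \<psi> x * \<alpha> x * (\<psi> y * \<eta> y))"
    using assms by (simp add: gauss_def sum_K sum_product)
  also have "\<dots> = (\<Sum>x\<in>K - {0}. \<Sum>s\<in>K. \<psi> s * (\<alpha> x * \<eta> (s - x)))"
  proof (rule sum.cong[OF refl])
    fix x assume x: "x \<in> K - {0}"
    show "(\<Sum>y\<in>K. \<psi> x * \<alpha> x * (\<psi> y * \<eta> y)) = (\<Sum>s\<in>K. \<psi> s * (\<alpha> x * \<eta> (s - x)))"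
      by (rule sum.reindex_bij_witness[where i = "\<lambda>s. s - x" and j = "\<lambda>y. x + y"])
        (use x in \<open>auto simp: psi_add\<close>)
  qed
  also have "\<dots> = (\<Sum>s\<in>K. \<psi> s * (\<Sum>x\<in>K - {0}. \<alpha> x * \<eta> (s - x)))"
    by (subst sum.swap) (simp add: sum_distrib_left)
  also have "\<dots> = (\<Sum>x\<in>K - {0}. \<alpha> x * \<eta> (- x))
      + (\<Sum>s\<in>K - {0}. \<psi> s * (\<Sum>x\<in>K - {0}. \<alpha> x * \<eta> (s - x)))"
    by (simp add: sum_K)
  also have "(\<Sum>x\<in>K - {0}. \<alpha> x * \<eta> (- x)) = (\<Sum>x\<in>K - {0}. \<eta> (-1) * (\<alpha> \<star> \<eta>) x)"
  proof (rule sum.cong[OF refl])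
    fix x assume "x \<in> K - {0}"
    then show "\<alpha> x * \<eta> (- x) = \<eta> (-1) * (\<alpha> \<star> \<eta>) x"
      using char_uminus[OF assms(2), of x] by (simp add: char_mult_def)
  qed
  also have "\<dots> = (if \<alpha> \<star> \<eta> = \<epsilon> then \<eta> (-1) * (of_nat (card K) - 1) else 0)"
    using assms by (simp add: sum_char flip: sum_distrib_left)
  also have "(\<Sum>s\<in>K - {0}. \<psi> s * (\<Sum>x\<in>K - {0}. \<alpha> x * \<eta> (s - x)))
      = (\<Sum>s\<in>K - {0}. \<psi> s * ((\<alpha> \<star> \<eta>) s * - jacobi K \<alpha> \<eta>))"
  proof (rule sum.cong[OF refl])
    fix s assume s: "s \<in> K - {0}"
    have "(\<Sum>x\<in>K - {0}. \<alpha> x * \<eta> (s - x)) = (\<Sum>x\<in>K - {0}. \<alpha> (s * x) * \<eta> (s - s * x))"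
      by (rule sum.reindex_bij_betw[OF bij_mult[OF s], symmetric])
    also have "\<dots> = (\<Sum>x\<in>K - {0}. (\<alpha> \<star> \<eta>) s * (\<alpha> x * \<eta> (1 - x)))"
    proof (rule sum.cong[OF refl])
      fix x assume x: "x \<in> K - {0}"
      have "s - s * x = s * (1 - x)" by (simp add: algebra_simps)
      then show "\<alpha> (s * x) * \<eta> (s - s * x) = (\<alpha> \<star> \<eta>) s * (\<alpha> x * \<eta> (1 - x))"
        using assms s x by (simp add: char_mult char_mult_def)
    qed
    finally show "\<psi> s * (\<Sum>x\<in>K - {0}. \<alpha> x * \<eta> (s - x)) = \<psi> s * ((\<alpha> \<star> \<eta>) s * - jacobi K \<alpha> \<eta>)"
      using assms by (simp add: jacobi_conv sum_distrib_left)
  qed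
  also have "\<dots> = jacobi K \<alpha> \<eta> * G (\<alpha> \<star> \<eta>)"
    by (simp add: gauss_def sum_distrib_left sum_distrib_right sum_negf mult_ac)
  finally show ?thesis by simp
qed

text \<open>If the product is trivial, the correction term of \<open>gauss_mult\<close> turns
  \<alpha>(-1) into \<alpha>(-1) q, and this q is exactly the one built into \<open>gauss0\<close>.
  The case \<alpha> = \<eta> = \<epsilon>, in which this breaks down, is excluded.\<close>

lemma jacobi_gauss0:
  assumes "\<alpha> \<in> chars" "\<eta> \<in> chars" "\<alpha> \<noteq> \<epsilon>"
  shows "jacobi K \<alpha> \<eta> * gauss0 K \<psi> (\<alpha> \<star> \<eta>) = G \<alpha> * G \<eta>"
proof (cases "\<alpha> \<star> \<eta> = \<epsilon>")
  case True
  then have "\<eta> = char_inv \<alpha>" using assms char_mult_eq_triv_iff by blast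
  moreover have "char_inv \<alpha> (-1) = \<alpha> (-1)"
    using char_minus_1_square[OF assms(1)] by (simp add: char_inv_def inverse_unique)
  ultimately show ?thesis
    using assms gauss_mult[of \<alpha> \<eta>] by (simp add: gauss0_def gauss_triv jacobi_inv algebra_simps)
next
  case False
  then show ?thesis using assms gauss_mult by (simp add: gauss0_def)
qed

text \<open>The extra q in \<open>gauss0\<close> at \<epsilon> makes the reflection formula uniform,
  so that sums over all characters can be transformed without splitting off the trivial one.\<close>

lemma gauss0_gauss_inv:
  assumes "\<eta> \<in> chars"
  shows "gauss0 K \<psi> \<eta> * G (char_inv \<eta>) = \<eta> (-1) * of_nat (card K)"
proof (cases "\<eta> = \<epsilon>")
  case True
  moreover have "\<epsilon> (-1) = 1" by (simp add: triv_char_def)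
  ultimately show ?thesis by (simp add: gauss0_def gauss_triv)
next
  case False
  have "char_inv \<eta> (-1) = \<eta> (-1)"
    using char_minus_1_square[OF assms] by (simp add: char_inv_def inverse_unique)
  then show ?thesis
    using False assms gauss_mult[of \<eta> "char_inv \<eta>"]
    by (simp add: gauss0_def gauss_triv jacobi_inv algebra_simps)
qed

lemma gauss_gauss_inv:
  assumes "\<eta> \<in> chars" "\<eta> \<noteq> \<epsilon>"
  shows "G \<eta> * G (char_inv \<eta>) = \<eta> (-1) * of_nat (card K)"
  using gauss0_gauss_inv[OF assms(1)] assms(2) by (simp add: gauss0_def)

lemma char_minus_1_neq_0 [simp]: "\<eta> \<in> chars \<Longrightarrow> \<eta> (-1) \<noteq> 0"
  by (simp add: char_0_iff)

lemma gauss_neq_0 [simp]: "\<eta> \<in> chars \<Longrightarrow> G \<eta> \<noteq> 0"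
  using gauss0_gauss_inv[of "char_inv \<eta>"] by (metis card_neq(1) char_inv_in char_inv_inv
      char_minus_1_neq_0 mult_eq_0_iff)

text \<open>This moves the \<open>gauss0\<close> factors that vary with \<nu>1 and \<nu>2 from the
  denominator of a summand of F4 into the numerator, where they can be expanded as sums.\<close>

lemma inverse_gauss0:
  assumes "\<eta> \<in> chars"
  shows "inverse (gauss0 K \<psi> \<eta>) = \<eta> (-1) * G (char_inv \<eta>) / of_nat (card K)"
proof -
  have "gauss0 K \<psi> \<eta> * (\<eta> (-1) * G (char_inv \<eta>) / of_nat (card K)) =
      (\<eta> (-1) * \<eta> (-1)) * (of_nat (card K) / of_nat (card K))"
    using gauss0_gauss_inv[OF assms] by (simp add: field_simps)
  also have "\<dots> = 1" using char_minus_1_square[OF assms] by simp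
  finally show ?thesis by (rule inverse_unique)
qed

text \<open>Fourier inversion on the unit group: up to sign, the Gauss sums of the inverse
  characters are the Fourier coefficients of \<psi>. Orthogonality is applied at y / x.\<close>

lemma psi_expand:
  assumes "y \<in> K - {0}"
  shows "(\<Sum>\<nu>\<in>chars. G (char_inv \<nu>) * \<nu> y) = - ((of_nat (card K) - 1) * \<psi> y)"
proof -
  have "- (\<Sum>\<nu>\<in>chars. G (char_inv \<nu>) * \<nu> y) = (\<Sum>\<nu>\<in>chars. \<Sum>x\<in>K - {0}. \<psi> x * \<nu> (y / x))"
    using assms
    by (auto simp: gauss_def sum_distrib_left sum_distrib_right char_mult char_inverse char_inv_def
        divide_inverse mult_ac simp flip: sum_negf intro!: sum.cong)
  also have "\<dots> = (\<Sum>x\<in>K - {0}. \<psi> x * (\<Sum>\<nu>\<in>chars. \<nu> (y / x)))"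
    by (subst sum.swap) (simp add: sum_distrib_left)
  also have "\<dots> = (\<Sum>x\<in>K - {0}. if x = y then \<psi> x * (of_nat (card K) - 1) else 0)"
    using assms by (intro sum.cong) (auto simp: sum_over_chars)
  also have "\<dots> = \<psi> y * (of_nat (card K) - 1)"
    using assms finite_K by (subst sum.delta) auto
  finally have "- (\<Sum>\<nu>\<in>chars. G (char_inv \<nu>) * \<nu> y) = - (- ((of_nat (card K) - 1) * \<psi> y))"
    by (simp only: minus_minus mult.commute)
  then show ?thesis by (simp only: neg_equal_iff_equal)
qed

section \<open>From the character sum F4 to an Euler sum\<close>

definition exp_sum :: "('a \<Rightarrow> Qbar) \<Rightarrow> ('a \<Rightarrow> Qbar) \<Rightarrow> ('a \<Rightarrow> Qbar) \<Rightarrow> ('a \<Rightarrow> Qbar) \<Rightarrow> 'a \<Rightarrow> 'a \<Rightarrow> Qbar" where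
  "exp_sum \<alpha> \<beta> \<gamma>1 \<gamma>2 z1 z2 =
    (\<Sum>u\<in>K - {0}. \<Sum>v\<in>K - {0}. \<Sum>s\<in>K - {0}. \<Sum>t\<in>K - {0}.
      \<psi> u * \<psi> v * \<psi> s * \<psi> t * \<psi> (z1 * u * v / s) * \<psi> (z2 * u * v / t) *
      \<alpha> u * \<beta> v * char_inv \<gamma>1 s * char_inv \<gamma>2 t)"

lemma sum_prod4:
  fixes f g h k :: "'c \<Rightarrow> 'd::comm_semiring_1"
  shows "(\<Sum>u\<in>A. f u) * (\<Sum>v\<in>A. g v) * (\<Sum>s\<in>A. h s) * (\<Sum>t\<in>A. k t)
    = (\<Sum>u\<in>A. \<Sum>v\<in>A. \<Sum>s\<in>A. \<Sum>t\<in>A. f u * g v * h s * k t)"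
  by (simp only: flip: sum_distrib_left sum_distrib_right)

lemma sum_swap4:
  fixes F :: "'e \<Rightarrow> 'c \<Rightarrow> 'c \<Rightarrow> 'c \<Rightarrow> 'c \<Rightarrow> 'd::comm_monoid_add"
  shows "(\<Sum>\<nu>\<in>C. \<Sum>u\<in>A. \<Sum>v\<in>A. \<Sum>s\<in>A. \<Sum>t\<in>A. F \<nu> u v s t)
    = (\<Sum>u\<in>A. \<Sum>v\<in>A. \<Sum>s\<in>A. \<Sum>t\<in>A. \<Sum>\<nu>\<in>C. F \<nu> u v s t)"
proof -
  have "(\<Sum>\<nu>\<in>C. \<Sum>s\<in>A. \<Sum>t\<in>A. F \<nu> u v s t) = (\<Sum>s\<in>A. \<Sum>t\<in>A. \<Sum>\<nu>\<in>C. F \<nu> u v s t)" for u v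
    by (subst sum.swap, rule sum.cong[OF refl], rule sum.swap)
  then have "(\<Sum>\<nu>\<in>C. \<Sum>v\<in>A. \<Sum>s\<in>A. \<Sum>t\<in>A. F \<nu> u v s t)
      = (\<Sum>v\<in>A. \<Sum>s\<in>A. \<Sum>t\<in>A. \<Sum>\<nu>\<in>C. F \<nu> u v s t)" for u
    by (subst sum.swap) simp
  then show ?thesis by (subst sum.swap) simp
qed

text \<open>Four of the six Gauss sums are written out, with variables u, v, s, t. The values of
  \<nu>1 and \<nu>2 then combine to \<nu>1(z1 u v / s) and \<nu>2(z2 u v / t), and
  \<open>psi_expand\<close> sums them against the two remaining Gauss sums; this is the origin of
  the arguments in \<open>exp_sum\<close>. Inversion is available at units only, hence z1, z2
  \<noteq> 0.\<close>

lemma exp_sum_fourier: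
  assumes chars: "\<alpha> \<in> chars" "\<beta> \<in> chars" "\<gamma>1 \<in> chars" "\<gamma>2 \<in> chars"
    and z: "z1 \<in> K - {0}" "z2 \<in> K - {0}"
  shows "(of_nat (card K) - 1) ^ 2 * exp_sum \<alpha> \<beta> \<gamma>1 \<gamma>2 z1 z2 =
    (\<Sum>\<nu>1\<in>chars. \<Sum>\<nu>2\<in>chars. G (\<alpha> \<star> (\<nu>1 \<star> \<nu>2)) * G (\<beta> \<star> (\<nu>1 \<star> \<nu>2)) *
      G (char_inv (\<gamma>1 \<star> \<nu>1)) * G (char_inv (\<gamma>2 \<star> \<nu>2)) * G (char_inv \<nu>1) * G (char_inv \<nu>2) *
      \<nu>1 z1 * \<nu>2 z2)" (is "_ = ?R")
proof -
  let ?q = "of_nat (card K) - 1 :: Qbar"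
  let ?e = "\<lambda>u v s t. \<psi> u * \<psi> v * \<psi> s * \<psi> t * \<alpha> u * \<beta> v * char_inv \<gamma>1 s * char_inv \<gamma>2 t"
  let ?F = "\<lambda>\<nu>1 \<nu>2 u v s t. ?e u v s t *
      ((G (char_inv \<nu>1) * \<nu>1 (z1 * u * v / s)) * (G (char_inv \<nu>2) * \<nu>2 (z2 * u * v / t)))"
  have "?R = (\<Sum>\<nu>1\<in>chars. \<Sum>\<nu>2\<in>chars. \<Sum>u\<in>K - {0}. \<Sum>v\<in>K - {0}. \<Sum>s\<in>K - {0}. \<Sum>t\<in>K - {0}. ?F \<nu>1 \<nu>2 u v s t)"
  proof (intro sum.cong refl)
    fix \<nu>1 \<nu>2 assume \<nu>: "\<nu>1 \<in> chars" "\<nu>2 \<in> chars"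
    have "G (\<alpha> \<star> (\<nu>1 \<star> \<nu>2)) * G (\<beta> \<star> (\<nu>1 \<star> \<nu>2)) *
        G (char_inv (\<gamma>1 \<star> \<nu>1)) * G (char_inv (\<gamma>2 \<star> \<nu>2)) =
      (\<Sum>u\<in>K - {0}. \<Sum>v\<in>K - {0}. \<Sum>s\<in>K - {0}. \<Sum>t\<in>K - {0}.
        (\<psi> u * (\<alpha> \<star> (\<nu>1 \<star> \<nu>2)) u) * (\<psi> v * (\<beta> \<star> (\<nu>1 \<star> \<nu>2)) v) *
        (\<psi> s * char_inv (\<gamma>1 \<star> \<nu>1) s) * (\<psi> t * char_inv (\<gamma>2 \<star> \<nu>2) t))"
      by (simp only: gauss_def minus_mult_minus mult_minus_right mult_minus_left minus_minus
          flip: sum_prod4)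
    then have "G (\<alpha> \<star> (\<nu>1 \<star> \<nu>2)) * G (\<beta> \<star> (\<nu>1 \<star> \<nu>2)) *
        G (char_inv (\<gamma>1 \<star> \<nu>1)) * G (char_inv (\<gamma>2 \<star> \<nu>2)) *
        (G (char_inv \<nu>1) * G (char_inv \<nu>2) * \<nu>1 z1 * \<nu>2 z2) =
      (\<Sum>u\<in>K - {0}. \<Sum>v\<in>K - {0}. \<Sum>s\<in>K - {0}. \<Sum>t\<in>K - {0}.
        (\<psi> u * (\<alpha> \<star> (\<nu>1 \<star> \<nu>2)) u) * (\<psi> v * (\<beta> \<star> (\<nu>1 \<star> \<nu>2)) v) *
        (\<psi> s * char_inv (\<gamma>1 \<star> \<nu>1) s) * (\<psi> t * char_inv (\<gamma>2 \<star> \<nu>2) t) *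
        (G (char_inv \<nu>1) * G (char_inv \<nu>2) * \<nu>1 z1 * \<nu>2 z2))"
      by (simp only: sum_distrib_right)
    also have "\<dots> = (\<Sum>u\<in>K - {0}. \<Sum>v\<in>K - {0}. \<Sum>s\<in>K - {0}. \<Sum>t\<in>K - {0}. ?F \<nu>1 \<nu>2 u v s t)"
      using \<nu> chars z
      by (intro sum.cong refl)
        (simp add: char_mult char_inverse char_inv_def char_mult_def divide_inverse mult_ac)
    finally show "G (\<alpha> \<star> (\<nu>1 \<star> \<nu>2)) * G (\<beta> \<star> (\<nu>1 \<star> \<nu>2)) *
        G (char_inv (\<gamma>1 \<star> \<nu>1)) * G (char_inv (\<gamma>2 \<star> \<nu>2)) * G (char_inv \<nu>1) * G (char_inv \<nu>2) *
        \<nu>1 z1 * \<nu>2 z2 =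
      (\<Sum>u\<in>K - {0}. \<Sum>v\<in>K - {0}. \<Sum>s\<in>K - {0}. \<Sum>t\<in>K - {0}. ?F \<nu>1 \<nu>2 u v s t)"
      by (simp only: mult.assoc)
  qed
  also have "\<dots> = (\<Sum>u\<in>K - {0}. \<Sum>v\<in>K - {0}. \<Sum>s\<in>K - {0}. \<Sum>t\<in>K - {0}.
      \<Sum>\<nu>1\<in>chars. \<Sum>\<nu>2\<in>chars. ?F \<nu>1 \<nu>2 u v s t)"
    by (simp only: sum_swap4)
  also have "\<dots> = (\<Sum>u\<in>K - {0}. \<Sum>v\<in>K - {0}. \<Sum>s\<in>K - {0}. \<Sum>t\<in>K - {0}.
      ?q ^ 2 * (?e u v s t * (\<psi> (z1 * u * v / s) * \<psi> (z2 * u * v / t))))"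
  proof (intro sum.cong refl)
    fix u v s t assume uv: "u \<in> K - {0}" "v \<in> K - {0}" "s \<in> K - {0}" "t \<in> K - {0}"
    let ?y1 = "z1 * u * v / s" and ?y2 = "z2 * u * v / t"
    have y: "?y1 \<in> K - {0}" "?y2 \<in> K - {0}" using uv z by auto
    have "(\<Sum>\<nu>1\<in>chars. \<Sum>\<nu>2\<in>chars. ?F \<nu>1 \<nu>2 u v s t) = ?e u v s t *
        ((\<Sum>\<nu>\<in>chars. G (char_inv \<nu>) * \<nu> ?y1) * (\<Sum>\<nu>\<in>chars. G (char_inv \<nu>) * \<nu> ?y2))"
      by (simp only: flip: sum_distrib_left sum_distrib_right)
    also have "\<dots> = ?e u v s t * ((- (?q * \<psi> ?y1)) * (- (?q * \<psi> ?y2)))"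
      unfolding psi_expand[OF y(1)] psi_expand[OF y(2)] ..
    finally show "(\<Sum>\<nu>1\<in>chars. \<Sum>\<nu>2\<in>chars. ?F \<nu>1 \<nu>2 u v s t) =
        ?q ^ 2 * (?e u v s t * (\<psi> ?y1 * \<psi> ?y2))"
      by (simp add: power2_eq_square)
  qed
  also have "\<dots> = ?q ^ 2 * exp_sum \<alpha> \<beta> \<gamma>1 \<gamma>2 z1 z2"
    unfolding exp_sum_def sum_distrib_left by (simp add: mult_ac)
  finally show ?thesis ..
qed

text \<open>A finite analogue of a double Euler integral. The parameters cross over, z2 standing
  with \<gamma>1 and z1 with \<gamma>2, because s (1 - U + z2 U V) = s + u + z2 u v / t for U = -u /
  s and V = -v / t.\<close>

definition euler_sum :: "('a \<Rightarrow> Qbar) \<Rightarrow> ('a \<Rightarrow> Qbar) \<Rightarrow> ('a \<Rightarrow> Qbar) \<Rightarrow> ('a \<Rightarrow> Qbar) \<Rightarrow> 'a \<Rightarrow> 'a \<Rightarrow> Qbar" where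
  "euler_sum \<alpha> \<beta> \<gamma>1 \<gamma>2 z1 z2 =
    (\<Sum>u\<in>K - {0}. \<Sum>v\<in>K - {0}. \<alpha> u * \<beta> v *
      (char_inv \<alpha> \<star> \<gamma>1) (1 - u + z2 * u * v) * (char_inv \<beta> \<star> \<gamma>2) (1 - v + z1 * u * v))"

lemma exp_sum_euler:
  assumes chars: "\<alpha> \<in> chars" "\<beta> \<in> chars" "\<gamma>1 \<in> chars" "\<gamma>2 \<in> chars"
    and ne: "\<alpha> \<noteq> \<gamma>1" "\<beta> \<noteq> \<gamma>2"
    and z: "z1 \<in> K" "z2 \<in> K"
  shows "exp_sum \<alpha> \<beta> \<gamma>1 \<gamma>2 z1 z2 = \<alpha> (-1) * \<beta> (-1) *
    G (\<alpha> \<star> char_inv \<gamma>1) * G (\<beta> \<star> char_inv \<gamma>2) * euler_sum \<alpha> \<beta> \<gamma>1 \<gamma>2 z1 z2"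
proof -
  let ?\<theta>1 = "\<alpha> \<star> char_inv \<gamma>1" and ?\<theta>2 = "\<beta> \<star> char_inv \<gamma>2"
  have \<theta>: "?\<theta>1 \<in> chars" "?\<theta>2 \<in> chars" "?\<theta>1 \<noteq> \<epsilon>" "?\<theta>2 \<noteq> \<epsilon>"
    using chars ne by (auto simp: char_mult_eq_triv_iff) (metis char_inv_inv)+
  have inv: "char_inv \<alpha> \<star> \<gamma>1 = char_inv ?\<theta>1" "char_inv \<beta> \<star> \<gamma>2 = char_inv ?\<theta>2"
    by (simp_all add: char_inv_mult)
  let ?H = "\<lambda>u v s t. \<alpha> u * \<beta> v * (\<psi> (s * (1 - u + z2 * u * v)) * ?\<theta>1 s) *
      (\<psi> (t * (1 - v + z1 * u * v)) * ?\<theta>2 t)"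
  have "G ?\<theta>1 * G ?\<theta>2 * euler_sum \<alpha> \<beta> \<gamma>1 \<gamma>2 z1 z2 = (\<Sum>u\<in>K - {0}. \<Sum>v\<in>K - {0}. \<alpha> u * \<beta> v *
      (- char_inv ?\<theta>1 (1 - u + z2 * u * v) * G ?\<theta>1) * (- char_inv ?\<theta>2 (1 - v + z1 * u * v) * G ?\<theta>2))"
    unfolding euler_sum_def inv sum_distrib_left by (simp add: mult_ac)
  \<comment> \<open>Each value of a non-trivial character, also the one at 0, becomes an exponential
    sum in s or t.\<close>
  also have "\<dots> = (\<Sum>u\<in>K - {0}. \<Sum>v\<in>K - {0}. \<alpha> u * \<beta> v *
      (\<Sum>s\<in>K - {0}. \<psi> (s * (1 - u + z2 * u * v)) * ?\<theta>1 s) *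
      (\<Sum>t\<in>K - {0}. \<psi> (t * (1 - v + z1 * u * v)) * ?\<theta>2 t))"
    using \<theta> z by (intro sum.cong refl) (simp add: sum_psi_scale_nontriv)
  also have "\<dots> = (\<Sum>u\<in>K - {0}. \<Sum>v\<in>K - {0}. \<Sum>s\<in>K - {0}. \<Sum>t\<in>K - {0}. ?H u v s t)"
    by (simp only: flip: sum_distrib_left sum_distrib_right)
  \<comment> \<open>The sums over s and t move outside, so that u and v can be rescaled by -1/s and
    -1/t with s and t fixed.\<close>
  also have "\<dots> = (\<Sum>v\<in>K - {0}. \<Sum>s\<in>K - {0}. \<Sum>t\<in>K - {0}. \<Sum>u\<in>K - {0}. ?H u v s t)"
    by (subst sum.swap, rule sum.cong[OF refl], subst sum.swap, rule sum.cong[OF refl], rule sum.swap)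
  also have "\<dots> = (\<Sum>s\<in>K - {0}. \<Sum>t\<in>K - {0}. \<Sum>v\<in>K - {0}. \<Sum>u\<in>K - {0}. ?H u v s t)"
    by (subst sum.swap, rule sum.cong[OF refl], rule sum.swap)
  also have "\<dots> = (\<Sum>s\<in>K - {0}. \<Sum>t\<in>K - {0}. \<Sum>v\<in>K - {0}. \<Sum>u\<in>K - {0}.
      ?H (- (1 / s) * u) (- (1 / t) * v) s t)"
  proof (rule sum.cong[OF refl], rule sum.cong[OF refl])
    fix s t assume st: "s \<in> K - {0}" "t \<in> K - {0}"
    have "(\<Sum>v\<in>K - {0}. \<Sum>u\<in>K - {0}. ?H u v s t) =
        (\<Sum>v\<in>K - {0}. \<Sum>u\<in>K - {0}. ?H u (- (1 / t) * v) s t)"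
      using st by (intro sum.reindex_bij_betw[symmetric] bij_mult) auto
    also have "\<dots> = (\<Sum>v\<in>K - {0}. \<Sum>u\<in>K - {0}. ?H (- (1 / s) * u) (- (1 / t) * v) s t)"
      using st by (intro sum.cong refl sum.reindex_bij_betw[symmetric] bij_mult) auto
    finally show "(\<Sum>v\<in>K - {0}. \<Sum>u\<in>K - {0}. ?H u v s t) =
        (\<Sum>v\<in>K - {0}. \<Sum>u\<in>K - {0}. ?H (- (1 / s) * u) (- (1 / t) * v) s t)" .
  qed
  also have "\<dots> = (\<Sum>s\<in>K - {0}. \<Sum>t\<in>K - {0}. \<Sum>v\<in>K - {0}. \<Sum>u\<in>K - {0}.
      \<alpha> (-1) * \<beta> (-1) * (\<psi> u * \<psi> v * \<psi> s * \<psi> t * \<psi> (z1 * u * v / s) * \<psi> (z2 * u * v / t) *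
      \<alpha> u * \<beta> v * char_inv \<gamma>1 s * char_inv \<gamma>2 t))"
  proof (intro sum.cong refl)
    fix s t v u assume K: "s \<in> K - {0}" "t \<in> K - {0}" "v \<in> K - {0}" "u \<in> K - {0}"
    let ?u = "- (1 / s) * u" and ?v = "- (1 / t) * v"
    have 1: "s * (1 - ?u + z2 * ?u * ?v) = s + u + z2 * u * v / t"
        "t * (1 - ?v + z1 * ?u * ?v) = t + v + z1 * u * v / s"
      using K by (auto simp: field_simps)
    have 2: "\<alpha> ?u = \<alpha> (-1) * \<alpha> u * inverse (\<alpha> s)" "\<beta> ?v = \<beta> (-1) * \<beta> v * inverse (\<beta> t)"
      using K chars char_divide[of \<alpha> "(-1) * u" s] char_divide[of \<beta> "(-1) * v" t]
        char_mult[of \<alpha> "-1" u] char_mult[of \<beta> "-1" v] by (auto simp: divide_inverse mult_ac)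
    have "\<alpha> s \<noteq> 0" "\<beta> t \<noteq> 0" using K chars by (auto simp: char_0_iff)
    then have 3: "\<alpha> s * (\<beta> t * (inverse (\<alpha> s) * inverse (\<beta> t))) = 1" by (simp add: field_simps)
    show "?H ?u ?v s t = \<alpha> (-1) * \<beta> (-1) * (\<psi> u * \<psi> v * \<psi> s * \<psi> t * \<psi> (z1 * u * v / s) *
        \<psi> (z2 * u * v / t) * \<alpha> u * \<beta> v * char_inv \<gamma>1 s * char_inv \<gamma>2 t)"
      unfolding 1 2 using K z 3 by (simp add: psi_add char_mult_def char_inv_def mult_ac)
  qed
  also have "\<dots> = \<alpha> (-1) * \<beta> (-1) * (\<Sum>s\<in>K - {0}. \<Sum>t\<in>K - {0}. \<Sum>v\<in>K - {0}. \<Sum>u\<in>K - {0}.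
      \<psi> u * \<psi> v * \<psi> s * \<psi> t * \<psi> (z1 * u * v / s) * \<psi> (z2 * u * v / t) *
      \<alpha> u * \<beta> v * char_inv \<gamma>1 s * char_inv \<gamma>2 t)"
    unfolding sum_distrib_left ..
  also have "(\<Sum>s\<in>K - {0}. \<Sum>t\<in>K - {0}. \<Sum>v\<in>K - {0}. \<Sum>u\<in>K - {0}.
      \<psi> u * \<psi> v * \<psi> s * \<psi> t * \<psi> (z1 * u * v / s) * \<psi> (z2 * u * v / t) *
      \<alpha> u * \<beta> v * char_inv \<gamma>1 s * char_inv \<gamma>2 t) = exp_sum \<alpha> \<beta> \<gamma>1 \<gamma>2 z1 z2" (is "?L = _")
  proof -
    let ?E = "\<lambda>s t v u. \<psi> u * \<psi> v * \<psi> s * \<psi> t * \<psi> (z1 * u * v / s) * \<psi> (z2 * u * v / t) *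
      \<alpha> u * \<beta> v * char_inv \<gamma>1 s * char_inv \<gamma>2 t"
    have "?L = (\<Sum>t\<in>K - {0}. \<Sum>v\<in>K - {0}. \<Sum>u\<in>K - {0}. \<Sum>s\<in>K - {0}. ?E s t v u)"
      by (subst sum.swap, rule sum.cong[OF refl], subst sum.swap, rule sum.cong[OF refl], rule sum.swap)
    also have "\<dots> = (\<Sum>v\<in>K - {0}. \<Sum>u\<in>K - {0}. \<Sum>t\<in>K - {0}. \<Sum>s\<in>K - {0}. ?E s t v u)"
      by (subst sum.swap, rule sum.cong[OF refl], rule sum.swap)
    also have "\<dots> = (\<Sum>u\<in>K - {0}. \<Sum>v\<in>K - {0}. \<Sum>t\<in>K - {0}. \<Sum>s\<in>K - {0}. ?E s t v u)"
      by (rule sum.swap)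
    also have "\<dots> = (\<Sum>u\<in>K - {0}. \<Sum>v\<in>K - {0}. \<Sum>s\<in>K - {0}. \<Sum>t\<in>K - {0}. ?E s t v u)"
      by (rule sum.cong[OF refl], rule sum.cong[OF refl], rule sum.swap)
    finally show ?thesis by (simp only: exp_sum_def)
  qed
  finally have "G ?\<theta>1 * G ?\<theta>2 * euler_sum \<alpha> \<beta> \<gamma>1 \<gamma>2 z1 z2 =
    \<alpha> (-1) * \<beta> (-1) * exp_sum \<alpha> \<beta> \<gamma>1 \<gamma>2 z1 z2" .
  then have "\<alpha> (-1) * \<beta> (-1) * G ?\<theta>1 * G ?\<theta>2 * euler_sum \<alpha> \<beta> \<gamma>1 \<gamma>2 z1 z2 =
    (\<alpha> (-1) * \<alpha> (-1)) * (\<beta> (-1) * \<beta> (-1)) * exp_sum \<alpha> \<beta> \<gamma>1 \<gamma>2 z1 z2"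
    by (simp only: mult_ac)
  then show ?thesis using chars by (simp add: char_minus_1_square)
qed

text \<open>Each of the four uses of \<open>inverse_gauss0\<close> brings a factor 1/q and a sign.
  Two of the factors 1/q cancel against the two occurrences of \<open>gauss0\<close> at \<epsilon>,
  whose value is q. The signs \<nu>1(-1) and \<nu>2(-1) each occur twice and cancel, so the
  remaining constant is the same for all \<nu>1 and \<nu>2.\<close>

lemma appell_F4_exp_sum:
  assumes chars: "\<alpha> \<in> chars" "\<beta> \<in> chars" "\<gamma>1 \<in> chars" "\<gamma>2 \<in> chars"
    and z: "z1 \<in> K - {0}" "z2 \<in> K - {0}"
  shows "appell_F4 K \<psi> \<alpha> \<beta> \<gamma>1 \<gamma>2 z1 z2 =
    gauss0 K \<psi> \<gamma>1 * gauss0 K \<psi> \<gamma>2 * \<gamma>1 (-1) * \<gamma>2 (-1) / (G \<alpha> * G \<beta> * of_nat (card K) ^ 2) *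
    exp_sum \<alpha> \<beta> \<gamma>1 \<gamma>2 z1 z2"
proof -
  let ?q = "of_nat (card K) :: Qbar"
  let ?C = "gauss0 K \<psi> \<gamma>1 * gauss0 K \<psi> \<gamma>2 * \<gamma>1 (-1) * \<gamma>2 (-1) / (G \<alpha> * G \<beta> * ?q ^ 2)"
  let ?A = "\<lambda>\<nu>1 \<nu>2. G (\<alpha> \<star> (\<nu>1 \<star> \<nu>2)) * G (\<beta> \<star> (\<nu>1 \<star> \<nu>2)) *
      G (char_inv (\<gamma>1 \<star> \<nu>1)) * G (char_inv (\<gamma>2 \<star> \<nu>2)) * G (char_inv \<nu>1) * G (char_inv \<nu>2) *
      \<nu>1 z1 * \<nu>2 z2"
  have 0: "gauss0 K \<psi> \<epsilon> = ?q" by (simp add: gauss0_def gauss_triv)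
  have "poch K \<psi> \<alpha> (\<nu>1 \<star> \<nu>2) * poch K \<psi> \<beta> (\<nu>1 \<star> \<nu>2) /
        (poch0 K \<psi> \<gamma>1 \<nu>1 * poch0 K \<psi> \<gamma>2 \<nu>2 * poch0 K \<psi> \<epsilon> \<nu>1 * poch0 K \<psi> \<epsilon> \<nu>2) *
        \<nu>1 z1 * \<nu>2 z2 = ?C * ?A \<nu>1 \<nu>2" if \<nu>: "\<nu>1 \<in> chars" "\<nu>2 \<in> chars" for \<nu>1 \<nu>2
  proof -
    have sgn: "(\<gamma>1 \<star> \<nu>1) (-1) * (\<gamma>2 \<star> \<nu>2) (-1) * \<nu>1 (-1) * \<nu>2 (-1) = \<gamma>1 (-1) * \<gamma>2 (-1)"
    proof -
      have "(\<gamma>1 \<star> \<nu>1) (-1) * (\<gamma>2 \<star> \<nu>2) (-1) * \<nu>1 (-1) * \<nu>2 (-1) =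
          \<gamma>1 (-1) * \<gamma>2 (-1) * (\<nu>1 (-1) * \<nu>1 (-1)) * (\<nu>2 (-1) * \<nu>2 (-1))"
        by (simp only: char_mult_def mult_ac)
      then show ?thesis using \<nu> by (simp only: char_minus_1_square mult_1_right)
    qed
    have "poch K \<psi> \<alpha> (\<nu>1 \<star> \<nu>2) * poch K \<psi> \<beta> (\<nu>1 \<star> \<nu>2) /
        (poch0 K \<psi> \<gamma>1 \<nu>1 * poch0 K \<psi> \<gamma>2 \<nu>2 * poch0 K \<psi> \<epsilon> \<nu>1 * poch0 K \<psi> \<epsilon> \<nu>2) *
        \<nu>1 z1 * \<nu>2 z2 =
      G (\<alpha> \<star> (\<nu>1 \<star> \<nu>2)) * G (\<beta> \<star> (\<nu>1 \<star> \<nu>2)) / (G \<alpha> * G \<beta>) *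
      (gauss0 K \<psi> \<gamma>1 * gauss0 K \<psi> \<gamma>2 * ?q ^ 2) *
      (inverse (gauss0 K \<psi> (\<gamma>1 \<star> \<nu>1)) * inverse (gauss0 K \<psi> (\<gamma>2 \<star> \<nu>2)) *
       inverse (gauss0 K \<psi> \<nu>1) * inverse (gauss0 K \<psi> \<nu>2)) * \<nu>1 z1 * \<nu>2 z2"
      using \<nu> by (simp add: poch_def poch0_def 0 divide_inverse power2_eq_square mult_ac)
    also have "inverse (gauss0 K \<psi> (\<gamma>1 \<star> \<nu>1)) * inverse (gauss0 K \<psi> (\<gamma>2 \<star> \<nu>2)) *
       inverse (gauss0 K \<psi> \<nu>1) * inverse (gauss0 K \<psi> \<nu>2) =
       ((\<gamma>1 \<star> \<nu>1) (-1) * (\<gamma>2 \<star> \<nu>2) (-1) * \<nu>1 (-1) * \<nu>2 (-1)) * (G (char_inv (\<gamma>1 \<star> \<nu>1)) *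
       G (char_inv (\<gamma>2 \<star> \<nu>2)) * G (char_inv \<nu>1) * G (char_inv \<nu>2)) / ?q ^ 4"
      using \<nu> chars by (simp add: inverse_gauss0 power4_eq_xxxx)
    also note sgn
    finally show ?thesis
      by (simp add: power4_eq_xxxx power2_eq_square mult_ac)
  qed
  then have "appell_F4 K \<psi> \<alpha> \<beta> \<gamma>1 \<gamma>2 z1 z2 =
      1 / (1 - ?q) ^ 2 * (?C * (\<Sum>\<nu>1\<in>chars. \<Sum>\<nu>2\<in>chars. ?A \<nu>1 \<nu>2))"
    unfolding appell_F4_def sum_distrib_left by (simp only: cong: sum.cong)
  also have "(\<Sum>\<nu>1\<in>chars. \<Sum>\<nu>2\<in>chars. ?A \<nu>1 \<nu>2) = (1 - ?q) ^ 2 * exp_sum \<alpha> \<beta> \<gamma>1 \<gamma>2 z1 z2"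
    using exp_sum_fourier[OF assms] by (simp only: power2_commute)
  finally show ?thesis by simp
qed

text \<open>The Jacobi sums cancel all constants: \<open>jacobi_gauss0\<close> replaces j(\<alpha>,
  \<gamma>1/\<alpha>) times \<open>gauss0\<close> of \<gamma>1 by g(\<alpha>) g(\<gamma>1/\<alpha>),
  and g(\<gamma>1/\<alpha>) pairs with the g(\<alpha>/\<gamma>1) from \<open>exp_sum_euler\<close>
  to give q up to sign. The first uses \<alpha> \<noteq> \<epsilon>, the second \<alpha> \<noteq>
  \<gamma>1; likewise for \<beta> and \<gamma>2.\<close>

lemma appell_F4_euler:
  assumes chars: "\<alpha> \<in> chars" "\<beta> \<in> chars" "\<gamma>1 \<in> chars" "\<gamma>2 \<in> chars"
    and ne: "\<alpha> \<noteq> \<epsilon>" "\<beta> \<noteq> \<epsilon>" "\<alpha> \<noteq> \<gamma>1" "\<beta> \<noteq> \<gamma>2"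
    and z: "z1 \<in> K - {0}" "z2 \<in> K - {0}"
  shows "jacobi K \<alpha> (char_inv \<alpha> \<star> \<gamma>1) * jacobi K \<beta> (char_inv \<beta> \<star> \<gamma>2) *
    appell_F4 K \<psi> \<alpha> \<beta> \<gamma>1 \<gamma>2 z1 z2 = euler_sum \<alpha> \<beta> \<gamma>1 \<gamma>2 z1 z2"
proof -
  let ?q = "of_nat (card K) :: Qbar"
  let ?\<theta>1 = "\<alpha> \<star> char_inv \<gamma>1" and ?\<theta>2 = "\<beta> \<star> char_inv \<gamma>2"
  have \<theta>: "?\<theta>1 \<noteq> \<epsilon>" "?\<theta>2 \<noteq> \<epsilon>"
    using chars ne by (auto simp: char_mult_eq_triv_iff) (metis char_inv_inv)+
  have inv: "char_inv \<alpha> \<star> \<gamma>1 = char_inv ?\<theta>1" "char_inv \<beta> \<star> \<gamma>2 = char_inv ?\<theta>2"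
    by (simp_all add: char_inv_mult)
  have j: "jacobi K \<eta> (char_inv \<eta> \<star> \<gamma>) * gauss0 K \<psi> \<gamma> = G \<eta> * G (char_inv \<eta> \<star> \<gamma>)"
    if "\<eta> \<in> chars" "\<gamma> \<in> chars" "\<eta> \<noteq> \<epsilon>" for \<eta> \<gamma>
    using jacobi_gauss0[of \<eta> "char_inv \<eta> \<star> \<gamma>"] that by (simp flip: char_mult_assoc)
  have t: "G ?\<theta>1 * G (char_inv ?\<theta>1) = \<alpha> (-1) * \<gamma>1 (-1) * ?q"
      "G ?\<theta>2 * G (char_inv ?\<theta>2) = \<beta> (-1) * \<gamma>2 (-1) * ?q"
  proof -
    have "char_inv \<eta> (-1) = \<eta> (-1)" if "\<eta> \<in> chars" for \<eta>
      using char_minus_1_square[OF that] by (simp add: char_inv_def inverse_unique)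
    then show "G ?\<theta>1 * G (char_inv ?\<theta>1) = \<alpha> (-1) * \<gamma>1 (-1) * ?q"
      "G ?\<theta>2 * G (char_inv ?\<theta>2) = \<beta> (-1) * \<gamma>2 (-1) * ?q"
      using gauss_gauss_inv[of ?\<theta>1] gauss_gauss_inv[of ?\<theta>2] chars \<theta> by (simp_all add: char_mult_def)
  qed
  have "jacobi K \<alpha> (char_inv \<alpha> \<star> \<gamma>1) * jacobi K \<beta> (char_inv \<beta> \<star> \<gamma>2) *
    appell_F4 K \<psi> \<alpha> \<beta> \<gamma>1 \<gamma>2 z1 z2 =
    (jacobi K \<alpha> (char_inv \<alpha> \<star> \<gamma>1) * gauss0 K \<psi> \<gamma>1) * (jacobi K \<beta> (char_inv \<beta> \<star> \<gamma>2) * gauss0 K \<psi> \<gamma>2) *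
    \<gamma>1 (-1) * \<gamma>2 (-1) / (G \<alpha> * G \<beta> * ?q ^ 2) * exp_sum \<alpha> \<beta> \<gamma>1 \<gamma>2 z1 z2"
    using chars z by (simp add: appell_F4_exp_sum)
  also have "\<dots> = (G (char_inv ?\<theta>1) * G (char_inv ?\<theta>2)) *
    \<gamma>1 (-1) * \<gamma>2 (-1) / ?q ^ 2 * exp_sum \<alpha> \<beta> \<gamma>1 \<gamma>2 z1 z2"
    using chars ne by (simp add: j flip: inv)
  also have "\<dots> = (G ?\<theta>1 * G (char_inv ?\<theta>1)) * (G ?\<theta>2 * G (char_inv ?\<theta>2)) *
    (\<alpha> (-1) * \<beta> (-1) * \<gamma>1 (-1) * \<gamma>2 (-1)) / ?q ^ 2 * euler_sum \<alpha> \<beta> \<gamma>1 \<gamma>2 z1 z2"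
    using chars ne z by (simp add: exp_sum_euler mult_ac)
  also have "\<dots> = ((\<alpha> (-1) * \<alpha> (-1)) * (\<beta> (-1) * \<beta> (-1)) * (\<gamma>1 (-1) * \<gamma>1 (-1)) * (\<gamma>2 (-1) * \<gamma>2 (-1))) *
    euler_sum \<alpha> \<beta> \<gamma>1 \<gamma>2 z1 z2"
    unfolding t by (simp add: power2_eq_square)
  finally show ?thesis using chars by (simp add: char_minus_1_square)
qed

end

section \<open>The change of variables\<close>

context finite_subfield
begin

definition surface_sum ::
  "('b \<Rightarrow> Qbar) \<Rightarrow> ('b \<Rightarrow> Qbar) \<Rightarrow> ('b \<Rightarrow> Qbar) \<Rightarrow> ('b \<Rightarrow> Qbar) \<Rightarrow> 'b \<Rightarrow> 'b \<Rightarrow> Qbar" where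
  "surface_sum \<alpha> \<beta> \<gamma>1 \<gamma>2 l1 l2 = (\<Sum>(x1, x2)\<in>K \<times> K.
    \<alpha> x1 * \<beta> x2 * (char_inv \<alpha> \<star> \<gamma>1) (1 - x1) * (char_inv \<beta> \<star> \<gamma>2) (1 - x2) *
    (\<alpha> \<star> char_inv (\<gamma>1 \<star> \<gamma>2)) (1 - l1 * x1) * (\<beta> \<star> char_inv (\<gamma>1 \<star> \<gamma>2)) (1 - l2 * x2) *
    (\<gamma>1 \<star> \<gamma>2 \<star> char_inv (\<alpha> \<star> \<beta>)) (1 - l1 * x1 - l2 * x2))"

definition euler_term ::
  "('b \<Rightarrow> Qbar) \<Rightarrow> ('b \<Rightarrow> Qbar) \<Rightarrow> ('b \<Rightarrow> Qbar) \<Rightarrow> ('b \<Rightarrow> Qbar) \<Rightarrow> 'b \<Rightarrow> 'b \<Rightarrow> 'b \<Rightarrow> 'b \<Rightarrow> Qbar" where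
  "euler_term \<alpha> \<beta> \<gamma>1 \<gamma>2 z1 z2 u v = \<alpha> u * \<beta> v *
      (char_inv \<alpha> \<star> \<gamma>1) (1 - u + z2 * u * v) * (char_inv \<beta> \<star> \<gamma>2) (1 - v + z1 * u * v)"

text \<open>The substitution \<open>u = x1 / (1 - l2 x2)\<close>, \<open>v = x2 / (1 - l1 x1)\<close> rests on these identities.\<close>
lemma substitution_identities:
  fixes x1 x2 l1 l2 :: "'b"
  assumes "1 - l1 * x1 \<noteq> 0" "1 - l2 * x2 \<noteq> 0"
  defines "u \<equiv> x1 / (1 - l2 * x2)" and "v \<equiv> x2 / (1 - l1 * x1)"
    and "D \<equiv> 1 - l1 * x1 - l2 * x2"
  shows "1 - u + l2 * (1 - l1) * u * v = (1 - x1) * D / ((1 - l1 * x1) * (1 - l2 * x2))"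
    and "1 - v + l1 * (1 - l2) * u * v = (1 - x2) * D / ((1 - l1 * x1) * (1 - l2 * x2))"
    and "1 - l1 * l2 * u * v = D / ((1 - l1 * x1) * (1 - l2 * x2))"
    and "1 - l1 * u = D / (1 - l2 * x2)"
    and "1 - l2 * v = D / (1 - l1 * x1)"
proof -
  define A B where "A = 1 - l1 * x1" and "B = 1 - l2 * x2"
  have AB: "A \<noteq> 0" "B \<noteq> 0" using assms by (auto simp: A_def B_def)
  have uv: "u = x1 / B" "v = x2 / A" by (simp_all add: u_def v_def A_def B_def)
  have *: "A * B * (1 - u + l2 * (1 - l1) * u * v) = (1 - x1) * D"
    "A * B * (1 - v + l1 * (1 - l2) * u * v) = (1 - x2) * D"
    "A * B * (1 - l1 * l2 * u * v) = D" "B * (1 - l1 * u) = D" "A * (1 - l2 * v) = D"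
  proof -
    \<comment> \<open>These products eliminate u and v once denominators are cleared, and the claims
      become polynomial identities in x1 and x2.\<close>
    have e: "A * B * u = A * x1" "A * B * v = B * x2" "A * B * (u * v) = x1 * x2" "B * u = x1" "A * v = x2"
      using AB by (simp_all add: uv)
    have "A * B * (1 - u + l2 * (1 - l1) * u * v) = A * B - A * B * u + l2 * (1 - l1) * (A * B * (u * v))"
      by (simp add: algebra_simps)
    then show "A * B * (1 - u + l2 * (1 - l1) * u * v) = (1 - x1) * D"
      unfolding e by (simp add: A_def B_def D_def algebra_simps)
    have "A * B * (1 - v + l1 * (1 - l2) * u * v) = A * B - A * B * v + l1 * (1 - l2) * (A * B * (u * v))"
      by (simp add: algebra_simps)
    then show "A * B * (1 - v + l1 * (1 - l2) * u * v) = (1 - x2) * D"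
      unfolding e by (simp add: A_def B_def D_def algebra_simps)
    have "A * B * (1 - l1 * l2 * u * v) = A * B - l1 * l2 * (A * B * (u * v))"
      by (simp add: algebra_simps)
    then show "A * B * (1 - l1 * l2 * u * v) = D"
      unfolding e by (simp add: A_def B_def D_def algebra_simps)
    have "B * (1 - l1 * u) = B - l1 * (B * u)" "A * (1 - l2 * v) = A - l2 * (A * v)"
      by (simp_all add: algebra_simps)
    then show "B * (1 - l1 * u) = D" "A * (1 - l2 * v) = D"
      unfolding e by (simp_all add: A_def B_def D_def algebra_simps)
  qed
  have R: "y = z / w" if "w * y = z" "w \<noteq> 0" for w y z :: 'b
    using that by (metis nonzero_mult_div_cancel_left)
  show "1 - u + l2 * (1 - l1) * u * v = (1 - x1) * D / ((1 - l1 * x1) * (1 - l2 * x2))"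
    "1 - v + l1 * (1 - l2) * u * v = (1 - x2) * D / ((1 - l1 * x1) * (1 - l2 * x2))"
    "1 - l1 * l2 * u * v = D / ((1 - l1 * x1) * (1 - l2 * x2))"
    "1 - l1 * u = D / (1 - l2 * x2)" "1 - l2 * v = D / (1 - l1 * x1)"
    using *[THEN R] AB unfolding A_def[symmetric] B_def[symmetric] by simp_all
qed

text \<open>Here x1 and x2 solve the linear system x1 + l2 u x2 = u, l1 v x1 + x2 = v, whose
  determinant is 1 - l1 l2 u v.\<close>

lemma substitution_inverse:
  fixes u v l1 l2 :: "'b"
  assumes "1 - l1 * l2 * u * v \<noteq> 0"
  defines "x1 \<equiv> u * (1 - l2 * v) / (1 - l1 * l2 * u * v)"
    and "x2 \<equiv> v * (1 - l1 * u) / (1 - l1 * l2 * u * v)"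
  shows "1 - l1 * x1 = (1 - l1 * u) / (1 - l1 * l2 * u * v)"
    and "1 - l2 * x2 = (1 - l2 * v) / (1 - l1 * l2 * u * v)"
  using assms(1) unfolding x1_def x2_def by (simp_all add: field_simps)

text \<open>With A = 1 - l1 x1, B = 1 - l2 x2 and D = 1 - l1 x1 - l2 x2, the Euler term collects
  \<alpha>/(\<gamma>1 \<gamma>2) at A, \<beta>/(\<gamma>1 \<gamma>2) at B and \<gamma>1
  \<gamma>2/(\<alpha> \<beta>) at D, which are the exponents in the equation of the surface. Each of
  1 - l1 l2 u v, 1 - l1 u and 1 - l2 v is D divided by a nonzero element, so precisely the three
  curves are missed.\<close>

lemma surface_sum_euler:
  assumes chars: "\<alpha> \<in> chars" "\<beta> \<in> chars" "\<gamma>1 \<in> chars" "\<gamma>2 \<in> chars"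
    and l: "l1 \<in> K" "l2 \<in> K"
  shows "surface_sum \<alpha> \<beta> \<gamma>1 \<gamma>2 l1 l2 =
    (\<Sum>(u, v) \<in> {(u, v). u \<in> K - {0} \<and> v \<in> K - {0} \<and> l1 * l2 * u * v \<noteq> 1 \<and> l1 * u \<noteq> 1 \<and> l2 * v \<noteq> 1}.
      euler_term \<alpha> \<beta> \<gamma>1 \<gamma>2 (l1 * (1 - l2)) (l2 * (1 - l1)) u v)" (is "_ = (\<Sum>(u, v) \<in> ?Y. ?M u v)")
proof -
  let ?h = "\<lambda>x1 x2. \<alpha> x1 * \<beta> x2 * (char_inv \<alpha> \<star> \<gamma>1) (1 - x1) * (char_inv \<beta> \<star> \<gamma>2) (1 - x2) *
    (\<alpha> \<star> char_inv (\<gamma>1 \<star> \<gamma>2)) (1 - l1 * x1) * (\<beta> \<star> char_inv (\<gamma>1 \<star> \<gamma>2)) (1 - l2 * x2) *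
    (\<gamma>1 \<star> \<gamma>2 \<star> char_inv (\<alpha> \<star> \<beta>)) (1 - l1 * x1 - l2 * x2)"
  let ?X = "{(x1, x2). x1 \<in> K - {0} \<and> x2 \<in> K - {0} \<and>
    1 - l1 * x1 \<noteq> 0 \<and> 1 - l2 * x2 \<noteq> 0 \<and> 1 - l1 * x1 - l2 * x2 \<noteq> 0}"
  have "surface_sum \<alpha> \<beta> \<gamma>1 \<gamma>2 l1 l2 = (\<Sum>(x1, x2)\<in>?X. ?h x1 x2)"
    unfolding surface_sum_def using finite_K chars
    by (intro sum.mono_neutral_right) (auto simp: char_mult_def char_inv_def)
  also have "\<dots> = (\<Sum>(u, v)\<in>?Y. ?M u v)"
  proof (rule sum.reindex_bij_witness[
      where i = "\<lambda>(u, v). (u * (1 - l2 * v) / (1 - l1 * l2 * u * v), v * (1 - l1 * u) / (1 - l1 * l2 * u * v))"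
      and j = "\<lambda>(x1, x2). (x1 / (1 - l2 * x2), x2 / (1 - l1 * x1))"])
    fix p assume "p \<in> ?X"
    then obtain x1 x2 where p: "p = (x1, x2)" and x: "x1 \<in> K - {0}" "x2 \<in> K - {0}"
      "1 - l1 * x1 \<noteq> 0" "1 - l2 * x2 \<noteq> 0" "1 - l1 * x1 - l2 * x2 \<noteq> 0" by blast
    define u v D A B where "u = x1 / (1 - l2 * x2)" and "v = x2 / (1 - l1 * x1)"
      and "D = 1 - l1 * x1 - l2 * x2" and "A = 1 - l1 * x1" and "B = 1 - l2 * x2"
    note id = substitution_identities[OF x(3,4), folded u_def v_def D_def, folded A_def B_def]
    have AB: "A \<noteq> 0" "B \<noteq> 0" "D \<noteq> 0" "A \<in> K" "B \<in> K" "D \<in> K"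
      using x l by (auto simp: A_def B_def D_def)
    have uv: "u = x1 / B" "v = x2 / A" by (simp_all add: u_def v_def A_def B_def)
    have *: "1 - l1 * l2 * u * v \<noteq> 0" "1 - l1 * u \<noteq> 0" "1 - l2 * v \<noteq> 0"
      using AB by (simp_all add: id)
    show "(case p of (x1, x2) \<Rightarrow> (x1 / (1 - l2 * x2), x2 / (1 - l1 * x1))) \<in> ?Y"
      using x l * by (simp add: p flip: u_def v_def) (simp add: u_def v_def)
    have "u * (1 - l2 * v) / (1 - l1 * l2 * u * v) = x1" "v * (1 - l1 * u) / (1 - l1 * l2 * u * v) = x2"
      unfolding id(3,4,5) using AB by (simp_all add: uv)
    then show "(\<lambda>(u, v). (u * (1 - l2 * v) / (1 - l1 * l2 * u * v), v * (1 - l1 * u) / (1 - l1 * l2 * u * v)))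
        (case p of (x1, x2) \<Rightarrow> (x1 / (1 - l2 * x2), x2 / (1 - l1 * x1))) = p"
      unfolding p prod.case u_def[symmetric] v_def[symmetric] by simp
    have nz: "\<eta> A \<noteq> 0" "\<eta> B \<noteq> 0" "\<eta> D \<noteq> 0" if "\<eta> \<in> chars" for \<eta>
      using AB that by (auto simp: char_0_iff)
    \<comment> \<open>Opaque names keep \<open>field_simps\<close> from multiplying out the
      arguments of the characters.\<close>
    define y1 y2 where "y1 = 1 - x1" and "y2 = 1 - x2"
    note y_def = this
    have y: "y1 \<in> K" "y2 \<in> K" using x by (auto simp: y_def)
    have "?M u v = ?h x1 x2"
      unfolding euler_term_def id(1,2) D_def[symmetric]
      unfolding uv A_def[symmetric] B_def[symmetric] y_def[symmetric]
      using chars x AB nz y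
      by (simp add: char_mult char_divide char_mult_def char_inv_def field_simps)
    then show "(case (case p of (x1, x2) \<Rightarrow> (x1 / (1 - l2 * x2), x2 / (1 - l1 * x1))) of (u, v) \<Rightarrow> ?M u v)
        = (case p of (x1, x2) \<Rightarrow> ?h x1 x2)"
      by (simp add: p u_def v_def)
  next
    fix p assume "p \<in> ?Y"
    then obtain u v where p: "p = (u, v)" and uv: "u \<in> K - {0}" "v \<in> K - {0}"
      and ne: "1 - l1 * l2 * u * v \<noteq> 0" "1 - l1 * u \<noteq> 0" "1 - l2 * v \<noteq> 0" by fastforce
    define x1 x2 where "x1 = u * (1 - l2 * v) / (1 - l1 * l2 * u * v)"
      and "x2 = v * (1 - l1 * u) / (1 - l1 * l2 * u * v)"
    note id = substitution_inverse[OF ne(1), folded x1_def x2_def]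
    have nz: "1 - l1 * x1 \<noteq> 0" "1 - l2 * x2 \<noteq> 0" using ne by (auto simp: id)
    have uv_eq: "x1 / (1 - l2 * x2) = u" "x2 / (1 - l1 * x1) = v"
      unfolding id using ne by (simp_all add: x1_def x2_def)
    have "1 - l1 * u = (1 - l1 * x1 - l2 * x2) / (1 - l2 * x2)"
      using substitution_identities(4)[OF nz] unfolding uv_eq .
    with ne have D: "1 - l1 * x1 - l2 * x2 \<noteq> 0" by auto
    have "x1 \<in> K - {0}" "x2 \<in> K - {0}"
      using uv l ne by (auto simp: x1_def x2_def)
    with nz D show "(case p of (u, v) \<Rightarrow>
        (u * (1 - l2 * v) / (1 - l1 * l2 * u * v), v * (1 - l1 * u) / (1 - l1 * l2 * u * v))) \<in> ?X"
      by (simp add: p flip: x1_def x2_def)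
    show "(\<lambda>(x1, x2). (x1 / (1 - l2 * x2), x2 / (1 - l1 * x1)))
      (case p of (u, v) \<Rightarrow>
        (u * (1 - l2 * v) / (1 - l1 * l2 * u * v), v * (1 - l1 * u) / (1 - l1 * l2 * u * v))) = p"
      using uv_eq by (simp add: p flip: x1_def x2_def)
  qed
  finally show ?thesis .
qed

text \<open>For v = 1 / l2 and u = w / l1 both trinomials are multiples of 1 - w, namely 1 - w and
  (l2 - 1)(1 - w) / l2, so a Jacobi sum in w remains. The result is -S2.\<close>

lemma sum_curve_v:
  assumes chars: "\<alpha> \<in> chars" "\<beta> \<in> chars" "\<gamma>1 \<in> chars" "\<gamma>2 \<in> chars"
    and l: "l1 \<in> K - {0}" "l2 \<in> K - {0}"
  shows "(\<Sum>u\<in>K - {0}. euler_term \<alpha> \<beta> \<gamma>1 \<gamma>2 (l1 * (1 - l2)) (l2 * (1 - l1)) u (1 / l2)) =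
    - (jacobi K (char_inv (\<alpha> \<star> \<beta>) \<star> \<gamma>1 \<star> \<gamma>2) \<alpha> *
      char_inv \<gamma>2 l2 * (char_inv \<beta> \<star> \<gamma>2) (l2 - 1) * char_inv \<alpha> l1)"
proof -
  let ?\<eta> = "char_inv (\<alpha> \<star> \<beta>) \<star> \<gamma>1 \<star> \<gamma>2"
  let ?C = "char_inv \<gamma>2 l2 * (char_inv \<beta> \<star> \<gamma>2) (l2 - 1) * char_inv \<alpha> l1"
  have "1 / l1 \<in> K - {0}" using l by auto
  then have "(\<Sum>u\<in>K - {0}. euler_term \<alpha> \<beta> \<gamma>1 \<gamma>2 (l1 * (1 - l2)) (l2 * (1 - l1)) u (1 / l2)) =
    (\<Sum>w\<in>K - {0}. euler_term \<alpha> \<beta> \<gamma>1 \<gamma>2 (l1 * (1 - l2)) (l2 * (1 - l1)) (1 / l1 * w) (1 / l2))"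
    by (rule sum.reindex_bij_betw[OF bij_mult, symmetric])
  also have "\<dots> = (\<Sum>w\<in>K - {0}. ?C * (\<alpha> w * ?\<eta> (1 - w)))"
  proof (rule sum.cong[OF refl])
    fix w assume w: "w \<in> K - {0}"
    define y m where "y = 1 - w" and "m = l2 - 1"
    have ym: "y \<in> K" "m \<in> K" using l w by (auto simp: y_def m_def)
    have e: "1 - 1 / l1 * w + l2 * (1 - l1) * (1 / l1 * w) * (1 / l2) = y"
      "1 - 1 / l2 + l1 * (1 - l2) * (1 / l1 * w) * (1 / l2) = m * y / l2"
      using l by (auto simp: field_simps y_def m_def)
    have nz: "\<beta> l2 \<noteq> 0" using l chars by (auto simp: char_0_iff)
    show "euler_term \<alpha> \<beta> \<gamma>1 \<gamma>2 (l1 * (1 - l2)) (l2 * (1 - l1)) (1 / l1 * w) (1 / l2) =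
      ?C * (\<alpha> w * ?\<eta> (1 - w))"
      unfolding euler_term_def e y_def[symmetric] m_def[symmetric] using chars l w nz ym
      by (simp add: char_mult char_divide char_mult_def char_inv_def field_simps)
  qed
  also have "\<dots> = ?C * - jacobi K \<alpha> ?\<eta>"
    using chars by (simp add: jacobi_conv flip: sum_distrib_left)
  also have "jacobi K \<alpha> ?\<eta> = jacobi K ?\<eta> \<alpha>"
    using chars by (intro jacobi_commute) simp_all
  finally show ?thesis by (simp add: mult_ac)
qed

text \<open>This symmetry reduces the curve l1 u = 1, which contributes -S1, to the curve l2 v =
  1.\<close>

lemma euler_term_swap: "euler_term \<alpha> \<beta> \<gamma>1 \<gamma>2 z1 z2 u v = euler_term \<beta> \<alpha> \<gamma>2 \<gamma>1 z2 z1 v u"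
  by (simp add: euler_term_def mult_ac)

lemma sum_curve_u:
  assumes chars: "\<alpha> \<in> chars" "\<beta> \<in> chars" "\<gamma>1 \<in> chars" "\<gamma>2 \<in> chars"
    and l: "l1 \<in> K - {0}" "l2 \<in> K - {0}"
  shows "(\<Sum>v\<in>K - {0}. euler_term \<alpha> \<beta> \<gamma>1 \<gamma>2 (l1 * (1 - l2)) (l2 * (1 - l1)) (1 / l1) v) =
    - (jacobi K (char_inv (\<alpha> \<star> \<beta>) \<star> \<gamma>1 \<star> \<gamma>2) \<beta> *
      char_inv \<gamma>1 l1 * (char_inv \<alpha> \<star> \<gamma>1) (l1 - 1) * char_inv \<beta> l2)"
proof -
  have "char_inv (\<alpha> \<star> \<beta>) \<star> \<gamma>1 \<star> \<gamma>2 = char_inv (\<beta> \<star> \<alpha>) \<star> \<gamma>2 \<star> \<gamma>1"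
    by (simp add: char_mult_def char_inv_def fun_eq_iff mult_ac)
  then show ?thesis
    using sum_curve_v[OF chars(2,1,4,3) l(2,1)] by (simp add: euler_term_swap[of \<alpha>])
qed

text \<open>For u = w / l1 and v = 1 / (l2 w) the trinomials become (1 - w) / l1 and -(1 - w) / (l2
  w). The Jacobi sum that arises has \<gamma>1 \<gamma>2/(\<alpha> \<beta>) as second character;
  \<open>jacobi_reflect\<close> brings it to the form in S0 at the cost of a value at -1.\<close>

lemma sum_hyperbola:
  assumes chars: "\<alpha> \<in> chars" "\<beta> \<in> chars" "\<gamma>1 \<in> chars" "\<gamma>2 \<in> chars"
    and l: "l1 \<in> K - {0}" "l2 \<in> K - {0}"
  shows "(\<Sum>u\<in>K - {0}. euler_term \<alpha> \<beta> \<gamma>1 \<gamma>2 (l1 * (1 - l2)) (l2 * (1 - l1)) u (1 / (l1 * l2 * u))) =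
    - ((\<alpha> \<star> \<beta>) (-1) * jacobi K (\<alpha> \<star> char_inv \<gamma>2) (\<beta> \<star> char_inv \<gamma>1) *
      char_inv \<gamma>1 l1 * char_inv \<gamma>2 l2)"
proof -
  let ?\<eta> = "char_inv ((\<alpha> \<star> char_inv \<gamma>2) \<star> (\<beta> \<star> char_inv \<gamma>1))"
  let ?C = "(char_inv \<beta> \<star> \<gamma>2) (-1) * char_inv \<gamma>1 l1 * char_inv \<gamma>2 l2"
  have "1 / l1 \<in> K - {0}" using l by auto
  then have "(\<Sum>u\<in>K - {0}. euler_term \<alpha> \<beta> \<gamma>1 \<gamma>2 (l1 * (1 - l2)) (l2 * (1 - l1)) u (1 / (l1 * l2 * u))) =
    (\<Sum>w\<in>K - {0}. euler_term \<alpha> \<beta> \<gamma>1 \<gamma>2 (l1 * (1 - l2)) (l2 * (1 - l1)) (1 / l1 * w) (1 / (l1 * l2 * (1 / l1 * w))))"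
    by (rule sum.reindex_bij_betw[OF bij_mult, symmetric])
  also have "\<dots> = (\<Sum>w\<in>K - {0}. ?C * ((\<alpha> \<star> char_inv \<gamma>2) w * ?\<eta> (1 - w)))"
  proof (rule sum.cong[OF refl])
    fix w assume w: "w \<in> K - {0}"
    define y n where "y = 1 - w" and "n = (-1 :: 'b)"
    have yn: "y \<in> K" "n \<in> K" using l w by (auto simp: y_def n_def)
    have e: "1 - 1 / l1 * w + l2 * (1 - l1) * (1 / l1 * w) * (1 / (l1 * l2 * (1 / l1 * w))) = y / l1"
      "1 - 1 / (l1 * l2 * (1 / l1 * w)) + l1 * (1 - l2) * (1 / l1 * w) * (1 / (l1 * l2 * (1 / l1 * w))) =
        n * y / (l2 * w)"
      "1 / (l1 * l2 * (1 / l1 * w)) = 1 / (l2 * w)"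
      using l w by (auto simp: field_simps y_def n_def)
    have nz: "\<alpha> l1 \<noteq> 0" "\<beta> l2 \<noteq> 0" "\<beta> w \<noteq> 0" using l w chars by (auto simp: char_0_iff)
    show "euler_term \<alpha> \<beta> \<gamma>1 \<gamma>2 (l1 * (1 - l2)) (l2 * (1 - l1)) (1 / l1 * w) (1 / (l1 * l2 * (1 / l1 * w))) =
      ?C * ((\<alpha> \<star> char_inv \<gamma>2) w * ?\<eta> (1 - w))"
      unfolding euler_term_def e(1,2) y_def[symmetric] n_def[symmetric]
      unfolding e(3) using chars l w nz yn
      by (simp add: char_mult char_divide char_mult_def char_inv_def field_simps)
  qed
  also have "\<dots> = ?C * - jacobi K (\<alpha> \<star> char_inv \<gamma>2) ?\<eta>"
    using chars by (simp add: jacobi_conv flip: sum_distrib_left)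
  also have "\<dots> = - ((char_inv \<beta> \<star> \<gamma>2) (-1) * jacobi K (\<alpha> \<star> char_inv \<gamma>2) ?\<eta> *
      char_inv \<gamma>1 l1 * char_inv \<gamma>2 l2)"
    by (simp add: mult_ac)
  also have "(char_inv \<beta> \<star> \<gamma>2) (-1) * jacobi K (\<alpha> \<star> char_inv \<gamma>2) ?\<eta> =
      (\<alpha> \<star> \<beta>) (-1) * jacobi K (\<alpha> \<star> char_inv \<gamma>2) (\<beta> \<star> char_inv \<gamma>1)"
  proof -
    have s: "\<eta> (-1) * \<eta> (-1) = 1" "inverse (\<eta> (-1)) = \<eta> (-1)" if "\<eta> \<in> chars" for \<eta>
      using char_minus_1_square[OF that] by (auto simp: inverse_unique)
    have "(\<alpha> \<star> \<beta>) (-1) * jacobi K (\<alpha> \<star> char_inv \<gamma>2) (\<beta> \<star> char_inv \<gamma>1) =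
        \<alpha> (-1) * \<beta> (-1) * (\<alpha> (-1) * \<gamma>2 (-1)) * jacobi K (\<alpha> \<star> char_inv \<gamma>2) ?\<eta>"
      using chars jacobi_reflect[of "\<alpha> \<star> char_inv \<gamma>2" "\<beta> \<star> char_inv \<gamma>1"]
      by (simp add: char_mult_def[of _ _ "-1"] char_inv_def[of _ "-1"] s)
    also have "\<dots> = (\<alpha> (-1) * \<alpha> (-1)) * (char_inv \<beta> \<star> \<gamma>2) (-1) * jacobi K (\<alpha> \<star> char_inv \<gamma>2) ?\<eta>"
      using chars by (simp only: char_mult_def[of _ _ "-1"] char_inv_def[of _ "-1"] s(2) mult_ac)
    finally show ?thesis using chars by (simp add: s)
  qed
  finally show ?thesis .
qed

end

section \<open>The surface sum in terms of F4\<close>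

context finite_subfield_add_char
begin

text \<open>The Euler sum over all units u, v is J F4, and the curves contribute -S0, -S1, -S2 to
  it; removing them therefore adds S0 + S1 + S2. The condition l1, l2 \<noteq> 1 makes both
  arguments of F4 units.\<close>

lemma surface_sum_appell_F4:
  assumes chars: "\<alpha> \<in> chars" "\<beta> \<in> chars" "\<gamma>1 \<in> chars" "\<gamma>2 \<in> chars"
    and ne: "\<alpha> \<noteq> \<epsilon>" "\<beta> \<noteq> \<epsilon>" "\<alpha> \<noteq> \<gamma>1" "\<beta> \<noteq> \<gamma>2"
    and l: "l1 \<in> K - {0, 1}" "l2 \<in> K - {0, 1}"
  shows "surface_sum \<alpha> \<beta> \<gamma>1 \<gamma>2 l1 l2 =
    jacobi K \<alpha> (char_inv \<alpha> \<star> \<gamma>1) * jacobi K \<beta> (char_inv \<beta> \<star> \<gamma>2) *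
      appell_F4 K \<psi> \<alpha> \<beta> \<gamma>1 \<gamma>2 (l1 * (1 - l2)) (l2 * (1 - l1))
    + (\<alpha> \<star> \<beta>) (-1) * jacobi K (\<alpha> \<star> char_inv \<gamma>2) (\<beta> \<star> char_inv \<gamma>1) *
      char_inv \<gamma>1 l1 * char_inv \<gamma>2 l2
    + jacobi K (char_inv (\<alpha> \<star> \<beta>) \<star> \<gamma>1 \<star> \<gamma>2) \<beta> *
      char_inv \<gamma>1 l1 * (char_inv \<alpha> \<star> \<gamma>1) (l1 - 1) * char_inv \<beta> l2
    + jacobi K (char_inv (\<alpha> \<star> \<beta>) \<star> \<gamma>1 \<star> \<gamma>2) \<alpha> *
      char_inv \<gamma>2 l2 * (char_inv \<beta> \<star> \<gamma>2) (l2 - 1) * char_inv \<alpha> l1"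
proof -
  let ?z1 = "l1 * (1 - l2)" and ?z2 = "l2 * (1 - l1)"
  let ?M = "\<lambda>(u, v). euler_term \<alpha> \<beta> \<gamma>1 \<gamma>2 ?z1 ?z2 u v"
  let ?A = "{(u, v). u \<in> K - {0} \<and> v \<in> K - {0} \<and> l1 * l2 * u * v = 1}"
  let ?B = "{(u, v). u \<in> K - {0} \<and> v \<in> K - {0} \<and> l1 * u = 1}"
  let ?C = "{(u, v). u \<in> K - {0} \<and> v \<in> K - {0} \<and> l2 * v = 1}"
  let ?S = "?A \<union> ?B \<union> ?C"
  let ?P = "(K - {0}) \<times> (K - {0})"
  have fin: "finite ?P" using finite_K by simp
  have l0: "l1 \<in> K - {0}" "l2 \<in> K - {0}" using l by auto
  text \<open>The three curves meet in a single point only, where the summand vanishes.\<close>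
  have meet: "?M p = 0" if "p \<in> ?A \<inter> ?B \<union> (?A \<union> ?B) \<inter> ?C" for p
  proof -
    obtain u v where p0: "p = (u, v)" by (cases p)
    have "l1 * l2 * u * v = (l1 * u) * (l2 * v)" by (simp add: mult_ac)
    with that p0 have p: "p = (u, v)" "u \<noteq> 0" "v \<noteq> 0" "l1 * u = 1" "l2 * v = 1" by auto
    have "1 - u + ?z2 * u * v = 1 - u + (l2 * v) * u - (l1 * u) * (l2 * v)"
      by (simp add: algebra_simps)
    also have "\<dots> = 0" unfolding p(4,5) by simp
    finally show ?thesis using chars by (simp add: p euler_term_def char_mult_def)
  qed
  have inv: "1 / y = w" if "y * w = 1" for y w :: 'a
    using inverse_unique[OF that] by (simp add: inverse_eq_divide)
  have "(\<Sum>p\<in>?P. ?M p) = (\<Sum>p\<in>?P - ?S. ?M p) + (\<Sum>p\<in>?S. ?M p)"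
    by (rule sum.subset_diff[OF _ fin]) auto
  also have "(\<Sum>p\<in>?S. ?M p) = (\<Sum>p\<in>?A \<union> ?B. ?M p) + (\<Sum>p\<in>?C. ?M p)"
    using meet by (intro sum.union_inter_neutral) (auto intro!: finite_subset[OF _ fin])
  also have "(\<Sum>p\<in>?A \<union> ?B. ?M p) = (\<Sum>p\<in>?A. ?M p) + (\<Sum>p\<in>?B. ?M p)"
    using meet by (intro sum.union_inter_neutral) (auto intro!: finite_subset[OF _ fin])
  also have "(\<Sum>p\<in>?A. ?M p) = (\<Sum>u\<in>K - {0}. ?M (u, 1 / (l1 * l2 * u)))"
    using l by (intro sum.reindex_bij_witness[where i = "\<lambda>u. (u, 1 / (l1 * l2 * u))" and j = fst])
      (auto simp: inv)
  also have "(\<Sum>p\<in>?B. ?M p) = (\<Sum>v\<in>K - {0}. ?M (1 / l1, v))"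
    using l by (intro sum.reindex_bij_witness[where i = "\<lambda>v. (1 / l1, v)" and j = snd])
      (auto simp: inv)
  also have "(\<Sum>p\<in>?C. ?M p) = (\<Sum>u\<in>K - {0}. ?M (u, 1 / l2))"
    using l by (intro sum.reindex_bij_witness[where i = "\<lambda>u. (u, 1 / l2)" and j = fst])
      (auto simp: inv)
  also have "?P - ?S = {(u, v). u \<in> K - {0} \<and> v \<in> K - {0} \<and> l1 * l2 * u * v \<noteq> 1 \<and> l1 * u \<noteq> 1 \<and> l2 * v \<noteq> 1}"
    by auto
  finally have "(\<Sum>p\<in>?P. ?M p) = surface_sum \<alpha> \<beta> \<gamma>1 \<gamma>2 l1 l2
    + ((\<Sum>u\<in>K - {0}. ?M (u, 1 / (l1 * l2 * u))) + (\<Sum>v\<in>K - {0}. ?M (1 / l1, v))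
    + (\<Sum>u\<in>K - {0}. ?M (u, 1 / l2)))"
    using l by (simp only: surface_sum_euler[OF chars] DiffD1)
  moreover have "(\<Sum>p\<in>?P. ?M p) = euler_sum \<alpha> \<beta> \<gamma>1 \<gamma>2 ?z1 ?z2"
    by (simp add: euler_sum_def euler_term_def sum.cartesian_product)
  moreover have "?z1 \<in> K - {0}" "?z2 \<in> K - {0}" using l by auto
  ultimately show ?thesis
    using appell_F4_euler[OF chars ne, of ?z1 ?z2] sum_hyperbola[OF chars l0]
      sum_curve_u[OF chars l0] sum_curve_v[OF chars l0]
    by (simp add: algebra_simps)
qed

end

section \<open>Extensions of the base field\<close>

interpretation base: finite_subfield "UNIV :: 'a::{field,finite} set"
  by standard auto

lemma card_base_gt_1: "CARD('a::{field,finite}) > 1"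
  by (rule base.card_gt_1)

lemma frob_0 [simp]: "frob 0 = 0" and frob_1 [simp]: "frob 1 = 1"
  and frob_mult: "frob (x * y) = frob x * frob y"
  and frob_inverse: "frob (inverse x) = inverse (frob x)"
  and frob_to_ac [simp]: "frob (to_ac (a :: 'a::{field,finite})) = to_ac a"
proof -
  have "to_ac (a ^ CARD('a)) = to_ac a" using base.power_card[of a] by simp
  then show "frob (to_ac a) = to_ac a" by (simp add: frob_def)
qed (auto simp: frob_def power_mult_distrib power_inverse)

text \<open>
  \<open>(X + 1)^q\<close> and \<open>X^q + 1\<close> are monic of degree \<open>q\<close> and agree at the \<open>q\<close> points of the base field.
\<close>
lemma frob_add_1: "frob (x + 1) = frob x + (1 :: 'a::{field,finite} alg_closure)"
proof -
  let ?q = "CARD('a)"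
  have q: "?q > 0" by simp
  have "[:1, 1:] ^ ?q = Polynomial.monom (1 :: 'a alg_closure) ?q + 1"
  proof (rule poly_eqI_degree_lead_coeff[where n = ?q and A = "range to_ac"])
    have d: "Polynomial.degree ([:1, 1:] ^ ?q :: 'a alg_closure poly) = ?q"
      by (simp add: degree_power_eq)
    have "lead_coeff ([:1, 1:] ^ ?q :: 'a alg_closure poly) = 1"
      by (simp add: lead_coeff_power)
    then show "Polynomial.coeff ([:1, 1:] ^ ?q) ?q = Polynomial.coeff (Polynomial.monom (1 :: 'a alg_closure) ?q + 1) ?q"
      using d q by simp
    show "?q \<le> card (range to_ac :: 'a alg_closure set)"
      by (simp add: card_image inj_to_ac)
    show "Polynomial.degree ([:1, 1:] ^ ?q :: 'a alg_closure poly) \<le> ?q" using d by simp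
    show "Polynomial.degree (Polynomial.monom (1 :: 'a alg_closure) ?q + 1) \<le> ?q"
      by (intro degree_add_le) (simp_all add: degree_monom_le)
    fix z :: "'a alg_closure" assume "z \<in> range to_ac"
    then obtain a where z: "z = to_ac a" by blast
    have "frob (to_ac (1 + a)) = 1 + frob (to_ac a)" by (simp del: to_ac_add) simp
    then show "poly ([:1, 1:] ^ ?q) z = poly (Polynomial.monom 1 ?q + 1) z"
      by (simp add: z frob_def poly_monom add.commute)
  qed
  then have "poly ([:1, 1:] ^ ?q) x = poly (Polynomial.monom 1 ?q + 1) x" by simp
  then show ?thesis by (simp add: frob_def poly_monom add.commute)
qed

text \<open>Frobenius is multiplicative, so dividing by y reduces the claim to
  \<open>frob_add_1\<close>.\<close>

lemma frob_add: "frob (x + y) = frob x + frob y"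
proof (cases "y = 0")
  case False
  then have "frob (x + y) = frob (y * (x / y + 1))" by (simp add: field_simps)
  also have "\<dots> = frob y * frob (x / y) + frob y"
    unfolding frob_mult frob_add_1 by (simp only: distrib_left mult_1_right)
  also have "frob y * frob (x / y) = frob x" using False by (simp flip: frob_mult)
  finally show ?thesis .
qed simp

lemma frob_minus: "frob (- x) = - frob x"
  using frob_add[of x "- x"] by (simp add: eq_neg_iff_add_eq_0 add.commute)

lemma frob_diff: "frob (x - y) = frob x - frob y"
  using frob_add[of x "- y"] by (simp add: frob_minus)

lemma frob_eq_0_iff [simp]: "frob x = 0 \<longleftrightarrow> x = 0"
  by (simp add: frob_def)

lemma inj_frob: "inj frob"
  by (rule injI) (metis frob_diff frob_eq_0_iff right_minus_eq)

lemma frob_prod_mset: "frob (\<Prod>x\<in>#M. f x) = (\<Prod>x\<in>#M. frob (f x))"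
  by (induction M) (simp_all add: frob_mult)

text \<open>X^q - X has at most q roots, and the base field already supplies q of them.\<close>

lemma frob_fixed_iff: "frob x = x \<longleftrightarrow> x \<in> range to_ac"
proof -
  let ?q = "CARD('a)"
  let ?p = "Polynomial.monom (1 :: 'a alg_closure) ?q - [:0, 1:]"
  have q: "?q > 1" by (rule card_base_gt_1)
  have c: "Polynomial.coeff ?p ?q = 1" using q by (simp add: coeff_pCons split: nat.split)
  then have p0: "?p \<noteq> 0" by (metis coeff_0 zero_neq_one)
  have R: "{x. frob x = x} = {x. poly ?p x = 0}" by (auto simp: frob_def poly_monom)
  have "card {x. poly ?p x = 0} \<le> Polynomial.degree ?p" by (rule card_poly_roots_bound[OF p0])
  also have "\<dots> \<le> ?q" using q by (intro degree_diff_le) (simp_all add: degree_monom_le)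
  also have "?q = card (range to_ac :: 'a alg_closure set)"
    by (simp add: card_image inj_to_ac)
  finally have "card {x :: 'a alg_closure. frob x = x} \<le> card (range to_ac :: 'a alg_closure set)"
    unfolding R .
  moreover have "finite {x :: 'a alg_closure. frob x = x}"
    unfolding R by (rule poly_roots_finite[OF p0])
  moreover have "range to_ac \<subseteq> {x :: 'a alg_closure. frob x = x}" by auto
  ultimately have "range to_ac = {x :: 'a alg_closure. frob x = x}" using card_seteq by metis
  then show ?thesis by blast
qed

section \<open>Iterated Frobenius, extension fields and norms\<close>

lemma funpow_frob: "(frob ^^ r) x = (x :: 'a::{field,finite} alg_closure) ^ (CARD('a) ^ r)"
  by (induction r) (simp_all add: frob_def mult.commute flip: power_mult)

lemma funpow_frob_0 [simp]: "(frob ^^ r) 0 = 0" and funpow_frob_1 [simp]: "(frob ^^ r) 1 = 1"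
  and funpow_frob_mult: "(frob ^^ r) (x * y) = (frob ^^ r) x * (frob ^^ r) y"
  and funpow_frob_inverse: "(frob ^^ r) (inverse x) = inverse ((frob ^^ r) x)"
  and funpow_frob_add: "(frob ^^ r) (x + y) = (frob ^^ r) x + (frob ^^ r) y"
  and funpow_frob_minus: "(frob ^^ r) (- x) = - (frob ^^ r) x"
  and funpow_frob_diff: "(frob ^^ r) (x - y) = (frob ^^ r) x - (frob ^^ r) y"
  and funpow_frob_to_ac [simp]: "(frob ^^ r) (to_ac a) = to_ac a"
  by (induction r) (simp_all add: frob_mult frob_inverse frob_add frob_minus frob_diff)

lemma funpow_frob_eq_0_iff [simp]: "(frob ^^ r) x = 0 \<longleftrightarrow> x = 0"
  by (simp add: funpow_frob)

text \<open>The field consists of the roots of X^(q^r) - X, which is separable: its derivative is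
  -1, because q is 0 in the field.\<close>

lemma card_ext_field:
  assumes "r \<ge> 1"
  shows "card (ext_field r :: 'a::{field,finite} alg_closure set) = CARD('a) ^ r"
    and "finite (ext_field r :: 'a alg_closure set)"
proof -
  let ?n = "CARD('a) ^ r"
  let ?p = "Polynomial.monom (1 :: 'a alg_closure) ?n - [:0, 1:]"
  have n: "?n > 1" using card_base_gt_1[where ?'a = 'a] assms one_less_power[of "CARD('a)" r] by simp
  have c: "Polynomial.coeff ?p ?n = 1" using n assms by (simp add: coeff_pCons split: nat.split)
  then have p0: "?p \<noteq> 0" by (metis coeff_0 zero_neq_one)
  have R: "ext_field r = {x. poly ?p x = 0}"
    by (auto simp: ext_field_def funpow_frob poly_monom)
  have "to_ac (of_nat CARD('a) :: 'a) = 0" by (simp only: base.of_nat_card_eq_0 to_ac_0)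
  then have "(of_nat ?n :: 'a alg_closure) = 0"
    using assms by (simp add: power_0_left)
  then have "pderiv ?p = - 1"
    using assms by (simp add: pderiv_diff pderiv_monom pderiv_pCons power_0_left one_pCons)
  then have "card {x. poly ?p x = 0} = Polynomial.degree ?p"
    using p0 by (intro card_roots_separable) auto
  also have "Polynomial.degree ?p = ?n"
    using n c by (intro antisym degree_diff_le le_degree) (simp_all add: degree_monom_le)
  finally show "card (ext_field r :: 'a alg_closure set) = ?n" by (simp add: R)
  show "finite (ext_field r :: 'a alg_closure set)"
    unfolding R by (rule poly_roots_finite[OF p0])
qed

lemma finite_subfield_ext_field:
  "r \<ge> 1 \<Longrightarrow> finite_subfield (ext_field r :: 'a::{field,finite} alg_closure set)"
  by standard
    (simp_all add: card_ext_field(2), simp_all add: ext_field_def funpow_frob_add funpow_frob_mult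
      funpow_frob_minus funpow_frob_inverse)

lemma to_ac_in_ext_field [simp]: "to_ac a \<in> ext_field r"
  by (simp add: ext_field_def)

text \<open>Frobenius permutes the r factors cyclically, so their product lies in the base field.
  This is what makes the value of \<open>of_ac\<close> in \<open>ext_norm\<close>
  meaningful.\<close>

lemma to_ac_ext_norm:
  assumes "x \<in> ext_field r"
  shows "to_ac (ext_norm r x) = (\<Prod>i<r. (frob ^^ i) x)"
proof -
  have "frob (\<Prod>i<r. (frob ^^ i) x) = (\<Prod>i<r. (frob ^^ Suc i) x)"
    by (induction r) (simp_all add: frob_mult)
  also have "\<dots> = (\<Prod>i<r. (frob ^^ i) x)"
  proof (cases r)
    case (Suc n)
    have "(\<Prod>i<Suc n. (frob ^^ Suc i) x) = (\<Prod>i<n. (frob ^^ Suc i) x) * (frob ^^ r) x"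
      by (simp only: prod.lessThan_Suc Suc)
    also have "\<dots> = (frob ^^ 0) x * (\<Prod>i<n. (frob ^^ Suc i) x)"
      using assms by (simp add: ext_field_def)
    also have "\<dots> = (\<Prod>i<Suc n. (frob ^^ i) x)"
      by (simp only: prod.lessThan_Suc_shift)
    finally show ?thesis by (simp only: Suc)
  qed simp
  finally show ?thesis by (simp only: ext_norm_def frob_fixed_iff to_ac_of_ac)
qed

text \<open>For r = 0 the product is empty and the norm is 1, whence the condition on r.\<close>

lemma ext_norm_eq_0_iff: "x \<in> ext_field r \<Longrightarrow> ext_norm r x = 0 \<longleftrightarrow> r \<ge> 1 \<and> x = 0"
proof -
  assume "x \<in> ext_field r"
  have "ext_norm r x = 0 \<longleftrightarrow> to_ac (ext_norm r x) = 0" by simp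
  also have "\<dots> \<longleftrightarrow> r \<ge> 1 \<and> x = 0"
    unfolding to_ac_ext_norm[OF \<open>x \<in> ext_field r\<close>] by (auto simp: Suc_le_eq)
  finally show ?thesis .
qed

lemma ext_norm_mult:
  assumes "r \<ge> 1" "x \<in> ext_field r" "y \<in> ext_field r"
  shows "ext_norm r (x * y) = ext_norm r x * ext_norm r y"
proof -
  interpret finite_subfield "ext_field r :: 'a alg_closure set"
    using assms(1) by (rule finite_subfield_ext_field)
  have "to_ac (ext_norm r (x * y)) = to_ac (ext_norm r x * ext_norm r y)"
    using assms by (simp add: to_ac_ext_norm funpow_frob_mult prod.distrib)
  then show ?thesis by (simp only: to_ac_eq_iff)
qed

lemma ext_norm_to_ac [simp]: "ext_norm r (to_ac a) = a ^ r"
proof -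
  have "to_ac (ext_norm r (to_ac a)) = to_ac (a ^ r)"
    by (subst to_ac_ext_norm) simp_all
  then show ?thesis by (simp only: to_ac_eq_iff)
qed

lemma char_lift_in:
  assumes "r \<ge> 1" "\<eta> \<in> mult_chars UNIV"
  shows "char_lift r \<eta> \<in> mult_chars (ext_field r)"
proof -
  interpret finite_subfield "ext_field r :: 'a alg_closure set"
    using assms(1) by (rule finite_subfield_ext_field)
  show ?thesis
    using assms unfolding mult_chars_def[of "ext_field r"]
    by (auto simp: char_lift_def ext_norm_mult base.char_mult base.char_0_iff ext_norm_eq_0_iff)
qed

lemma char_lift_mult: "char_lift r (\<eta> \<star> \<theta>) = char_lift r \<eta> \<star> char_lift r \<theta>"
  by (simp add: char_lift_def char_mult_def fun_eq_iff)

lemma char_lift_inv: "char_lift r (char_inv \<eta>) = char_inv (char_lift r \<eta>)"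
  by (simp add: char_lift_def char_inv_def fun_eq_iff)

lemma char_lift_to_ac: "\<eta> \<in> mult_chars UNIV \<Longrightarrow> char_lift r \<eta> (to_ac a) = \<eta> a ^ r"
  by (simp add: char_lift_def base.char_power)

text \<open>The theorem takes powers of the lifted character, whereas the point count produces lifts
  of powers.\<close>

lemma char_lift_pow:
  assumes "r \<ge> 1" "\<eta> \<in> mult_chars UNIV"
  shows "char_pow (ext_field r) (char_lift r \<eta>) n = char_lift r (char_pow UNIV \<eta> n)"
proof
  interpret finite_subfield "ext_field r :: 'a alg_closure set"
    using assms(1) by (rule finite_subfield_ext_field)
  fix x
  show "char_pow (ext_field r) (char_lift r \<eta>) n x = char_lift r (char_pow UNIV \<eta> n) x"
    using assms char_lift_in[OF assms]
    by (auto simp: char_pow_apply base.char_pow_apply char_lift_def ext_norm_eq_0_iff)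
qed

section \<open>The Hasse-Davenport relation for Jacobi sums\<close>

text \<open>
  Monic polynomials of degree \<open>n\<close> over the base field are encoded by their multisets of roots:
  the Frobenius-stable multisets of size \<open>n\<close> in the algebraic closure.
\<close>
definition stable_msets :: "nat \<Rightarrow> 'a::{field,finite} alg_closure multiset set" where
  "stable_msets n = {M. size M = n \<and> image_mset frob M = M}"

text \<open>For x in \<open>ext_field r\<close> this is the root multiset of the characteristic
  polynomial of x over the base field; roots are repeated if x generates a smaller field.\<close>

definition conjugates :: "nat \<Rightarrow> 'a::{field,finite} alg_closure \<Rightarrow> 'a alg_closure multiset" where
  "conjugates r x = image_mset (\<lambda>i. (frob ^^ i) x) (mset [0..<r])"

lemma size_conjugates [simp]: "size (conjugates r x) = r"
  by (simp add: conjugates_def)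

lemma conjugates_0 [simp]: "conjugates 0 x = {#}"
  by (simp add: conjugates_def)

lemma conjugates_Suc: "conjugates (Suc r) x = add_mset ((frob ^^ r) x) (conjugates r x)"
  by (simp add: conjugates_def)

lemma conjugates_add: "conjugates (r + s) x = conjugates r x + conjugates s ((frob ^^ r) x)"
proof (induction s)
  case (Suc s)
  have "(frob ^^ (r + s)) x = (frob ^^ s) ((frob ^^ r) x)"
    by (subst add.commute) (simp only: funpow_add comp_apply)
  with Suc show ?case by (simp add: conjugates_Suc)
qed simp

lemma frob_conjugates:
  assumes "x \<in> ext_field r"
  shows "image_mset frob (conjugates r x) = conjugates r x"
proof -
  have "image_mset frob (conjugates r x) = conjugates r (frob x)"
    by (simp add: conjugates_def multiset.map_comp o_def funpow_swap1)
  \<comment> \<open>The list x, F x, ..., F^r x is split once at its first entry and once at its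
    last, which is x again.\<close>
  moreover have "add_mset x (conjugates r (frob x)) = conjugates (1 + r) x"
    unfolding conjugates_add by (simp add: conjugates_Suc)
  moreover have "conjugates (1 + r) x = add_mset x (conjugates r x)"
    using assms by (simp add: conjugates_Suc ext_field_def)
  ultimately show ?thesis by simp
qed

lemma prod_conjugates: "(\<Prod>y\<in>#conjugates r x. f y) = (\<Prod>i<r. f ((frob ^^ i) x))"
  by (induction r) (simp_all add: conjugates_Suc mult.commute)

lemma count_stable:
  assumes "image_mset frob M = M"
  shows "count M ((frob ^^ i) x) = count M x"
proof (induction i)
  case (Suc i)
  have "count (image_mset frob M) (frob y) = count M y" for y
  proof -
    have "frob -` {frob y} \<inter> set_mset M = (if y \<in># M then {y} else {})"
      using inj_frob by (auto simp: inj_def)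
    then show ?thesis by (simp add: count_image_mset not_in_iff)
  qed
  with assms Suc show ?case by simp
qed simp

text \<open>
  The orbit of \<open>x\<close> has some length \<open>e\<close>; the admissible \<open>r\<close> are the \<open>k e\<close> with
  \<open>1 \<le> k \<le> count M x\<close>, because the conjugates are then \<open>k\<close> copies of the orbit.
\<close>
lemma card_conjugates_subseteq:
  assumes M: "image_mset frob M = M" and x: "x \<in># M"
  shows "card {r \<in> {1..size M}. x \<in> ext_field r \<and> conjugates r x \<subseteq># M} = count M x"
proof -
  have inM: "(frob ^^ i) x \<in># M" for i
    using count_stable[OF M, of i x] x by (metis count_greater_zero_iff)
  \<comment> \<open>All conjugates of x lie in the finite support of M, so two of them
    coincide.\<close>
  have "\<exists>i j. i < j \<and> (frob ^^ i) x = (frob ^^ j) x"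
  proof -
    have "\<not> inj (\<lambda>i. (frob ^^ i) x)"
    proof
      assume "inj (\<lambda>i. (frob ^^ i) x)"
      then have "infinite (range (\<lambda>i. (frob ^^ i) x))" using finite_imageD by blast
      moreover have "range (\<lambda>i. (frob ^^ i) x) \<subseteq> set_mset M" using inM by auto
      ultimately show False using finite_subset finite_set_mset by blast
    qed
    then show ?thesis unfolding inj_def by (metis linorder_neqE_nat)
  qed
  then obtain i j where ij: "i < j" "(frob ^^ i) x = (frob ^^ j) x" by blast
  \<comment> \<open>Injectivity of Frobenius makes the sequence of conjugates purely
    periodic.\<close>
  have sub: "(frob ^^ (l - k)) x = x" if "k \<le> l" "(frob ^^ k) x = (frob ^^ l) x" for k l
  proof -
    have "(frob ^^ (k + (l - k))) x = (frob ^^ k) ((frob ^^ (l - k)) x)"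
      by (simp only: funpow_add comp_apply)
    then have "(frob ^^ k) x = (frob ^^ k) ((frob ^^ (l - k)) x)"
      using that by simp
    then show ?thesis using inj_frob inj_fn by (metis injD)
  qed
  define e where "e = (LEAST e. e > 0 \<and> (frob ^^ e) x = x)"
  have "j - i > 0 \<and> (frob ^^ (j - i)) x = x" using sub[of i j] ij by simp
  then have e: "e > 0" "(frob ^^ e) x = x"
    unfolding e_def by (metis (mono_tags, lifting) LeastI)+
  have least: "\<not> (l > 0 \<and> (frob ^^ l) x = x)" if "l < e" for l
    using that not_less_Least unfolding e_def by blast
  have e_mult: "(frob ^^ (k * e)) x = x" for k
    by (induction k) (simp_all add: funpow_add e)
  have ext_iff: "x \<in> ext_field r \<longleftrightarrow> e dvd r" for r
  proof
    assume "x \<in> ext_field r"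
    then have "(frob ^^ (r mod e + r div e * e)) x = x"
      by (simp add: ext_field_def)
    then have "(frob ^^ (r mod e)) x = x" by (simp only: funpow_add comp_apply e_mult)
    then show "e dvd r" using least[of "r mod e"] e(1) by (auto simp: dvd_eq_mod_eq_0)
  next
    assume "e dvd r"
    then show "x \<in> ext_field r" using e_mult by (auto simp: ext_field_def mult.commute elim!: dvdE)
  qed
  have conj: "conjugates (k * e) x = repeat_mset k (conjugates e x)" for k
    by (induction k) (simp_all add: conjugates_add e)
  have inj: "inj_on (\<lambda>i. (frob ^^ i) x) {..<e}"
  proof (rule linorder_inj_onI')
    fix k l assume "k \<in> {..<e}" "l \<in> {..<e}" "k < l"
    then show "(frob ^^ k) x \<noteq> (frob ^^ l) x" using sub[of k l] least[of "l - k"] by auto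
  qed
  have count_orbit: "count (conjugates e x) y \<le> 1" for y
  proof -
    have "distinct (map (\<lambda>i. (frob ^^ i) x) [0..<e])"
      using inj by (simp add: distinct_map lessThan_atLeast0)
    then have "count (mset (map (\<lambda>i. (frob ^^ i) x) [0..<e])) y \<le> 1"
      by (metis distinct_count_atmost_1 le_refl zero_le_one)
    then show ?thesis by (simp add: conjugates_def)
  qed
  have sub_iff: "conjugates (k * e) x \<subseteq># M \<longleftrightarrow> k \<le> count M x" for k
  proof
    assume "conjugates (k * e) x \<subseteq># M"
    then have "k * count (conjugates e x) x \<le> count M x"
      unfolding conj by (metis count_repeat_mset mset_subset_eq_count)
    moreover have "count (conjugates e x) x > 0"
      using e(1) by (auto simp: conjugates_def intro!: image_eqI[of _ _ 0])
    ultimately show "k \<le> count M x" by (metis One_nat_def Suc_leI dual_order.trans mult_le_mono2 mult_1_right)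
  next
    assume k: "k \<le> count M x"
    show "conjugates (k * e) x \<subseteq># M"
      unfolding conj
    proof (rule mset_subset_eqI)
      fix y
      show "count (repeat_mset k (conjugates e x)) y \<le> count M y"
      proof (cases "y \<in># conjugates e x")
        case True
        then obtain i where "y = (frob ^^ i) x" by (auto simp: conjugates_def)
        then have "k \<le> count M y" using k count_stable[OF M] by simp
        moreover have "k * count (conjugates e x) y \<le> k * 1" by (rule mult_le_mono2[OF count_orbit])
        ultimately show ?thesis unfolding count_repeat_mset by linarith
      qed (simp add: not_in_iff)
    qed
  qed
  have "bij_betw (\<lambda>k. k * e) {1..count M x} {r \<in> {1..size M}. x \<in> ext_field r \<and> conjugates r x \<subseteq># M}"
  proof (rule bij_betw_imageI)
    show "inj_on (\<lambda>k. k * e) {1..count M x}" using e(1) by (auto intro: inj_onI)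
    show "(\<lambda>k. k * e) ` {1..count M x} = {r \<in> {1..size M}. x \<in> ext_field r \<and> conjugates r x \<subseteq># M}"
      (is "?L = ?R")
    proof (intro equalityI subsetI)
      fix r assume "r \<in> ?L"
      then obtain k where k: "k \<in> {1..count M x}" "r = k * e" by blast
      then have s: "conjugates r x \<subseteq># M" using sub_iff by simp
      from size_mset_mono[OF this] have "r \<le> size M" by simp
      with k s e(1) show "r \<in> ?R" by (simp add: ext_iff)
    next
      fix r assume r: "r \<in> ?R"
      then obtain k where k: "r = k * e" by (auto simp: ext_iff mult.commute elim!: dvdE)
      then have "k \<in> {1..count M x}" using r sub_iff[of k] by (cases k) auto
      then show "r \<in> ?L" using k by blast
    qed
  qed
  from bij_betw_same_card[OF this] show ?thesis by simp
qed

text \<open>Sum \<open>card_conjugates_subseteq\<close> over the support of M. For the polynomial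
  with roots M this says that its degree is the sum of multiplicity times degree over its prime
  factors, in the form that the logarithmic derivative of an Euler product takes.\<close>

lemma size_eq_sum_conjugates:
  assumes M: "image_mset frob M = M"
  shows "size M = (\<Sum>r = 1..size M. card {x \<in> ext_field r. conjugates r x \<subseteq># M})"
proof -
  have "size M = (\<Sum>x\<in>set_mset M. \<Sum>r = 1..size M. if x \<in> ext_field r \<and> conjugates r x \<subseteq># M then 1 else 0)"
    unfolding size_multiset_overloaded_eq
  proof (rule sum.cong[OF refl])
    fix x assume "x \<in> set_mset M"
    from card_conjugates_subseteq[OF M this]
    show "count M x = (\<Sum>r = 1..(\<Sum>x\<in>set_mset M. count M x).
        if x \<in> ext_field r \<and> conjugates r x \<subseteq># M then 1 else 0)"
      by (simp add: size_multiset_overloaded_eq flip: sum.inter_filter)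
  qed
  also have "\<dots> = (\<Sum>r = 1..size M. card {x \<in> set_mset M. x \<in> ext_field r \<and> conjugates r x \<subseteq># M})"
    by (subst sum.swap) (simp flip: sum.inter_filter)
  also have "\<dots> = (\<Sum>r = 1..size M. card {x \<in> ext_field r. conjugates r x \<subseteq># M})"
  proof (rule sum.cong[OF refl])
    fix r assume "r \<in> {1..size M}"
    \<comment> \<open>As r \<ge> 1, x is among its own conjugates, so restricting x to the support
      of M loses nothing.\<close>
    then have "x \<in># conjugates r x" for x :: "'a alg_closure"
      by (auto simp: conjugates_def intro!: image_eqI[of _ _ 0])
    then have "x \<in># M" if "conjugates r x \<subseteq># M" for x using mset_subset_eqD[OF that] by blast
    then have "{x \<in> set_mset M. x \<in> ext_field r \<and> conjugates r x \<subseteq># M} =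
        {x \<in> ext_field r. conjugates r x \<subseteq># M}" by blast
    then show "card {x \<in> set_mset M. x \<in> ext_field r \<and> conjugates r x \<subseteq># M} =
        card {x \<in> ext_field r. conjugates r x \<subseteq># M}" by simp
  qed
  finally show ?thesis .
qed

section \<open>Monic polynomials and their root multisets\<close>

definition monics :: "nat \<Rightarrow> 'a::field poly set" where
  "monics n = {f. Polynomial.degree f = n \<and> lead_coeff f = 1}"

abbreviation root_poly :: "'b::field multiset \<Rightarrow> 'b poly" where
  "root_poly M \<equiv> \<Prod>x\<in>#M. [:-x, 1:]"

lemma degree_root_poly [simp]: "Polynomial.degree (root_poly M) = size M"
  and lead_coeff_root_poly: "Polynomial.coeff (root_poly M) (size M) = 1"
proof -
  have *: "Polynomial.degree (root_poly M) = size M \<and> lead_coeff (root_poly M) = 1"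
  proof (induction M)
    case (add x M)
    then have "root_poly M \<noteq> 0" by auto
    then have "Polynomial.degree ([:-x, 1:] * root_poly M) = Suc (size M)"
      using add by (subst degree_mult_eq) auto
    moreover have "lead_coeff ([:-x, 1:] * root_poly M) = 1"
      unfolding lead_coeff_mult using conjunct2[OF add] by simp
    ultimately show ?case by (simp del: mult_pCons_left)
  qed simp
  then show "Polynomial.degree (root_poly M) = size M" ..
  show "Polynomial.coeff (root_poly M) (size M) = 1"
    using conjunct2[OF *] unfolding conjunct1[OF *] .
qed

lemma root_poly_proots:
  fixes p :: "'b::alg_closed_field poly"
  assumes "lead_coeff p = 1"
  shows "root_poly (proots p) = p"
proof -
  have "p \<noteq> 0" using assms by auto
  then obtain A where "p = Polynomial.smult (lead_coeff p) (root_poly A)"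
    using alg_closed_imp_factorization by blast
  then have "p = root_poly A" using assms by simp
  then show ?thesis by (simp add: proots_prod_linear)
qed

lemma map_poly_frob_root_poly: "map_poly frob (root_poly M) = root_poly (image_mset frob M)"
proof (induction M)
  case (add x M)
  have "map_poly frob ([:-x, 1:] * p) = [:- frob x, 1:] * map_poly frob p" for p
    by (rule poly_eqI)
      (auto simp: coeff_map_poly frob_diff frob_mult frob_minus coeff_pCons split: nat.split)
  then show ?case using add by (simp del: mult_pCons_left)
qed simp

lemma poly_map_poly_to_ac: "poly (map_poly to_ac f) (to_ac a) = to_ac (poly f a)"
  by (induction f) (simp_all add: map_poly_pCons)

text \<open>By unique factorization, Frobenius fixes the coefficients of a monic polynomial exactly
  if it preserves the root multiset, and fixed coefficients lie in the base field.\<close>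

lemma bij_monics_stable_msets:
  "bij_betw (\<lambda>f. proots (map_poly to_ac f)) (monics n :: 'a::{field,finite} poly set) (stable_msets n)"
proof (rule bij_betw_byWitness[where f' = "\<lambda>M. map_poly of_ac (root_poly M)"])
  have emb: "Polynomial.degree (map_poly to_ac f) = n" "lead_coeff (map_poly to_ac f) = 1"
    if "f \<in> monics n" for f
    using that by (auto simp: monics_def degree_map_poly coeff_map_poly)
  have of_ac_to: "map_poly of_ac (map_poly to_ac f) = f" for f
    by (rule poly_eqI) (simp add: coeff_map_poly)
  have to_of: "map_poly to_ac (map_poly of_ac (root_poly M)) = root_poly M"
    if "image_mset frob M = M" for M
  proof (rule poly_eqI)
    fix i
    have "frob (Polynomial.coeff (root_poly M) i) = Polynomial.coeff (map_poly frob (root_poly M)) i"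
      by (simp add: coeff_map_poly)
    also have "\<dots> = Polynomial.coeff (root_poly M) i"
      by (simp only: map_poly_frob_root_poly that)
    finally show "Polynomial.coeff (map_poly to_ac (map_poly of_ac (root_poly M))) i =
        Polynomial.coeff (root_poly M) i"
      by (simp add: coeff_map_poly frob_fixed_iff to_ac_of_ac)
  qed
  show "\<forall>f\<in>(monics n :: 'a poly set). map_poly of_ac (root_poly (proots (map_poly to_ac f))) = f"
    by (simp add: root_poly_proots[OF emb(2)] of_ac_to)
  show "\<forall>M\<in>(stable_msets n :: 'a alg_closure multiset set). proots (map_poly to_ac (map_poly of_ac (root_poly M))) = M"
    by (simp add: stable_msets_def to_of proots_prod_linear)
  show "(\<lambda>f. proots (map_poly to_ac f)) ` (monics n :: 'a poly set) \<subseteq> stable_msets n"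
  proof (rule image_subsetI)
    fix f :: "'a poly" assume f: "f \<in> monics n"
    let ?F = "map_poly to_ac f"
    have F: "root_poly (proots ?F) = ?F" using emb[OF f] by (intro root_poly_proots)
    have "map_poly frob ?F = ?F"
      by (rule poly_eqI) (simp add: coeff_map_poly)
    then have "root_poly (image_mset frob (proots ?F)) = root_poly (proots ?F)"
      by (simp only: F flip: map_poly_frob_root_poly)
    then have "image_mset frob (proots ?F) = proots ?F"
      by (metis proots_prod_linear)
    moreover have "size (proots ?F) = n"
      using emb[OF f] by (subst size_proots_alg_closed) auto
    ultimately show "proots ?F \<in> stable_msets n" by (simp add: stable_msets_def)
  qed
  show "(\<lambda>M. map_poly of_ac (root_poly M)) ` (stable_msets n :: 'a alg_closure multiset set) \<subseteq> monics n"
  proof (rule image_subsetI)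
    fix M :: "'a alg_closure multiset" assume "M \<in> stable_msets n"
    then have M: "size M = n" "image_mset frob M = M" by (auto simp: stable_msets_def)
    let ?f = "map_poly of_ac (root_poly M)"
    have c: "Polynomial.coeff ?f n = 1"
      using lead_coeff_root_poly[of M] M by (simp add: coeff_map_poly)
    moreover have "Polynomial.degree ?f \<le> n"
      using map_poly_degree_leq[of of_ac "root_poly M"] M by simp
    moreover have "n \<le> Polynomial.degree ?f" using c by (intro le_degree) simp
    ultimately show "?f \<in> monics n" by (simp add: monics_def)
  qed
qed

lemma finite_monics: "finite (monics n :: 'a::{field,finite} poly set)"
proof (rule finite_subset)
  show "monics n \<subseteq> Poly ` {xs :: 'a list. set xs \<subseteq> UNIV \<and> length xs \<le> Suc n}"
  proof
    fix f :: "'a poly" assume "f \<in> monics n"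
    then have "length (coeffs f) \<le> Suc n"
      by (cases "f = 0") (auto simp: monics_def length_coeffs_degree)
    then show "f \<in> Poly ` {xs. set xs \<subseteq> UNIV \<and> length xs \<le> Suc n}"
      by (intro image_eqI[of _ _ "coeffs f"]) simp_all
  qed
  show "finite (Poly ` {xs :: 'a list. set xs \<subseteq> UNIV \<and> length xs \<le> Suc n})"
    by (intro finite_imageI finite_lists_length_le) simp
qed

lemma finite_stable_msets: "finite (stable_msets n)"
  using bij_betw_finite[OF bij_monics_stable_msets] finite_monics by blast

text \<open>For the polynomial f of degree n with root multiset M the two products are (-1)^n f(0)
  and f(1). By \<open>stable_prod_in\<close> they lie in the base field if M is stable, so
  \<open>of_ac\<close> does no harm.\<close>

definition mset_char ::
  "('a::{field,finite} \<Rightarrow> Qbar) \<Rightarrow> ('a \<Rightarrow> Qbar) \<Rightarrow> 'a alg_closure multiset \<Rightarrow> Qbar" where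
  "mset_char \<eta> \<theta> M = \<eta> (of_ac (\<Prod>x\<in>#M. x)) * \<theta> (of_ac (\<Prod>x\<in>#M. 1 - x))"

lemma of_ac_mult: "x \<in> range to_ac \<Longrightarrow> y \<in> range to_ac \<Longrightarrow> of_ac (x * y) = of_ac x * of_ac y"
  by (intro of_ac_eqI) (simp add: to_ac_of_ac)

lemma stable_prod_in:
  assumes "image_mset frob M = M"
  shows "(\<Prod>x\<in>#M. x) \<in> range to_ac" "(\<Prod>x\<in>#M. 1 - x) \<in> range to_ac"
proof -
  have "frob (\<Prod>x\<in>#M. f x) = (\<Prod>x\<in>#M. f x)" if "\<And>x. frob (f x) = f (frob x)" for f
  proof -
    have "frob (\<Prod>x\<in>#M. f x) = (\<Prod>x\<in>#image_mset frob M. f x)"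
      by (simp add: frob_prod_mset that multiset.map_comp o_def)
    then show ?thesis by (simp only: assms)
  qed
  from this[of "\<lambda>x. x"] this[of "\<lambda>x. 1 - x"]
  show "(\<Prod>x\<in>#M. x) \<in> range to_ac" "(\<Prod>x\<in>#M. 1 - x) \<in> range to_ac"
    by (simp_all add: frob_diff flip: frob_fixed_iff)
qed

section \<open>Character sums over stable multisets\<close>

context
  fixes \<eta> \<theta> :: "'a::{field,finite} \<Rightarrow> Qbar"
  assumes chars: "\<eta> \<in> mult_chars UNIV" "\<theta> \<in> mult_chars UNIV"
begin

lemma mset_char_add:
  assumes "image_mset frob M = M" "image_mset frob N = N"
  shows "mset_char \<eta> \<theta> (M + N) = mset_char \<eta> \<theta> M * mset_char \<eta> \<theta> N"
  using stable_prod_in[OF assms(1)] stable_prod_in[OF assms(2)] chars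
  by (simp add: mset_char_def of_ac_mult base.char_mult)

text \<open>The two products over the conjugates are the norms of x and of 1 - x.\<close>

lemma mset_char_conjugates:
  assumes "x \<in> ext_field r"
  shows "mset_char \<eta> \<theta> (conjugates r x) = char_lift r \<eta> x * char_lift r \<theta> (1 - x)"
proof -
  have "1 - x \<in> ext_field r" using assms by (simp add: ext_field_def funpow_frob_diff)
  then show ?thesis
    using assms
    by (simp add: mset_char_def prod_conjugates prod_conjugates[where f = "\<lambda>y. y", simplified] char_lift_def ext_norm_def funpow_frob_diff)
qed

lemma sum_mset_char_monics:
  "(\<Sum>M\<in>stable_msets n. mset_char \<eta> \<theta> M) = (\<Sum>f\<in>monics n. \<eta> ((-1) ^ n * poly f 0) * \<theta> (poly f 1))"
proof -
  have "(\<Sum>M\<in>stable_msets n. mset_char \<eta> \<theta> M) =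
      (\<Sum>f\<in>monics n. mset_char \<eta> \<theta> (proots (map_poly to_ac f)))"
    by (rule sum.reindex_bij_betw[OF bij_monics_stable_msets, symmetric])
  also have "\<dots> = (\<Sum>f\<in>monics n. \<eta> ((-1) ^ n * poly f 0) * \<theta> (poly f 1))"
  proof (rule sum.cong[OF refl])
    fix f :: "'a poly" assume f: "f \<in> monics n"
    let ?F = "map_poly to_ac f"
    have lc: "Polynomial.degree ?F = n" "lead_coeff ?F = 1"
      using f by (auto simp: monics_def degree_map_poly coeff_map_poly)
    then have sz: "size (proots ?F) = n" by (subst size_proots_alg_closed) auto
    have ev: "poly ?F a = (\<Prod>x\<in>#proots ?F. a - x)" for a
      using root_poly_proots[OF lc(2)] by (metis (no_types, lifting) image_mset_cong mult_1_right
          poly_pCons poly_prod_mset poly_0 add.commute mult_zero_right add_0_right uminus_add_conv_diff)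
    have "(\<Prod>x\<in>#N. 0 - x) = (-1) ^ size N * (\<Prod>x\<in>#N. x)" for N :: "'a alg_closure multiset"
      by (induction N) auto
    with ev[of 0] sz have "(\<Prod>x\<in>#proots ?F. x) = (-1) ^ n * poly ?F 0"
      by (simp flip: power_mult_distrib mult.assoc)
    then have 1: "(\<Prod>x\<in>#proots ?F. x) = to_ac ((-1) ^ n * poly f 0)"
      using poly_map_poly_to_ac[of f 0] by simp
    have 2: "(\<Prod>x\<in>#proots ?F. 1 - x) = to_ac (poly f 1)"
      using ev[of 1] poly_map_poly_to_ac[of f 1] by simp
    show "mset_char \<eta> \<theta> (proots ?F) = \<eta> ((-1) ^ n * poly f 0) * \<theta> (poly f 1)"
      unfolding mset_char_def 1 2 of_ac_to_ac ..
  qed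
  finally show ?thesis .
qed

lemma sum_mset_char_1: "(\<Sum>M\<in>stable_msets 1. mset_char \<eta> \<theta> M) = - jacobi UNIV \<eta> \<theta>"
proof -
  have "(\<Sum>M\<in>stable_msets 1. mset_char \<eta> \<theta> M) = (\<Sum>a\<in>UNIV. \<eta> a * \<theta> (1 - a))"
  proof (rule sum.reindex_bij_witness[where i = "\<lambda>a. {#to_ac a#}" and j = "\<lambda>M. of_ac (\<Prod>x\<in>#M. x)"])
    fix M :: "'a alg_closure multiset" assume "M \<in> stable_msets 1"
    then have "size M = 1" "image_mset frob M = M" by (auto simp: stable_msets_def)
    moreover from this obtain x where "M = {#x#}" using size_1_singleton_mset by blast
    ultimately have x: "M = {#x#}" "frob x = x" by simp_all
    then obtain a where a: "x = to_ac a" by (auto simp: frob_fixed_iff)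
    show "{#to_ac (of_ac (\<Prod>x\<in>#M. x))#} = M" by (simp add: x a)
    have "1 - to_ac a = to_ac (1 - a)" by simp
    then show "\<eta> (of_ac (\<Prod>x\<in>#M. x)) * \<theta> (1 - of_ac (\<Prod>x\<in>#M. x)) = mset_char \<eta> \<theta> M"
      by (simp add: mset_char_def x a del: to_ac_diff)
  qed (auto simp: stable_msets_def)
  then show ?thesis using base.jacobi_conv'[OF chars] by simp
qed

text \<open>Adding multiples of \<open>X\<close> changes the value at \<open>1\<close> but not at \<open>0\<close>.\<close>
lemma sum_mset_char_ge_2:
  assumes "\<theta> \<noteq> triv_char UNIV" "n \<ge> 2"
  shows "(\<Sum>M\<in>stable_msets n. mset_char \<eta> \<theta> M) = 0"
proof -
  let ?h = "\<lambda>f. \<eta> ((-1) ^ n * poly f 0) * \<theta> (poly f 1)"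
  let ?S = "\<Sum>f\<in>monics n. ?h f"
  have "?S = (\<Sum>f\<in>monics n. ?h (f + [:0, t:]))" for t
  proof (rule sum.reindex_bij_witness[where j = "\<lambda>f. f - [:0, t:]" and i = "\<lambda>f. f + [:0, t:]"])
    \<comment> \<open>This is where n \<ge> 2 enters: adding a multiple of X leaves f monic of
      degree n.\<close>
    have d: "Polynomial.degree [:0, s:] < n" for s :: 'a using assms(2) by simp
    have m: "f + [:0, s:] \<in> monics n" if "f \<in> monics n" for f :: "'a poly" and s
      using that d[of s] by (auto simp: monics_def degree_add_eq_left coeff_eq_0)
    fix f :: "'a poly" assume f: "f \<in> monics n"
    show "f + [:0, t:] \<in> monics n" using m f .
    have "f - [:0, t:] = f + [:0, - t:]" by (rule poly_eqI) (simp add: coeff_pCons split: nat.split)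
    then show "f - [:0, t:] \<in> monics n" using m[OF f] by metis
  qed auto
  \<comment> \<open>Averaging over t makes f(1) + t run through the whole field while f(0) stays
    fixed.\<close>
  then have "of_nat CARD('a) * ?S = (\<Sum>t\<in>(UNIV :: 'a set). \<Sum>f\<in>monics n. ?h (f + [:0, t:]))"
    by simp
  also have "\<dots> = (\<Sum>f\<in>monics n. \<eta> ((-1) ^ n * poly f 0) * (\<Sum>t\<in>UNIV. \<theta> (poly f 1 + t)))"
    by (subst sum.swap) (simp add: sum_distrib_left)
  also have "\<dots> = 0"
  proof (rule sum.neutral, rule ballI)
    fix f :: "'a poly"
    have "(\<Sum>t\<in>UNIV. \<theta> (poly f 1 + t)) = (\<Sum>t\<in>UNIV. \<theta> t)"
      by (rule sum.reindex_bij_witness[where j = "\<lambda>t. poly f 1 + t" and i = "\<lambda>t. t - poly f 1"]) auto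
    also have "\<dots> = 0"
      using base.sum_char[OF chars(2)] assms(1) base.sum_K[of \<theta>] chars by simp
    finally show "\<eta> ((-1) ^ n * poly f 0) * (\<Sum>t\<in>UNIV. \<theta> (poly f 1 + t)) = 0" by simp
  qed
  finally show ?thesis by (simp add: sum_mset_char_monics)
qed

text \<open>Newton's identities for A_n, the sum over multisets of size n, and B_r, the sum over the
  field of degree r. By \<open>size_eq_sum_conjugates\<close> the factor n counts the pairs (r, x)
  with \<open>conjugates r x \<subseteq># M\<close>; removing these conjugates leaves an arbitrary
  stable multiset of size n - r.\<close>

lemma sum_mset_char_recurrence:
  "of_nat n * (\<Sum>M\<in>stable_msets n. mset_char \<eta> \<theta> M) =
    (\<Sum>r = 1..n. (\<Sum>x\<in>ext_field r. char_lift r \<eta> x * char_lift r \<theta> (1 - x)) *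
      (\<Sum>M\<in>stable_msets (n - r). mset_char \<eta> \<theta> M))"
proof -
  let ?c = "mset_char \<eta> \<theta>"
  have "of_nat n * (\<Sum>M\<in>stable_msets n. ?c M) =
      (\<Sum>M\<in>stable_msets n. \<Sum>r = 1..n. \<Sum>x\<in>ext_field r. if conjugates r x \<subseteq># M then ?c M else 0)"
    unfolding sum_distrib_left
  proof (rule sum.cong[OF refl])
    fix M :: "'a alg_closure multiset" assume "M \<in> stable_msets n"
    then have M: "size M = n" "image_mset frob M = M" by (auto simp: stable_msets_def)
    have "of_nat n * ?c M = of_nat (\<Sum>r = 1..n. card {x \<in> ext_field r. conjugates r x \<subseteq># M}) * ?c M"
      using size_eq_sum_conjugates[OF M(2)] M(1) by simp
    also have "\<dots> = (\<Sum>r = 1..n. \<Sum>x | x \<in> ext_field r \<and> conjugates r x \<subseteq># M. ?c M)"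
      by (simp add: sum_distrib_right)
    also have "\<dots> = (\<Sum>r = 1..n. \<Sum>x\<in>ext_field r. if conjugates r x \<subseteq># M then ?c M else 0)"
      by (intro sum.cong refl sum.inter_filter) (simp add: card_ext_field(2))
    finally show "of_nat n * ?c M = \<dots>" .
  qed
  also have "\<dots> = (\<Sum>r = 1..n. \<Sum>M\<in>stable_msets n. \<Sum>x\<in>ext_field r. if conjugates r x \<subseteq># M then ?c M else 0)"
    by (rule sum.swap)
  also have "\<dots> = (\<Sum>r = 1..n. \<Sum>x\<in>ext_field r. \<Sum>M\<in>stable_msets n. if conjugates r x \<subseteq># M then ?c M else 0)"
    by (rule sum.cong[OF refl], rule sum.swap)
  also have "\<dots> = (\<Sum>r = 1..n. \<Sum>x\<in>ext_field r. ?c (conjugates r x) * (\<Sum>M\<in>stable_msets (n - r). ?c M))"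
  proof (rule sum.cong[OF refl], rule sum.cong[OF refl])
    fix r and x :: "'a alg_closure" assume r: "r \<in> {1..n}" and x: "x \<in> ext_field r"
    let ?C = "conjugates r x"
    note C = frob_conjugates[OF x]
    have "(\<Sum>M\<in>stable_msets n. if ?C \<subseteq># M then ?c M else 0) = (\<Sum>M | M \<in> stable_msets n \<and> ?C \<subseteq># M. ?c M)"
      by (rule sum.inter_filter[symmetric]) (rule finite_stable_msets)
    also have "\<dots> = (\<Sum>N\<in>stable_msets (n - r). ?c ?C * ?c N)"
    proof (rule sum.reindex_bij_witness[where j = "\<lambda>M. M - ?C" and i = "\<lambda>N. ?C + N"])
      fix M :: "'a alg_closure multiset" assume "M \<in> {M \<in> stable_msets n. ?C \<subseteq># M}"
      then have M: "size M = n" "image_mset frob M = M" "?C \<subseteq># M" by (auto simp: stable_msets_def)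
      show eq: "?C + (M - ?C) = M" using M(3) by simp
      have "image_mset frob (M - ?C) = M - ?C"
        using M C by (simp add: image_mset_Diff)
      then show "M - ?C \<in> stable_msets (n - r)"
        using M by (simp add: stable_msets_def size_Diff_submset)
      then show "?c ?C * ?c (M - ?C) = ?c M"
        using mset_char_add[OF C, of "M - ?C"] eq by (simp add: stable_msets_def)
    next
      fix N :: "'a alg_closure multiset" assume "N \<in> stable_msets (n - r)"
      then show "?C + N \<in> {M \<in> stable_msets n. ?C \<subseteq># M}"
        using r C by (auto simp: stable_msets_def)
    qed simp
    finally show "(\<Sum>M\<in>stable_msets n. if ?C \<subseteq># M then ?c M else 0) =
        ?c ?C * (\<Sum>M\<in>stable_msets (n - r). ?c M)"
      by (simp add: sum_distrib_left)
  qed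
  also have "\<dots> = (\<Sum>r = 1..n. (\<Sum>x\<in>ext_field r. char_lift r \<eta> x * char_lift r \<theta> (1 - x)) *
      (\<Sum>M\<in>stable_msets (n - r). ?c M))"
    by (simp add: mset_char_conjugates sum_distrib_right)
  finally show ?thesis .
qed

text \<open>The generating series of the A_n is the polynomial 1 - j t, because A_0 = 1, A_1 = -j
  and A_n = 0 for n \<ge> 2. Its logarithmic derivative gives B_r = -j^r; the induction reads this
  off from the recurrence.\<close>

theorem jacobi_char_lift:
  assumes "\<theta> \<noteq> triv_char UNIV" "r \<ge> 1"
  shows "jacobi (ext_field r) (char_lift r \<eta>) (char_lift r \<theta>) = jacobi UNIV \<eta> \<theta> ^ r"
proof -
  let ?A = "\<lambda>n. \<Sum>M\<in>stable_msets n. mset_char \<eta> \<theta> M"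
  let ?B = "\<lambda>r. \<Sum>x\<in>ext_field r. char_lift r \<eta> x * char_lift r \<theta> (1 - x)"
  let ?j = "jacobi UNIV \<eta> \<theta>"
  have "stable_msets 0 = {{#} :: 'a alg_closure multiset}" by (auto simp: stable_msets_def)
  then have A0: "?A 0 = 1" using chars by (simp add: mset_char_def)
  have "?B r = - (?j ^ r)"
    using assms(2)
  proof (induction r rule: nat_induct_at_least)
    case base
    then show ?case
      using sum_mset_char_recurrence[of 1] A0 by (simp add: sum_mset_char_1[simplified])
  next
    case (Suc n)
    have "0 = (\<Sum>r = 1..Suc n. ?B r * ?A (Suc n - r))"
      using sum_mset_char_recurrence[of "Suc n"] sum_mset_char_ge_2[OF assms(1), of "Suc n"] Suc(1)
      by simp
    \<comment> \<open>Only A_0 and A_1 can be nonzero, so only r = n and r = n + 1 survive.\<close>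
    also have "\<dots> = (\<Sum>r\<in>{n, Suc n}. ?B r * ?A (Suc n - r))"
      using Suc(1) by (intro sum.mono_neutral_right ballI)
        (auto simp: sum_mset_char_ge_2[OF assms(1)])
    also have "\<dots> = ?B n * ?A 1 + ?B (Suc n) * ?A 0" by simp
    finally show ?case
      using Suc.IH by (simp only: A0 sum_mset_char_1) (simp add: eq_neg_iff_add_eq_0 algebra_simps)
  qed
  moreover have "?B r = - jacobi (ext_field r) (char_lift r \<eta>) (char_lift r \<theta>)"
    using assms(2) chars
    by (intro finite_subfield.jacobi_conv' finite_subfield_ext_field char_lift_in)
  ultimately show ?thesis by simp
qed

end

section \<open>Exponential generating series\<close>

text \<open>F / G has derivative 0 and constant term 1. An exponential series is thus determined by
  its logarithmic derivative, which reduces identities between such series to identities between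
  coefficients.\<close>

lemma fps_linear_ode_unique:
  fixes F G c :: "'b::field_char_0 fps"
  assumes "fps_deriv F = F * c" "fps_deriv G = G * c" "fps_nth F 0 = 1" "fps_nth G 0 = 1"
  shows "F = G"
proof -
  have G: "G * inverse G = 1" using assms(4) by (simp add: inverse_mult_eq_1')
  have "fps_deriv (inverse G) = - fps_deriv G * (inverse G * inverse G)"
    using assms(4) by (simp add: fps_inverse_deriv power2_eq_square)
  then have "fps_deriv (F * inverse G) = F * c * inverse G - F * (G * inverse G) * c * inverse G"
    using assms(1,2) by (simp add: algebra_simps)
  also have "\<dots> = 0" unfolding G by simp
  finally have "F * inverse G = fps_const (fps_nth (F * inverse G) 0)"
    by (simp only: fps_deriv_eq_0_iff)
  also have "\<dots> = 1" using assms(3,4) by simp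
  finally have F: "F * inverse G = 1" .
  have "F = F * (G * inverse G)" unfolding G by simp
  also have "\<dots> = (F * inverse G) * G" by (simp only: mult_ac)
  finally show ?thesis unfolding F by simp
qed

text \<open>The derivative of the series with coefficients N r / r. The index shift means that N 0
  never enters.\<close>

definition log_deriv :: "(nat \<Rightarrow> Qbar) \<Rightarrow> Qbar fps" where
  "log_deriv N = Abs_fps (\<lambda>r. N (Suc r))"

lemma exp_series_ode:
  "fps_deriv (exp_series N) = exp_series N * log_deriv N" "fps_nth (exp_series N) 0 = 1"
proof -
  let ?A = "Abs_fps (\<lambda>r. if r = 0 then 0 else N r / of_nat r)"
  have "fps_deriv ?A = log_deriv N"
    by (rule fps_ext) (simp add: log_deriv_def del: of_nat_Suc)
  then show "fps_deriv (exp_series N) = exp_series N * log_deriv N"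
    unfolding exp_series_def by (subst fps_compose_deriv) simp_all
  show "fps_nth (exp_series N) 0 = 1" by (simp add: exp_series_def)
qed

lemma exp_series_cong:
  assumes "\<And>r. r \<ge> 1 \<Longrightarrow> M r = N r"
  shows "exp_series M = exp_series N"
  by (rule fps_linear_ode_unique[where c = "log_deriv N"])
    (use assms in \<open>simp_all add: exp_series_ode log_deriv_def\<close>)

lemma exp_series_add: "exp_series (\<lambda>r. M r + N r) = exp_series M * exp_series N"
proof (rule fps_linear_ode_unique[where c = "log_deriv M + log_deriv N"])
  have "log_deriv (\<lambda>r. M r + N r) = log_deriv M + log_deriv N"
    by (rule fps_ext) (simp add: log_deriv_def)
  then show "fps_deriv (exp_series (\<lambda>r. M r + N r)) =
      exp_series (\<lambda>r. M r + N r) * (log_deriv M + log_deriv N)"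
    by (simp only: exp_series_ode)
qed (simp_all add: exp_series_ode algebra_simps)

lemma exp_series_power: "exp_series (\<lambda>r. S ^ r) = inverse (1 - fps_const S * fps_X)"
proof (rule fps_linear_ode_unique[where c = "log_deriv (\<lambda>r. S ^ r)"])
  let ?g = "1 - fps_const S * fps_X"
  have "?g * Abs_fps (\<lambda>n. S ^ n) = 1"
  proof (rule fps_ext)
    fix n show "fps_nth (?g * Abs_fps (\<lambda>n. S ^ n)) n = fps_nth 1 n"
      by (cases n) (simp_all add: left_diff_distrib mult.assoc)
  qed
  then have g: "inverse ?g = Abs_fps (\<lambda>n. S ^ n)" by (rule fps_inverse_unique)
  have l: "log_deriv (\<lambda>r. S ^ r) = fps_const S * inverse ?g"
    unfolding g by (rule fps_ext) (simp add: log_deriv_def)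
  show "fps_deriv (inverse ?g) = inverse ?g * log_deriv (\<lambda>r. S ^ r)"
    unfolding l by (subst fps_inverse_deriv) (simp_all add: power2_eq_square mult_ac)
qed (simp_all add: exp_series_ode)

section \<open>Counting points\<close>

lemma sum_powers_base: "(\<Sum>i<r. q ^ i) * (q - 1) = q ^ r - (1::nat)"
proof (cases "q = 0")
  case False
  have "(\<Sum>i<r. q ^ i) * (q - 1) + 1 = q ^ r"
  proof (induction r)
    case (Suc r)
    have "(\<Sum>i<Suc r. q ^ i) * (q - 1) + 1 = ((\<Sum>i<r. q ^ i) * (q - 1) + 1) + q ^ r * (q - 1)"
      by (simp add: algebra_simps)
    also have "\<dots> = q ^ r * (1 + (q - 1))" unfolding Suc by (simp add: distrib_left)
    finally show ?case using False by simp
  qed simp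
  then show ?thesis by simp
qed (cases r, simp_all)

section \<open>Characters of order d and the fibres of the covering\<close>

locale kummer =
  fixes d :: nat and \<phi> :: "'a::{field,finite} \<Rightarrow> Qbar"
  assumes d_dvd: "d dvd CARD('a) - 1" and d_pos: "d > 0"
    and gen: "mult_char_generator UNIV \<phi>"
begin

definition k :: nat where "k = (CARD('a) - 1) div d"

definition \<phi>d :: "'a \<Rightarrow> Qbar" where "\<phi>d = char_pow UNIV \<phi> k"

lemma k: "d * k = CARD('a) - 1" "k > 0"
proof -
  show *: "d * k = CARD('a) - 1" using d_dvd by (simp add: k_def)
  show "k > 0"
  proof (rule gr0I)
    assume "k = 0"
    then show False using * card_base_gt_1[where ?'a = 'a] by simp
  qed
qed

lemma phi_char: "\<phi> \<in> mult_chars UNIV" and phid_char: "\<phi>d \<in> mult_chars UNIV"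
  using gen by (auto simp: mult_char_generator_def \<phi>d_def)

lemma phid_apply: "x \<noteq> 0 \<Longrightarrow> \<phi>d x = \<phi> x ^ k"
  by (simp add: \<phi>d_def base.char_pow_apply phi_char)

text \<open>Where a generator takes the value 1, all characters do, and characters separate
  points.\<close>

lemma phi_eq_1:
  assumes "\<phi> x = 1"
  shows "x = 1"
proof (rule base.char_separates)
  fix \<nu> :: "'a \<Rightarrow> Qbar" assume "\<nu> \<in> mult_chars UNIV"
  then obtain n where "\<nu> = char_pow UNIV \<phi> n" using gen by (auto simp: mult_char_generator_def)
  moreover have "x \<noteq> 0" using assms phi_char by auto
  ultimately show "\<nu> x = 1" using assms phi_char by (simp add: base.char_pow_apply)
qed simp

lemma unit_power: "x \<noteq> 0 \<Longrightarrow> (x :: 'a) ^ (d * k) = 1"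
  unfolding k(1) by (rule base.power_card_units) simp

lemma phid_power_d: "x \<noteq> 0 \<Longrightarrow> \<phi>d x ^ d = 1"
  using unit_power[of x] phi_char base.char_power[of \<phi> x "d * k"]
  by (simp add: phid_apply mult.commute flip: power_mult)

text \<open>If d were 0 in the field, then q = d k + 1 would be 1 there instead of 0. This makes X^d
  - w separable for w \<noteq> 0.\<close>

lemma of_nat_d: "(of_nat d :: 'a alg_closure) \<noteq> 0"
proof
  assume "(of_nat d :: 'a alg_closure) = 0"
  then have "to_ac (of_nat d :: 'a) = 0" by simp
  then have "(of_nat d :: 'a) = 0" by (simp only: to_ac_eq_0_iff)
  then have "(of_nat (d * k + 1) :: 'a) = 1" by simp
  moreover have "d * k + 1 = CARD('a)" using k(1) card_base_gt_1[where ?'a = 'a] by simp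
  ultimately have "(of_nat CARD('a) :: 'a) = 1" by (simp only:)
  then show False using base.of_nat_card_eq_0[where ?'a = 'a] by simp
qed

lemma card_roots:
  fixes w :: "'a alg_closure"
  assumes "w \<noteq> 0"
  shows "card {y. y ^ d = w} = d"
proof -
  let ?p = "Polynomial.monom 1 d - [:w:]"
  have c: "Polynomial.coeff ?p d = 1" using d_pos by (simp add: coeff_pCons split: nat.split)
  then have p0: "?p \<noteq> 0" by (metis coeff_0 zero_neq_one)
  have "card {y. poly ?p y = 0} = Polynomial.degree ?p"
  proof (rule card_roots_separable[OF p0])
    fix y assume "poly ?p y = 0"
    then have "y \<noteq> 0" using assms d_pos by (auto simp: poly_monom)
    then show "poly (pderiv ?p) y \<noteq> 0"
      using of_nat_d by (simp add: pderiv_diff pderiv_monom poly_monom pderiv_pCons)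
  qed
  also have "Polynomial.degree ?p = d"
    using c by (intro antisym degree_diff_le le_degree) (simp_all add: degree_monom_le)
  finally show ?thesis by (simp add: poly_monom)
qed

text \<open>Since d divides q - 1, every d-th root of unity y satisfies y^q = y, so all of them lie
  in the base field.\<close>

lemma card_mu: "card (mu d :: 'a set) = d"
proof -
  have "bij_betw to_ac (mu d :: 'a set) {y. y ^ d = 1}"
  proof (rule bij_betw_imageI)
    show "inj_on to_ac (mu d :: 'a set)" using inj_to_ac by (rule inj_on_subset) simp
    have "y \<in> to_ac ` mu d" if "y ^ d = 1" for y :: "'a alg_closure"
    proof -
      have "y ^ (d * k) = 1" using that by (simp add: power_mult)
      then have "y ^ Suc (d * k) = y" by simp
      moreover have "Suc (d * k) = CARD('a)" using k(1) card_base_gt_1[where ?'a = 'a] by simp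
      ultimately have "frob y = y" by (simp add: frob_def)
      then obtain a where a: "y = to_ac a" by (auto simp: frob_fixed_iff)
      then have "to_ac (a ^ d) = 1" using that by simp
      then show ?thesis using a by (simp add: mu_def del: to_ac_power)
    qed
    then show "to_ac ` mu d = {y :: 'a alg_closure. y ^ d = 1}"
      by (auto simp: mu_def simp flip: to_ac_power)
  qed
  from bij_betw_same_card[OF this] show ?thesis by (simp add: card_roots)
qed

lemma mu_phi_power:
  assumes "\<xi> \<in> mu d" "d dvd m"
  shows "\<phi> \<xi> ^ m = 1"
proof -
  obtain l where "m = d * l" using assms(2) by (elim dvdE)
  then have "\<xi> ^ m = 1" using assms(1) by (simp add: mu_def power_mult)
  then show ?thesis using base.char_power[OF phi_char, of \<xi> m] phi_char by simp
qed

lemma sum_mu: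
  "(\<Sum>\<xi>\<in>mu d. \<phi> \<xi> ^ m) = (if d dvd m then of_nat d else 0)"
proof (cases "d dvd m")
  case True
  then show ?thesis by (simp add: mu_phi_power card_mu)
next
  case False
  \<comment> \<open>Otherwise \<open>phi_eq_1\<close> makes all d elements of \<open>mu d\<close>
    m-th roots of unity, which forces d to divide m.\<close>
  have "\<exists>\<xi>\<in>mu d. \<phi> \<xi> ^ m \<noteq> 1"
  proof (rule ccontr)
    assume *: "\<not> (\<exists>\<xi>\<in>mu d. \<phi> \<xi> ^ m \<noteq> 1)"
    have "card (mu d :: 'a set) dvd m"
    proof (rule card_dvd_exponent)
      fix \<xi> :: 'a assume \<xi>: "\<xi> \<in> mu d"
      then show "\<xi> ^ card (mu d :: 'a set) = 1" by (simp add: card_mu) (simp add: mu_def)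
      show "\<xi> ^ m = 1" using * \<xi> by (intro phi_eq_1) (simp add: base.char_power phi_char)
    qed (simp add: card_mu d_pos)
    then show False using False by (simp add: card_mu)
  qed
  then obtain \<xi> where \<xi>: "\<xi> \<in> mu d" "\<phi> \<xi> ^ m \<noteq> 1" by blast
  then have \<xi>0: "\<xi> \<noteq> 0" using d_pos by (auto simp: mu_def power_0_left)
  have "bij_betw ((*) \<xi>) (mu d) (mu d)"
    by (rule bij_betw_byWitness[where f' = "\<lambda>x. x / \<xi>"])
      (use \<xi> \<xi>0 in \<open>auto simp: mu_def power_mult_distrib power_divide\<close>)
  then have "(\<Sum>\<zeta>\<in>mu d. \<phi> \<zeta> ^ m) = (\<Sum>\<zeta>\<in>mu d. \<phi> (\<xi> * \<zeta>) ^ m)"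
    by (rule sum.reindex_bij_betw[symmetric])
  also have "\<dots> = \<phi> \<xi> ^ m * (\<Sum>\<zeta>\<in>mu d. \<phi> \<zeta> ^ m)"
    by (simp add: base.char_mult phi_char power_mult_distrib sum_distrib_left)
  finally show ?thesis using \<xi> False by simp
qed

lemma ext_norm_power:
  fixes w :: "'a alg_closure"
  assumes "r \<ge> 1" "w \<in> ext_field r"
  shows "to_ac (ext_norm r w ^ k) = w ^ ((\<Sum>i<r. CARD('a) ^ i) * k)"
  using assms by (simp add: to_ac_ext_norm funpow_frob power_mult flip: power_sum)

lemma exponent: "d * ((\<Sum>i<r. CARD('a) ^ i) * k) = CARD('a) ^ r - 1"
  unfolding sum_powers_base[where r = r and q = "CARD('a)", symmetric] k(1)[symmetric]
  by (simp only: mult_ac)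

text \<open>A solution \<open>y\<close> of \<open>y^d = w \<noteq> 0\<close> satisfies \<open>F^r y = w^e y\<close> with \<open>e = (q^r - 1) / d\<close>.\<close>
lemma sum_fibre:
  assumes r: "r \<ge> 1" and w: "w \<in> ext_field r"
  shows "(\<Sum>\<xi>\<in>mu d. \<phi> \<xi> ^ m * of_nat (card {y. y ^ d = w \<and> (frob ^^ r) y = to_ac \<xi> * y})) =
    of_nat d * (if w = 0 then (if d dvd m then 1 else 0) else char_lift r \<phi>d w ^ m)"
proof (cases "w = 0")
  case True
  \<comment> \<open>The only point over w = 0 is y = 0. It is fixed by all of \<open>mu d\<close>,
    so this fibre contributes the complete character sum over \<open>mu d\<close>.\<close>
  have "{y. y ^ d = w \<and> (frob ^^ r) y = to_ac \<xi> * y} = {0}" for \<xi> :: 'a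
    using True d_pos by (auto simp: power_0_left)
  then show ?thesis using True by (simp add: sum_mu)
next
  case False
  let ?e = "(\<Sum>i<r. CARD('a) ^ i) * k"
  \<comment> \<open>The unique element of \<open>mu d\<close> by which F^r acts on the fibre, equal
    to w^((q^r - 1) / d); its image under \<phi> is \<phi>d of the norm of w.\<close>
  define z where "z = ext_norm r w ^ k"
  have n0: "ext_norm r w \<noteq> 0" using False ext_norm_eq_0_iff[OF w] by simp
  have \<xi>: "z \<in> mu d"
    using unit_power[OF n0] by (simp add: z_def mu_def mult.commute flip: power_mult)
  have "(frob ^^ r) y = to_ac z * y" if "y ^ d = w" for y
  proof -
    have "CARD('a) ^ r = d * ?e + 1" unfolding exponent by simp
    then have "(frob ^^ r) y = (y ^ d) ^ ?e * y"
      by (simp only: funpow_frob power_add power_mult power_one_right)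
    then show ?thesis unfolding that z_def ext_norm_power[OF r w] .
  qed
  moreover have "y \<noteq> 0" if "y ^ d = w" for y using that False d_pos by (auto simp: power_0_left)
  ultimately have "{y. y ^ d = w \<and> (frob ^^ r) y = to_ac \<xi> * y} = (if \<xi> = z then {y. y ^ d = w} else {})" for \<xi>
    by auto
  then have "(\<Sum>\<xi>\<in>mu d. \<phi> \<xi> ^ m * of_nat (card {y. y ^ d = w \<and> (frob ^^ r) y = to_ac \<xi> * y})) =
      (\<Sum>\<xi>\<in>mu d. if \<xi> = z then \<phi> \<xi> ^ m * of_nat d else 0)"
    using False by (intro sum.cong) (simp_all add: card_roots)
  also have "\<dots> = \<phi> z ^ m * of_nat d" using \<xi> by simp
  also have "\<phi> z = char_lift r \<phi>d w"
    using w n0 by (simp add: z_def char_lift_def phid_apply base.char_power phi_char)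
  finally show ?thesis using False by simp
qed

text \<open>The group moves only y, so a counted point has x1 and x2 in \<open>ext_field r\<close>,
  and the count splits into the fibres over such pairs.\<close>

lemma twisted_count_surface:
  assumes r: "r \<ge> 1"
    and P: "\<And>x1 x2. x1 \<in> ext_field r \<Longrightarrow> x2 \<in> ext_field r \<Longrightarrow> P x1 x2 \<in> ext_field r"
  shows "twisted_count {(x1, x2, y). y ^ d = P x1 x2} frob3 (mu d) mu_act
      (\<lambda>\<xi>. restrict \<phi> (mu d) \<xi> ^ m) r =
    (\<Sum>(x1, x2)\<in>ext_field r \<times> ext_field r.
      if P x1 x2 = 0 then (if d dvd m then 1 else 0) else char_lift r \<phi>d (P x1 x2) ^ m)"
proof -
  let ?K = "ext_field r :: 'a alg_closure set"
  let ?Y = "\<lambda>\<xi> x1 x2. {y. y ^ d = P x1 x2 \<and> (frob ^^ r) y = to_ac \<xi> * y}"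
  have fin: "finite ?K" using r by (rule card_ext_field(2))
  have f3: "(frob3 ^^ n) (x1, x2, y) = ((frob ^^ n) x1, (frob ^^ n) x2, (frob ^^ n) y)"
    for n and x1 x2 y :: "'a alg_closure"
    by (induction n) (simp_all add: frob3_def)
  have card: "card {x \<in> {(x1, x2, y). y ^ d = P x1 x2}. (frob3 ^^ r) x = mu_act \<xi> x} =
      (\<Sum>(x1, x2)\<in>?K \<times> ?K. card (?Y \<xi> x1 x2))" for \<xi>
  proof -
    have "bij_betw (\<lambda>((x1, x2), y). (x1, x2, y)) (SIGMA p:?K \<times> ?K. ?Y \<xi> (fst p) (snd p))
        {x \<in> {(x1, x2, y). y ^ d = P x1 x2}. (frob3 ^^ r) x = mu_act \<xi> x}"
      by (rule bij_betw_byWitness[where f' = "\<lambda>(x1, x2, y). ((x1, x2), y)"])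
        (auto simp: f3 mu_act_def ext_field_def)
    from bij_betw_same_card[OF this]
    have "card {x \<in> {(x1, x2, y). y ^ d = P x1 x2}. (frob3 ^^ r) x = mu_act \<xi> x} =
        card (SIGMA p:?K \<times> ?K. ?Y \<xi> (fst p) (snd p))" by simp
    also have "\<dots> = (\<Sum>p\<in>?K \<times> ?K. card (?Y \<xi> (fst p) (snd p)))"
    proof (rule card_SigmaI)
      have "finite {y :: 'a alg_closure. y ^ d = w}" for w
      proof (cases "w = 0")
        case True
        then show ?thesis using d_pos by simp
      next
        case False
        then show ?thesis using card_roots[OF False] d_pos by (intro card_ge_0_finite) simp
      qed
      then show "\<forall>p\<in>?K \<times> ?K. finite (?Y \<xi> (fst p) (snd p))" by simp
    qed (use fin in simp)
    finally show ?thesis by (simp add: case_prod_unfold)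
  qed
  have "twisted_count {(x1, x2, y). y ^ d = P x1 x2} frob3 (mu d) mu_act
      (\<lambda>\<xi>. restrict \<phi> (mu d) \<xi> ^ m) r =
    1 / of_nat d * (\<Sum>\<xi>\<in>mu d. \<Sum>(x1, x2)\<in>?K \<times> ?K. \<phi> \<xi> ^ m * of_nat (card (?Y \<xi> x1 x2)))"
    unfolding twisted_count_def card_mu card
    by (simp add: sum_distrib_left case_prod_unfold)
  also have "(\<Sum>\<xi>\<in>mu d. \<Sum>(x1, x2)\<in>?K \<times> ?K. \<phi> \<xi> ^ m * of_nat (card (?Y \<xi> x1 x2))) =
    (\<Sum>(x1, x2)\<in>?K \<times> ?K. \<Sum>\<xi>\<in>mu d. \<phi> \<xi> ^ m * of_nat (card (?Y \<xi> x1 x2)))"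
    unfolding case_prod_unfold by (rule sum.swap)
  also have "\<dots> = (\<Sum>(x1, x2)\<in>?K \<times> ?K. of_nat d *
      (if P x1 x2 = 0 then (if d dvd m then 1 else 0) else char_lift r \<phi>d (P x1 x2) ^ m))"
    using P by (intro sum.cong refl) (auto simp: sum_fibre[OF r])
  also have "1 / of_nat d * \<dots> = (\<Sum>(x1, x2)\<in>?K \<times> ?K.
      if P x1 x2 = 0 then (if d dvd m then 1 else 0) else char_lift r \<phi>d (P x1 x2) ^ m)"
    using d_pos by (simp add: sum_distrib_left[symmetric] case_prod_unfold)
  finally show ?thesis .
qed

text \<open>Lifting along the norm preserves the order d. Equal powers give w^(e (j - i)) = 1 for
  all units w, with e = (q^r - 1) / d, so q^r - 1 = d e divides e (j - i).\<close>

lemma char_lift_power_eq: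
  assumes r: "r \<ge> 1"
    and eq: "char_lift r (char_pow UNIV \<phi>d i) = char_lift r (char_pow UNIV \<phi>d j)"
  shows "int d dvd int i - int j"
proof -
  interpret finite_subfield "ext_field r :: 'a alg_closure set"
    using r by (rule finite_subfield_ext_field)
  let ?K = "ext_field r :: 'a alg_closure set"
  have le: "d dvd j - i" if "i \<le> j"
    "char_lift r (char_pow UNIV \<phi>d i) = char_lift r (char_pow UNIV \<phi>d j)" for i j
  proof -
    let ?e = "(\<Sum>i<r. CARD('a) ^ i) * k"
    have "card (?K - {0}) dvd ?e * (j - i)"
    proof (rule card_dvd_exponent)
      fix w assume w: "w \<in> ?K - {0}"
      then have n0: "ext_norm r w \<noteq> 0" using ext_norm_eq_0_iff[of w r] by simp
      from fun_cong[OF that(2), of w] have "\<phi>d (ext_norm r w) ^ i = \<phi>d (ext_norm r w) ^ j"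
        using w n0 by (simp add: char_lift_def base.char_pow_apply phid_char)
      also have "\<dots> = \<phi>d (ext_norm r w) ^ i * \<phi>d (ext_norm r w) ^ (j - i)"
        using that(1) by (simp flip: power_add)
      finally have "\<phi>d (ext_norm r w) ^ (j - i) = 1"
        using n0 by (simp add: base.char_0_iff phid_char)
      then have "\<phi> (ext_norm r w ^ (k * (j - i))) = 1"
        using n0 by (simp add: phid_apply base.char_power phi_char power_mult)
      then have "ext_norm r w ^ (k * (j - i)) = 1" by (rule phi_eq_1)
      then have "to_ac ((ext_norm r w ^ k) ^ (j - i)) = 1"
        by (simp only: power_mult to_ac_1)
      then have "to_ac (ext_norm r w ^ k) ^ (j - i) = 1" by (simp only: to_ac_power)
      then show "w ^ (?e * (j - i)) = 1"
        using w r by (simp only: ext_norm_power DiffD1 power_mult)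
      show "w ^ card (?K - {0}) = 1" using power_card_units[OF w] by (simp only: card_units)
    qed (use card_gt_1 in \<open>simp add: card_units\<close>)
    then have "d * ?e dvd ?e * (j - i)"
      by (simp only: card_units card_ext_field(1)[OF r] exponent)
    moreover have "?e > 0"
    proof -
      have "d * ?e = card ?K - 1" by (simp only: card_ext_field(1)[OF r] exponent)
      then show ?thesis using card_gt_1 by (metis gr0I mult_0_right zero_less_diff less_irrefl)
    qed
    ultimately show ?thesis by (simp only: mult.commute[of d] nat_mult_dvd_cancel1)
  qed
  show ?thesis
  proof (cases "i \<le> j")
    case True
    with le[OF True eq] show ?thesis by (metis dvd_diff_commute int_dvd_int_iff of_nat_diff)
  next
    case False
    then show ?thesis using le[of j i] eq by (metis int_dvd_int_iff nat_le_linear of_nat_diff)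
  qed
qed

end

section \<open>Exponents of the surface and the corresponding characters\<close>

context kummer
begin

text \<open>Keeping the exponent explicit turns products and quotients of characters into sums and
  differences of integers.\<close>

definition chi :: "nat \<Rightarrow> nat \<Rightarrow> 'a alg_closure \<Rightarrow> Qbar" where
  "chi r i = char_lift r (char_pow UNIV \<phi>d i)"

lemma chi_in:
  assumes "r \<ge> 1"
  shows "chi r i \<in> mult_chars (ext_field r)"
  unfolding chi_def using assms phid_char by (intro char_lift_in base.char_pow_in)

lemma chi_powi:
  assumes "x \<in> ext_field r" "x \<noteq> 0"
  shows "chi r i x = char_lift r \<phi>d x powi int i"
  using assms ext_norm_eq_0_iff[OF assms(1)] phid_char
  by (auto simp: chi_def char_lift_def base.char_pow_apply ext_norm_def)

lemma lift_neq_0: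
  assumes "r \<ge> 1" "x \<in> ext_field r" "x \<noteq> 0"
  shows "char_lift r \<phi>d x \<noteq> 0"
  using assms ext_norm_eq_0_iff[OF assms(2)] phid_char by (simp add: char_lift_def base.char_0_iff)

text \<open>At units only n modulo d matters, as the lifted character has values of order dividing
  d. At x = 0, positivity of n makes x^n vanish, in agreement with a character being 0 there even if
  d divides j.\<close>

lemma lift_power_rep:
  assumes r: "r \<ge> 1" and x: "x \<in> ext_field r" and m: "m > 0"
    and n: "n > 0" "int d dvd int n - j"
  shows "char_lift r \<phi>d (x ^ n) ^ m = (if x = 0 then 0 else char_lift r \<phi>d x powi (int m * j))"
proof (cases "x = 0")
  case True
  then show ?thesis using m n char_lift_in[OF r phid_char]
      finite_subfield.char_zero[OF finite_subfield_ext_field[OF r]] by (simp add: power_0_left)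
next
  case False
  interpret finite_subfield "ext_field r :: 'a alg_closure set"
    using r by (rule finite_subfield_ext_field)
  let ?c = "char_lift r \<phi>d x"
  have c0: "?c \<noteq> 0" using r x False by (rule lift_neq_0)
  have cd: "?c ^ d = 1"
    using x False ext_norm_eq_0_iff[OF x] by (simp add: char_lift_def phid_power_d)
  obtain t where t: "int n - j = int d * t" using n(2) by (elim dvdE)
  then have "int n = j + int d * t" by simp
  then have "int (n * m) = int m * j + int d * (t * int m)"
    by (simp add: algebra_simps)
  then have "?c powi int (n * m) = ?c powi (int m * j + int d * (t * int m))" by (simp only:)
  also have "\<dots> = ?c powi (int m * j) * ?c powi (int d * (t * int m))"
    by (rule power_int_add) (simp add: c0)
  also have "?c powi (int d * (t * int m)) = (?c powi int d) powi (t * int m)"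
    by (rule power_int_mult)
  also have "?c powi int d = 1" using cd by simp
  finally have "?c ^ (n * m) = ?c powi (int m * j)"
    by (simp only: power_int_of_nat power_int_1_left mult_1_right)
  then show ?thesis
    using False x char_power[OF char_lift_in[OF r phid_char] x, of n] by (simp add: power_mult)
qed

lemma chi_combination:
  assumes r: "r \<ge> 1" and x: "x \<in> ext_field r"
  shows "(char_inv (chi r i) \<star> chi r j) x =
      (if x = 0 then 0 else char_lift r \<phi>d x powi (int j - int i))"
    and "(chi r i \<star> char_inv (chi r j \<star> chi r l)) x =
      (if x = 0 then 0 else char_lift r \<phi>d x powi (int i - int j - int l))"
    and "(chi r i \<star> chi r j \<star> char_inv (chi r l \<star> chi r n)) x =
      (if x = 0 then 0 else char_lift r \<phi>d x powi (int i + int j - int l - int n))"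
proof -
  interpret finite_subfield "ext_field r :: 'a alg_closure set"
    using r by (rule finite_subfield_ext_field)
  show "(char_inv (chi r i) \<star> chi r j) x =
      (if x = 0 then 0 else char_lift r \<phi>d x powi (int j - int i))"
    "(chi r i \<star> char_inv (chi r j \<star> chi r l)) x =
      (if x = 0 then 0 else char_lift r \<phi>d x powi (int i - int j - int l))"
    "(chi r i \<star> chi r j \<star> char_inv (chi r l \<star> chi r n)) x =
      (if x = 0 then 0 else char_lift r \<phi>d x powi (int i + int j - int l - int n))"
    using chi_in[OF r] lift_neq_0[OF r x] chi_powi[OF x]
    by (simp_all add: char_mult_def char_inv_def power_int_diff power_int_add divide_inverse mult_ac
        del: power_int_of_nat)
qed

lemma twisted_count_eq_surface_sum:
  fixes a b c1 c2 m :: nat and l1 l2 :: 'a and rep :: "int \<Rightarrow> nat"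
  assumes r: "r \<ge> 1" and m: "\<not> d dvd m"
    and rep: "\<And>j. j \<in> {int a, int b, int c1 - int a, int c2 - int b, int a - int c1 - int c2,
        int b - int c1 - int c2, int c1 + int c2 - int a - int b} \<Longrightarrow>
        rep j > 0 \<and> int d dvd int (rep j) - j"
  shows "twisted_count (S4 rep d (int a) (int b) (int c1) (int c2) l1 l2) frob3 (mu d) mu_act
      (\<lambda>\<xi>. restrict \<phi> (mu d) \<xi> ^ m) r =
    finite_subfield.surface_sum (ext_field r) (chi r (m * a)) (chi r (m * b)) (chi r (m * c1))
      (chi r (m * c2)) (to_ac l1) (to_ac l2)"
proof -
  interpret finite_subfield "ext_field r :: 'a alg_closure set"
    using r by (rule finite_subfield_ext_field)
  have m0: "m > 0" using m by (auto intro!: gr0I)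
  let ?c = "char_lift r \<phi>d"
  have c: "?c \<in> chars" using r phid_char by (rule char_lift_in)
  define P where "P x1 x2 = x1 ^ rep (int a) * x2 ^ rep (int b) * (1 - x1) ^ rep (int c1 - int a) *
      (1 - x2) ^ rep (int c2 - int b) * (1 - to_ac l1 * x1) ^ rep (int a - int c1 - int c2) *
      (1 - to_ac l2 * x2) ^ rep (int b - int c1 - int c2) *
      (1 - to_ac l1 * x1 - to_ac l2 * x2) ^ rep (int c1 + int c2 - int a - int b)" for x1 x2
  have "S4 rep d (int a) (int b) (int c1) (int c2) l1 l2 = {(x1, x2, y). y ^ d = P x1 x2}"
    by (simp add: S4_def P_def)
  then have "twisted_count (S4 rep d (int a) (int b) (int c1) (int c2) l1 l2) frob3 (mu d) mu_act
      (\<lambda>\<xi>. restrict \<phi> (mu d) \<xi> ^ m) r = (\<Sum>(x1, x2)\<in>ext_field r \<times> ext_field r.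
      if P x1 x2 = 0 then (if d dvd m then 1 else 0) else ?c (P x1 x2) ^ m)"
    using twisted_count_surface[OF r, of P m] by (simp add: P_def)
  also have "\<dots> = surface_sum (chi r (m * a)) (chi r (m * b)) (chi r (m * c1))
      (chi r (m * c2)) (to_ac l1) (to_ac l2)"
    unfolding surface_sum_def
  proof (rule sum.cong[OF refl], clarify)
    fix x1 x2 :: "'a alg_closure" assume x: "x1 \<in> ext_field r" "x2 \<in> ext_field r"
    let ?F = "\<lambda>j x. if x = 0 then 0 else ?c x powi (int m * j)"
    have in_K: "1 - x1 \<in> ext_field r" "1 - x2 \<in> ext_field r" "1 - to_ac l1 * x1 \<in> ext_field r"
      "1 - to_ac l2 * x2 \<in> ext_field r" "1 - to_ac l1 * x1 - to_ac l2 * x2 \<in> ext_field r"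
      using x by simp_all
    have e: "?c (y ^ rep j) ^ m = ?F j y"
      if "y \<in> ext_field r" "j \<in> {int a, int b, int c1 - int a, int c2 - int b, int a - int c1 - int c2,
        int b - int c1 - int c2, int c1 + int c2 - int a - int b}" for y j
      using rep[OF that(2)] by (intro lift_power_rep r that m0) simp_all
    have chi: "chi r (m * i) y = ?F (int i) y" if "y \<in> ext_field r" for i y
      using chi_powi[of y r "m * i"] chi_in[OF r, of "m * i"] that
      by (cases "y = 0") (simp_all del: power_int_of_nat)
    \<comment> \<open>As d does not divide m, zeros of P contribute 0, and so does the power of the
      character, because m > 0.\<close>
    have "(if P x1 x2 = 0 then (if d dvd m then 1 else 0) else ?c (P x1 x2) ^ m) = ?c (P x1 x2) ^ m"
      using m m0 c by (simp add: power_0_left)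
    also have "\<dots> = ?F (int a) x1 * ?F (int b) x2 * ?F (int c1 - int a) (1 - x1) *
      ?F (int c2 - int b) (1 - x2) * ?F (int a - int c1 - int c2) (1 - to_ac l1 * x1) *
      ?F (int b - int c1 - int c2) (1 - to_ac l2 * x2) *
      ?F (int c1 + int c2 - int a - int b) (1 - to_ac l1 * x1 - to_ac l2 * x2)"
      unfolding P_def
      by (subst e[symmetric], use x in_K in simp, use x in_K in simp)+
        (use x in_K c in \<open>simp add: char_mult power_mult_distrib\<close>)
    also have "\<dots> = chi r (m * a) x1 * chi r (m * b) x2 *
      (char_inv (chi r (m * a)) \<star> chi r (m * c1)) (1 - x1) *
      (char_inv (chi r (m * b)) \<star> chi r (m * c2)) (1 - x2) *
      (chi r (m * a) \<star> char_inv (chi r (m * c1) \<star> chi r (m * c2))) (1 - to_ac l1 * x1) *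
      (chi r (m * b) \<star> char_inv (chi r (m * c1) \<star> chi r (m * c2))) (1 - to_ac l2 * x2) *
      (chi r (m * c1) \<star> chi r (m * c2) \<star> char_inv (chi r (m * a) \<star> chi r (m * b)))
        (1 - to_ac l1 * x1 - to_ac l2 * x2)"
      unfolding chi[OF x(1)] chi[OF x(2)] chi_combination(1)[OF r in_K(1)] chi_combination(1)[OF r in_K(2)]
        chi_combination(2)[OF r in_K(3)] chi_combination(2)[OF r in_K(4)] chi_combination(3)[OF r in_K(5)]
      by (simp only: right_diff_distrib distrib_left of_nat_mult)
    finally show "(if P x1 x2 = 0 then (if d dvd m then 1 else 0) else ?c (P x1 x2) ^ m) = \<dots>" .
  qed
  finally show ?thesis .
qed

text \<open>In contrapositive form this turns the coprimality assumptions into inequalities between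
  characters when d does not divide m.\<close>

lemma chi_eq_imp_dvd:
  assumes r: "r \<ge> 1" and eq: "chi r (m * i) = chi r (m * j)"
    and cop: "coprime (int d) (int i - int j)"
  shows "d dvd m"
proof -
  have "int d dvd int (m * i) - int (m * j)"
    using char_lift_power_eq[OF r] eq unfolding chi_def .
  then have "int d dvd int m * (int i - int j)"
    by (simp add: right_diff_distrib)
  then show ?thesis using cop by (simp add: coprime_dvd_mult_left_iff)
qed

lemma char_lift_triv: "r \<ge> 1 \<Longrightarrow> char_lift r (triv_char UNIV) = triv_char (ext_field r)"
  by (auto simp: fun_eq_iff char_lift_def triv_char_def ext_norm_eq_0_iff)

lemma chi_0: "r \<ge> 1 \<Longrightarrow> chi r 0 = triv_char (ext_field r)"
  by (simp add: chi_def char_pow_def char_lift_triv)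

text \<open>The formula with F4 requires that \<alpha>, \<beta>, \<alpha>/\<gamma>1 and
  \<beta>/\<gamma>2 be non-trivial, and the Hasse-Davenport relation for the Jacobi sum in S0
  requires this of \<beta>/\<gamma>1. Each comes from one gcd condition.\<close>

lemma twisted_count_S4:
  fixes a b c1 c2 m :: nat and l1 l2 :: 'a and rep :: "int \<Rightarrow> nat"
  assumes r: "r \<ge> 1" and m: "\<not> d dvd m"
    and rep: "\<And>j. j \<in> {int a, int b, int c1 - int a, int c2 - int b, int a - int c1 - int c2,
        int b - int c1 - int c2, int c1 + int c2 - int a - int b} \<Longrightarrow>
        rep j > 0 \<and> int d dvd int (rep j) - j"
    and l: "l1 \<notin> {0, 1}" "l2 \<notin> {0, 1}"
    and \<psi>: "nontriv_add_char (ext_field r) \<psi>"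
    and gcds: "gcd (int d) (int a) = 1" "gcd (int d) (int b) = 1"
      "gcd (int d) (int c1 - int a) = 1" "gcd (int d) (int c1 - int b) = 1"
      "gcd (int d) (int c2 - int b) = 1"
  defines "\<alpha> \<equiv> char_pow UNIV \<phi>d (m * a)" and "\<beta> \<equiv> char_pow UNIV \<phi>d (m * b)"
    and "\<gamma>1 \<equiv> char_pow UNIV \<phi>d (m * c1)" and "\<gamma>2 \<equiv> char_pow UNIV \<phi>d (m * c2)"
  shows "twisted_count (S4 rep d (int a) (int b) (int c1) (int c2) l1 l2) frob3 (mu d) mu_act
      (\<lambda>\<xi>. restrict \<phi> (mu d) \<xi> ^ m) r =
    (jacobi UNIV \<alpha> (char_inv \<alpha> \<star> \<gamma>1) * jacobi UNIV \<beta> (char_inv \<beta> \<star> \<gamma>2)) ^ r *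
      appell_F4 (ext_field r) \<psi> (char_lift r \<alpha>) (char_lift r \<beta>) (char_lift r \<gamma>1) (char_lift r \<gamma>2)
        (to_ac (l1 * (1 - l2))) (to_ac (l2 * (1 - l1)))
    + ((\<alpha> \<star> \<beta>) (-1) * jacobi UNIV (\<alpha> \<star> char_inv \<gamma>2) (\<beta> \<star> char_inv \<gamma>1) *
      char_inv \<gamma>1 l1 * char_inv \<gamma>2 l2) ^ r
    + (jacobi UNIV (char_inv (\<alpha> \<star> \<beta>) \<star> \<gamma>1 \<star> \<gamma>2) \<beta> *
      char_inv \<gamma>1 l1 * (char_inv \<alpha> \<star> \<gamma>1) (l1 - 1) * char_inv \<beta> l2) ^ r
    + (jacobi UNIV (char_inv (\<alpha> \<star> \<beta>) \<star> \<gamma>1 \<star> \<gamma>2) \<alpha> *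
      char_inv \<gamma>2 l2 * (char_inv \<beta> \<star> \<gamma>2) (l2 - 1) * char_inv \<alpha> l1) ^ r"
proof -
  interpret finite_subfield_add_char "ext_field r :: 'a alg_closure set" \<psi>
    using finite_subfield_ext_field[OF r] \<psi>
    by (simp add: finite_subfield_add_char_def finite_subfield_add_char_axioms_def)
  have chars: "\<alpha> \<in> mult_chars UNIV" "\<beta> \<in> mult_chars UNIV" "\<gamma>1 \<in> mult_chars UNIV" "\<gamma>2 \<in> mult_chars UNIV"
    by (simp_all add: \<alpha>_def \<beta>_def \<gamma>1_def \<gamma>2_def phid_char)
  have lift: "chi r (m * a) = char_lift r \<alpha>" "chi r (m * b) = char_lift r \<beta>"
    "chi r (m * c1) = char_lift r \<gamma>1" "chi r (m * c2) = char_lift r \<gamma>2"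
    by (simp_all add: chi_def \<alpha>_def \<beta>_def \<gamma>1_def \<gamma>2_def)
  \<comment> \<open>Subtracting 0 fits the comparison with the trivial character
    \<open>chi r 0\<close>.\<close>
  have cop: "coprime (int d) (int a - int 0)" "coprime (int d) (int b - int 0)"
    "coprime (int d) (int c1 - int a)" "coprime (int d) (int c1 - int b)"
    "coprime (int d) (int c2 - int b)"
    using gcds by (simp_all add: coprime_iff_gcd_eq_1)
  have ne: "char_lift r \<alpha> \<noteq> \<epsilon>" "char_lift r \<beta> \<noteq> \<epsilon>" "char_lift r \<alpha> \<noteq> char_lift r \<gamma>1"
    "char_lift r \<beta> \<noteq> char_lift r \<gamma>2" "char_lift r \<beta> \<noteq> char_lift r \<gamma>1"
    using chi_eq_imp_dvd[where m = m, OF r _ cop(1)] chi_eq_imp_dvd[where m = m, OF r _ cop(2)] chi_eq_imp_dvd[where m = m, OF r _ cop(3)]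
      chi_eq_imp_dvd[where m = m, OF r _ cop(4)] chi_eq_imp_dvd[where m = m, OF r _ cop(5)] m
    unfolding lift mult_0_right chi_0[OF r] by metis+
  have ne_base: "\<alpha> \<noteq> triv_char UNIV" "\<beta> \<noteq> triv_char UNIV" "char_inv \<alpha> \<star> \<gamma>1 \<noteq> triv_char UNIV"
    "char_inv \<beta> \<star> \<gamma>2 \<noteq> triv_char UNIV" "\<beta> \<star> char_inv \<gamma>1 \<noteq> triv_char UNIV"
  proof -
    show "\<alpha> \<noteq> triv_char UNIV" "\<beta> \<noteq> triv_char UNIV"
      using ne(1,2) char_lift_triv[OF r] by auto
    show "char_inv \<alpha> \<star> \<gamma>1 \<noteq> triv_char UNIV" "char_inv \<beta> \<star> \<gamma>2 \<noteq> triv_char UNIV"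
      "\<beta> \<star> char_inv \<gamma>1 \<noteq> triv_char UNIV"
      using ne(3-5) chars by (auto simp: base.char_mult_eq_triv_iff) (metis base.char_inv_inv)
  qed
  have HD: "jacobi (ext_field r) (char_lift r \<eta>) (char_lift r \<theta>) = jacobi UNIV \<eta> \<theta> ^ r"
    if "\<eta> \<in> mult_chars UNIV" "\<theta> \<in> mult_chars UNIV" "\<theta> \<noteq> triv_char UNIV" for \<eta> \<theta>
    using that r by (intro jacobi_char_lift)
  have jac: "jacobi (ext_field r) (char_lift r \<alpha>) (char_lift r (char_inv \<alpha> \<star> \<gamma>1)) =
      jacobi UNIV \<alpha> (char_inv \<alpha> \<star> \<gamma>1) ^ r"
    "jacobi (ext_field r) (char_lift r \<beta>) (char_lift r (char_inv \<beta> \<star> \<gamma>2)) =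
      jacobi UNIV \<beta> (char_inv \<beta> \<star> \<gamma>2) ^ r"
    "jacobi (ext_field r) (char_lift r (\<alpha> \<star> char_inv \<gamma>2)) (char_lift r (\<beta> \<star> char_inv \<gamma>1)) =
      jacobi UNIV (\<alpha> \<star> char_inv \<gamma>2) (\<beta> \<star> char_inv \<gamma>1) ^ r"
    "jacobi (ext_field r) (char_lift r (char_inv (\<alpha> \<star> \<beta>) \<star> \<gamma>1 \<star> \<gamma>2)) (char_lift r \<beta>) =
      jacobi UNIV (char_inv (\<alpha> \<star> \<beta>) \<star> \<gamma>1 \<star> \<gamma>2) \<beta> ^ r"
    "jacobi (ext_field r) (char_lift r (char_inv (\<alpha> \<star> \<beta>) \<star> \<gamma>1 \<star> \<gamma>2)) (char_lift r \<alpha>) =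
      jacobi UNIV (char_inv (\<alpha> \<star> \<beta>) \<star> \<gamma>1 \<star> \<gamma>2) \<alpha> ^ r"
    using chars ne_base by (intro HD; simp)+
  have ev: "char_lift r (\<alpha> \<star> \<beta>) (-1) = (\<alpha> \<star> \<beta>) (-1) ^ r"
    "char_lift r (char_inv \<alpha> \<star> \<gamma>1) (to_ac l1 - 1) = (char_inv \<alpha> \<star> \<gamma>1) (l1 - 1) ^ r"
    "char_lift r (char_inv \<beta> \<star> \<gamma>2) (to_ac l2 - 1) = (char_inv \<beta> \<star> \<gamma>2) (l2 - 1) ^ r"
    using chars char_lift_to_ac[of "\<alpha> \<star> \<beta>" r "-1"] char_lift_to_ac[of "char_inv \<alpha> \<star> \<gamma>1" r "l1 - 1"]
      char_lift_to_ac[of "char_inv \<beta> \<star> \<gamma>2" r "l2 - 1"] by simp_all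
  have ev': "char_lift r (char_inv \<eta>) (to_ac x) = char_inv \<eta> x ^ r" if "\<eta> \<in> mult_chars UNIV" for \<eta> x
    using that by (intro char_lift_to_ac) simp
  have K: "to_ac l1 \<in> ext_field r - {0, 1}" "to_ac l2 \<in> ext_field r - {0, 1}"
    using l by simp_all
  have z: "to_ac (l1 * (1 - l2)) = to_ac l1 * (1 - to_ac l2)"
    "to_ac (l2 * (1 - l1)) = to_ac l2 * (1 - to_ac l1)" by simp_all
  have in_chars: "char_lift r \<alpha> \<in> chars" "char_lift r \<beta> \<in> chars" "char_lift r \<gamma>1 \<in> chars" "char_lift r \<gamma>2 \<in> chars"
    using chars r by (simp_all add: char_lift_in)
  have count: "twisted_count (S4 rep d (int a) (int b) (int c1) (int c2) l1 l2) frob3 (mu d) mu_act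
      (\<lambda>\<xi>. restrict \<phi> (mu d) \<xi> ^ m) r =
    surface_sum (chi r (m * a)) (chi r (m * b)) (chi r (m * c1)) (chi r (m * c2)) (to_ac l1) (to_ac l2)"
    by (rule twisted_count_eq_surface_sum[OF r m]) (rule rep)
  show ?thesis
    unfolding count lift z
      surface_sum_appell_F4[OF in_chars ne(1-4) K]
    unfolding char_lift_mult[symmetric] char_lift_inv[symmetric] jac ev
      ev'[OF chars(1)] ev'[OF chars(2)] ev'[OF chars(3)] ev'[OF chars(4)]
      power_mult_distrib ..
qed

text \<open>Every pair (x1, x2) contributes 1, over zeros of P because d divides m and elsewhere
  because values of \<phi>d have d-th power 1. So the number of pairs remains, whatever the
  representatives.\<close>

lemma twisted_count_S4_trivial:
  fixes l1 l2 :: 'a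
  assumes r: "r \<ge> 1" and m: "d dvd m"
  shows "twisted_count (S4 rep d a' b' c1' c2' l1 l2) frob3 (mu d) mu_act
      (\<lambda>\<xi>. restrict \<phi> (mu d) \<xi> ^ m) r = (of_nat CARD('a) ^ 2) ^ r"
proof -
  interpret finite_subfield "ext_field r :: 'a alg_closure set"
    using r by (rule finite_subfield_ext_field)
  define P where "P x1 x2 = x1 ^ rep a' * x2 ^ rep b' * (1 - x1) ^ rep (c1' - a') *
      (1 - x2) ^ rep (c2' - b') * (1 - to_ac l1 * x1) ^ rep (a' - c1' - c2') *
      (1 - to_ac l2 * x2) ^ rep (b' - c1' - c2') *
      (1 - to_ac l1 * x1 - to_ac l2 * x2) ^ rep (c1' + c2' - a' - b')" for x1 x2
  have "S4 rep d a' b' c1' c2' l1 l2 = {(x1, x2, y). y ^ d = P x1 x2}"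
    by (simp add: S4_def P_def)
  then have "twisted_count (S4 rep d a' b' c1' c2' l1 l2) frob3 (mu d) mu_act
      (\<lambda>\<xi>. restrict \<phi> (mu d) \<xi> ^ m) r = (\<Sum>(x1, x2)\<in>ext_field r \<times> ext_field r.
      if P x1 x2 = 0 then (if d dvd m then 1 else 0) else char_lift r \<phi>d (P x1 x2) ^ m)"
    using twisted_count_surface[OF r, of P m] by (simp add: P_def)
  also have "\<dots> = (\<Sum>(x1, x2)\<in>(ext_field r :: 'a alg_closure set) \<times> (ext_field r :: 'a alg_closure set). 1)"
  proof (rule sum.cong[OF refl], clarify)
    fix x1 x2 :: "'a alg_closure" assume x: "x1 \<in> ext_field r" "x2 \<in> ext_field r"
    then have P: "P x1 x2 \<in> ext_field r" by (simp add: P_def)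
    obtain t where t: "m = d * t" using m by (elim dvdE)
    have "char_lift r \<phi>d (P x1 x2) ^ m = 1" if "P x1 x2 \<noteq> 0"
      unfolding t power_mult using that P ext_norm_eq_0_iff[OF P] by (simp add: char_lift_def phid_power_d)
    then show "(if P x1 x2 = 0 then (if d dvd m then 1 else 0) else char_lift r \<phi>d (P x1 x2) ^ m) = 1"
      using m by simp
  qed
  also have "\<dots> = (of_nat CARD('a) ^ 2) ^ r"
    by (simp add: case_prod_unfold card_cartesian_product card_ext_field(1)[OF r] power2_eq_square power_mult_distrib)
  finally show ?thesis .
qed

end

text \<open>A nonzero residue is already positive, so away from multiples of d the representative
  \<open>res\<close> satisfies what \<open>twisted_count_S4\<close> asks for.\<close>

lemma res_props:
  assumes "d > 0" "\<not> int d dvd j"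
  shows "res d j > 0 \<and> int d dvd int (res d j) - j"
proof -
  have "j mod int d > 0"
    using assms by (metis dvd_eq_mod_eq_0 of_nat_0_less_iff order_le_less pos_mod_sign)
  moreover have "int (res d j) = j mod int d" using assms(1) by (simp add: res_def)
  ultimately show ?thesis by (simp add: res_def mod_eq_dvd_iff[symmetric])
qed

lemma pos_res_props:
  assumes "d > 0"
  shows "pos_res d j > 0 \<and> int d dvd int (pos_res d j) - j"
  using assms res_props[of d j] by (auto simp: pos_res_def)

theorem corollary4p14:
  fixes d a b c1 c2 m :: nat
    and l1 l2 :: "'a::{field,finite}"
    and \<phi> :: "'a \<Rightarrow> Qbar"
    and \<psi> :: "nat \<Rightarrow> 'a alg_closure \<Rightarrow> Qbar"
  assumes pos: "d > 0" "a > 0" "b > 0" "c1 > 0" "c2 > 0"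
    and d: "d dvd CARD('a) - 1"
    and l: "l1 \<notin> {0, 1}" "l2 \<notin> {0, 1}"
    and \<phi>: "mult_char_generator UNIV \<phi>"
    and \<psi>: "\<And>r. r \<ge> 1 \<Longrightarrow> nontriv_add_char (ext_field r) (\<psi> r)"
    and gcds: "gcd (int d) (int a) = 1" "gcd (int d) (int b) = 1"
      "gcd (int d) (int c1 - int a) = 1" "gcd (int d) (int c2 - int a) = 1"
      "gcd (int d) (int c1 - int b) = 1" "gcd (int d) (int c2 - int b) = 1"
  shows
    "let \<phi>d = char_pow UNIV \<phi> ((CARD('a) - 1) div d);
         \<chi> = restrict \<phi> (mu d);
         \<alpha> = char_pow UNIV \<phi>d (m * a);
         \<beta> = char_pow UNIV \<phi>d (m * b);
         \<gamma>1 = char_pow UNIV \<phi>d (m * c1);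
         \<gamma>2 = char_pow UNIV \<phi>d (m * c2);
         f = (\<lambda>r. appell_F4 (ext_field r) (\<psi> r)
           (char_pow (ext_field r) (char_lift r \<phi>d) (m * a))
           (char_pow (ext_field r) (char_lift r \<phi>d) (m * b))
           (char_pow (ext_field r) (char_lift r \<phi>d) (m * c1))
           (char_pow (ext_field r) (char_lift r \<phi>d) (m * c2))
           (to_ac (l1 * (1 - l2))) (to_ac (l2 * (1 - l1))));
         J = jacobi UNIV \<alpha> (char_inv \<alpha> \<star> \<gamma>1) * jacobi UNIV \<beta> (char_inv \<beta> \<star> \<gamma>2);
         S0 = (\<alpha> \<star> \<beta>) (-1) * jacobi UNIV (\<alpha> \<star> char_inv \<gamma>2) (\<beta> \<star> char_inv \<gamma>1) *
           char_inv \<gamma>1 l1 * char_inv \<gamma>2 l2;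
         S1 = jacobi UNIV (char_inv (\<alpha> \<star> \<beta>) \<star> \<gamma>1 \<star> \<gamma>2) \<beta> *
           char_inv \<gamma>1 l1 * (char_inv \<alpha> \<star> \<gamma>1) (l1 - 1) * char_inv \<beta> l2;
         S2 = jacobi UNIV (char_inv (\<alpha> \<star> \<beta>) \<star> \<gamma>1 \<star> \<gamma>2) \<alpha> *
           char_inv \<gamma>2 l2 * (char_inv \<beta> \<star> \<gamma>2) (l2 - 1) * char_inv \<alpha> l1;
         L = (\<lambda>rep. artin_L (S4 rep d (int a) (int b) (int c1) (int c2) l1 l2)
           frob3 (mu d) mu_act (\<lambda>\<xi>. \<chi> \<xi> ^ m));
         R = (if d dvd m then inverse (1 - fps_const (of_nat CARD('a) ^ 2) * fps_X)
           else exp_series (\<lambda>r. J ^ r * f r) *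
             (\<Prod>S\<leftarrow>[S0, S1, S2]. inverse (1 - fps_const S * fps_X)))
     in (d dvd m \<or>
          (\<not> int d dvd int a - int c1 - int c2 \<and>
           \<not> int d dvd int b - int c1 - int c2 \<and>
           \<not> int d dvd int c1 + int c2 - int a - int b) \<longrightarrow> L (res d) = R) \<and>
        L (pos_res d) = R"
proof -
  interpret kummer d \<phi>
    using d pos(1) \<phi> by unfold_locales
  define \<alpha> \<beta> \<gamma>1 \<gamma>2 where defs: "\<alpha> = char_pow UNIV \<phi>d (m * a)" "\<beta> = char_pow UNIV \<phi>d (m * b)"
    "\<gamma>1 = char_pow UNIV \<phi>d (m * c1)" "\<gamma>2 = char_pow UNIV \<phi>d (m * c2)"
  define J S0 S1 S2 where JS:
    "J = jacobi UNIV \<alpha> (char_inv \<alpha> \<star> \<gamma>1) * jacobi UNIV \<beta> (char_inv \<beta> \<star> \<gamma>2)"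
    "S0 = (\<alpha> \<star> \<beta>) (-1) * jacobi UNIV (\<alpha> \<star> char_inv \<gamma>2) (\<beta> \<star> char_inv \<gamma>1) *
      char_inv \<gamma>1 l1 * char_inv \<gamma>2 l2"
    "S1 = jacobi UNIV (char_inv (\<alpha> \<star> \<beta>) \<star> \<gamma>1 \<star> \<gamma>2) \<beta> *
      char_inv \<gamma>1 l1 * (char_inv \<alpha> \<star> \<gamma>1) (l1 - 1) * char_inv \<beta> l2"
    "S2 = jacobi UNIV (char_inv (\<alpha> \<star> \<beta>) \<star> \<gamma>1 \<star> \<gamma>2) \<alpha> *
      char_inv \<gamma>2 l2 * (char_inv \<beta> \<star> \<gamma>2) (l2 - 1) * char_inv \<alpha> l1"
  define f where "f = (\<lambda>r. appell_F4 (ext_field r) (\<psi> r)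
     (char_pow (ext_field r) (char_lift r \<phi>d) (m * a))
     (char_pow (ext_field r) (char_lift r \<phi>d) (m * b))
     (char_pow (ext_field r) (char_lift r \<phi>d) (m * c1))
     (char_pow (ext_field r) (char_lift r \<phi>d) (m * c2))
     (to_ac (l1 * (1 - l2))) (to_ac (l2 * (1 - l1))))"
  define L where "L rep = artin_L (S4 rep d (int a) (int b) (int c1) (int c2) l1 l2)
     frob3 (mu d) mu_act (\<lambda>\<xi>. restrict \<phi> (mu d) \<xi> ^ m)" for rep
  define R where "R = (if d dvd m then inverse (1 - fps_const (of_nat CARD('a) ^ 2) * fps_X)
     else exp_series (\<lambda>r. J ^ r * f r) *
       (\<Prod>S\<leftarrow>[S0, S1, S2]. inverse (1 - fps_const S * fps_X)))"
  let ?T = "{int a, int b, int c1 - int a, int c2 - int b, int a - int c1 - int c2,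
    int b - int c1 - int c2, int c1 + int c2 - int a - int b}"
  have triv: "L rep = R" if "d dvd m" for rep
  proof -
    have "L rep = exp_series (\<lambda>r. (of_nat CARD('a) ^ 2) ^ r)"
      unfolding L_def artin_L_def using that by (intro exp_series_cong twisted_count_S4_trivial)
    then show ?thesis using that by (simp add: R_def exp_series_power)
  qed
  have main: "L rep = R" if m: "\<not> d dvd m"
    and rep: "\<And>j. j \<in> ?T \<Longrightarrow> rep j > 0 \<and> int d dvd int (rep j) - j" for rep
  proof -
    have "L rep = exp_series (\<lambda>r. J ^ r * f r + S0 ^ r + S1 ^ r + S2 ^ r)"
      unfolding L_def artin_L_def
    proof (rule exp_series_cong)
      fix r :: nat assume r: "r \<ge> 1"
      show "twisted_count (S4 rep d (int a) (int b) (int c1) (int c2) l1 l2) frob3 (mu d) mu_act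
          (\<lambda>\<xi>. restrict \<phi> (mu d) \<xi> ^ m) r = J ^ r * f r + S0 ^ r + S1 ^ r + S2 ^ r"
        unfolding JS defs f_def char_lift_pow[OF r phid_char]
        by (rule twisted_count_S4[OF r m _ l \<psi>[OF r] gcds(1-3,5,6)]) (rule rep)
    qed
    then show ?thesis using m by (simp add: R_def exp_series_add exp_series_power mult.assoc)
  qed
  have "L (pos_res d) = R"
  proof (cases "d dvd m")
    case False
    then show ?thesis by (rule main) (rule pos_res_props[OF pos(1)])
  qed (rule triv)
  moreover have "L (res d) = R"
    if "d dvd m \<or> (\<not> int d dvd int a - int c1 - int c2 \<and> \<not> int d dvd int b - int c1 - int c2 \<and>
      \<not> int d dvd int c1 + int c2 - int a - int b)"
  proof (cases "d dvd m")
    case False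
    \<comment> \<open>For d = 1 coprimality would not exclude divisibility. Here d > 1, so the gcd
      conditions ensure that d divides none of a, b, c1 - a, c2 - b.\<close>
    then have "int d \<noteq> 1" by auto
    then have ndvd: "\<not> int d dvd j" if "gcd (int d) j = 1" for j
      using that gcd_proj1_if_dvd_int[of "int d" j] by auto
    have "\<not> int d dvd j" if "j \<in> ?T" for j
      using that \<open>d dvd m \<or> _\<close> False ndvd[OF gcds(1)] ndvd[OF gcds(2)] ndvd[OF gcds(3)]
        ndvd[OF gcds(6)] by auto
    then show ?thesis using res_props[OF pos(1)] by (intro main[OF False]) simp
  qed (rule triv)
  ultimately show ?thesis
    unfolding Let_def L_def[symmetric] \<phi>d_def[unfolded k_def, symmetric]
      defs[symmetric] JS[symmetric] R_def[unfolded f_def, symmetric]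
    by blast
qed

end
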